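(* As $k\to\infty$, \[ R(3,k)\geq \Big(\frac{1}{3}+o(1)\Big)\frac{k^2}{\log k}. \] Equivalently, for every $\varepsilon>0$ and all sufficiently large $k$, there exists a triangle-free graph on at least $(1/3-\varepsilon)k^2/\log k$ vertices containing no independent set of size $k$.
   Context: $R(3,k)$ denotes the Ramsey number: the least $n$ such that every graph on $n$ vertices contains either a triangle or an independent set of size $k$. Logarithms are natural. *)

theory Defs
  imports Complex_Main
begin

definition simple_graph :: "'a set \<Rightarrow> ('a \<Rightarrow> 'a \<Rightarrow> bool) \<Rightarrow> bool" where
  "simple_graph V E \<longleftrightarrow> (\<forall>x\<in>V. \<forall>y\<in>V. E x y \<longleftrightarrow> E y x) \<and> (\<forall>x\<in>V. \<not> E x x)"

definition has_triangle :: "'a set \<Rightarrow> ('a \<Rightarrow> 'a \<Rightarrow> bool) \<Rightarrow> bool" where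
  "has_triangle V E \<longleftrightarrow> (\<exists>x\<in>V. \<exists>y\<in>V. \<exists>z\<in>V. E x y \<and> E y z \<and> E x z)"

definition independent_set :: "'a set \<Rightarrow> ('a \<Rightarrow> 'a \<Rightarrow> bool) \<Rightarrow> 'a set \<Rightarrow> bool" where
  "independent_set V E S \<longleftrightarrow> S \<subseteq> V \<and> (\<forall>x\<in>S. \<forall>y\<in>S. \<not> E x y)"

definition has_indep_set_of_size :: "'a set \<Rightarrow> ('a \<Rightarrow> 'a \<Rightarrow> bool) \<Rightarrow> nat \<Rightarrow> bool" where
  "has_indep_set_of_size V E k \<longleftrightarrow> (\<exists>S. independent_set V E S \<and> finite S \<and> card S = k)"

definition R3 :: "nat \<Rightarrow> nat" where
  "R3 k = (LEAST n. \<forall>E :: nat \<Rightarrow> nat \<Rightarrow> bool. simple_graph {..<n} E \<longrightarrow>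
              has_triangle {..<n} E \<or> has_indep_set_of_size {..<n} E k)"

end

theory Submission
  imports Defs "HOL-Probability.Probability" "HOL-Real_Asymp.Real_Asymp" "HOL-Library.Ramsey"
begin

text \<open>
  The construction is a union of two random blow-ups ("two bites"); it even gives \<open>R(3,k) > n\<close> for
  \<open>n = \<lfloor>k\<^sup>2 / (3 log k)\<rfloor>\<close>. Let \<open>m\<close> be smaller than \<open>n\<close> by a power of \<open>log k\<close>. Map \<open>[n]\<close> to \<open>[m]\<close> at random in
  two independent ways (the rows and the columns) and pull back two independent random graphs on \<open>[m]\<close>
  of density \<open>p = \<beta> log k / k\<close> with \<open>\<beta> = 61/50\<close>; call the edges red and blue. Since \<open>m p\<^sup>2 = o(1)\<close>, few
  edges have a common neighbour in one given colour, so triangles can be destroyed cheaply: in each base graph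
  remove a maximal family of edge-disjoint triangles, and drop every red edge whose ends have a common blue
  neighbour and vice versa.

  A \<open>k\<close>-set \<open>I\<close> can lose many edges only inside the few neighbourhoods that contain a large part
  of it. Let \<open>u k\<close> and \<open>v k\<close> points of \<open>I\<close> lie in such red and blue neighbourhoods, and let \<open>x k\<close> and \<open>y k\<close>
  be the numbers of rows and columns met by the other points, so \<open>x \<le> 1 - u\<close>, \<open>y \<le> 1 - v\<close>.
  There are about \<open>k^((x + y - 1) k)\<close> such sets, and each is independent with probability about
  \<open>k^(- \<beta> (x\<^sup>2 + y\<^sup>2 - S) k / 2)\<close>, where \<open>S\<close> is the sum of the squares of the pieces cut out by single
  neighbourhoods. As \<open>S \<le> u\<^sup>2 + v\<^sup>2 \<le> (1 - x)\<^sup>2 + (1 - y)\<^sup>2\<close>, the exponent \<open>x\<^sup>2 + y\<^sup>2 - S\<close> is at least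
  \<open>2 (x + y - 1)\<close>, so any \<open>\<beta> > 1\<close> suffices for the union bound as long as a neighbourhood holds
  less than half of \<open>I\<close>.
\<close>

text \<open>The obstacle is dependence: which red edges survive inside \<open>I\<close> depends on
  the blue graph, and conversely. The way out is to record, for each colour, which heavy
  neighbourhood, if any, is responsible for each point of \<open>I\<close>. Only polylogarithmically
  many vertices are heavy, so there are \<open>exp (o(k log k))\<close> such records and a union
  bound over them costs nothing at the scale of the main terms. With both records fixed,
  independence of \<open>I\<close> in a typical graph forces one condition on the red map and graph
  and one on the blue map and graph; these are independent events, so their probabilities multiply.
  Edges that the records do not explain, on exceptional pairs or in removed triangles, number at
  most a tiny multiple of \<open>k log k\<close>, which the lower tail absorbs.

  The constant 1/3 enters through \<open>n p = (61/150) k\<close>, which keeps a neighbourhood below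
  \<open>(9/20) k\<close> and so below half of \<open>I\<close>; moreover \<open>3 > e\<close> gives
  at most \<open>k^k\<close> sets. The density is well above 1 because the lower tail is taken at a
  fixed exponent and keeps only the fraction \<open>1 - exp (- 3)\<close> of the expected number of
  edges.\<close>

abbreviation "expct \<equiv> measure_pmf.expectation"
abbreviation "prb \<equiv> measure_pmf.prob"

subsection \<open>Expectations over finite product measures\<close>

text \<open>Every measure below has finite support. Expectations are then finite sums, so that
  monotonicity, additivity and exchange of order come without integrability conditions.\<close>

lemma expectation_finite:
  fixes f :: "'a \<Rightarrow> real"
  assumes "finite (set_pmf P)"
  shows "expct P f = (\<Sum>x\<in>set_pmf P. pmf P x * f x)"
  using integral_measure_pmf[OF assms, of P f] by simp

lemma expectation_mono_finite:
  fixes f :: "'a \<Rightarrow> real"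
  assumes "finite (set_pmf P)" "\<And>x. x \<in> set_pmf P \<Longrightarrow> f x \<le> g x"
  shows "expct P f \<le> expct P g"
  unfolding expectation_finite[OF assms(1)] using assms(2)
  by (intro sum_mono mult_left_mono) auto

lemma expectation_le_const:
  fixes f :: "'a \<Rightarrow> real"
  assumes "finite (set_pmf P)" "\<And>x. x \<in> set_pmf P \<Longrightarrow> f x \<le> c"
  shows "expct P f \<le> c"
  using expectation_mono_finite[OF assms(1), of f "\<lambda>_. c"] assms(2) by simp

lemma expectation_sum_finite:
  fixes f :: "'b \<Rightarrow> 'a \<Rightarrow> real"
  assumes "finite (set_pmf P)"
  shows "expct P (\<lambda>x. \<Sum>i\<in>S. f i x) = (\<Sum>i\<in>S. expct P (f i))"
  unfolding expectation_finite[OF assms] sum_distrib_left by (rule sum.swap)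

lemma expectation_add_finite:
  fixes f :: "'a \<Rightarrow> real"
  assumes "finite (set_pmf P)"
  shows "expct P (\<lambda>x. f x + g x) = expct P f + expct P g"
  unfolding expectation_finite[OF assms] by (simp add: algebra_simps sum.distrib)

lemma prob_eq_expectation: "prb P S = expct P (indicator S)"
  by simp

lemma prob_le_expectation:
  assumes "finite (set_pmf P)" "\<And>x. x \<in> set_pmf P \<Longrightarrow> 0 \<le> f x"
    "\<And>x. x \<in> set_pmf P \<Longrightarrow> x \<in> S \<Longrightarrow> 1 \<le> f x"
  shows "prb P S \<le> expct P f"
  unfolding prob_eq_expectation using assms
  by (intro expectation_mono_finite) (auto simp: indicator_def)

text \<open>Facts such as the absence of loops or \<open>r i < m\<close> hold only on the support,
  so inclusions between events are compared there.\<close>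

lemma prob_mono_support:
  assumes "\<And>x. x \<in> set_pmf P \<Longrightarrow> x \<in> S \<Longrightarrow> x \<in> T"
  shows "prb P S \<le> prb P T"
proof -
  have "prb P S = prb P (S \<inter> set_pmf P)" by (simp add: measure_Int_set_pmf)
  also have "\<dots> \<le> prb P T" using assms by (intro measure_pmf.finite_measure_mono) auto
  finally show ?thesis .
qed

lemma prob_UN_le:
  fixes c :: real
  assumes "finite S" "\<And>i. i \<in> S \<Longrightarrow> prb P (B i) \<le> c"
  shows "prb P (\<Union>i\<in>S. B i) \<le> card S * c"
proof -
  have "prb P (\<Union>i\<in>S. B i) \<le> (\<Sum>i\<in>S. prb P (B i))"
    by (rule measure_pmf.finite_measure_subadditive_finite) (use assms in auto)
  also have "\<dots> \<le> card S * c" using sum_bounded_above[of S "\<lambda>i. prb P (B i)" c] assms by simp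
  finally show ?thesis .
qed

lemma prob_exp_markov:
  fixes X :: "'a \<Rightarrow> real"
  assumes "finite (set_pmf P)" "\<And>x. x \<in> set_pmf P \<Longrightarrow> x \<in> S \<Longrightarrow> a \<le> l * X x"
  shows "prb P S \<le> exp (- a) * expct P (\<lambda>x. exp (l * X x))"
proof -
  have "prb P S \<le> expct P (\<lambda>x. exp (- a) * exp (l * X x))"
    using assms by (intro prob_le_expectation) (auto simp flip: exp_add)
  then show ?thesis by simp
qed

lemma expectation_pair_finite:
  fixes f :: "'a \<times> 'b \<Rightarrow> real"
  assumes "finite (set_pmf P)" "finite (set_pmf Q)"
  shows "expct (pair_pmf P Q) f = expct P (\<lambda>x. expct Q (\<lambda>y. f (x, y)))"
proof -
  have fin: "finite (set_pmf (pair_pmf P Q))" using assms by simp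
  have "(\<Sum>z\<in>set_pmf P \<times> set_pmf Q. h z) = (\<Sum>x\<in>set_pmf P. \<Sum>y\<in>set_pmf Q. h (x, y))" for h :: "_ \<Rightarrow> real"
    by (simp add: sum.cartesian_product)
  then show ?thesis
    unfolding expectation_finite[OF fin] expectation_finite[OF assms(1)] expectation_finite[OF assms(2)]
    by (simp add: pmf_pair sum_distrib_left mult.assoc)
qed

lemma expectation_pair_swap:
  fixes f :: "'a \<times> 'b \<Rightarrow> real"
  assumes "finite (set_pmf P)" "finite (set_pmf Q)"
  shows "expct (pair_pmf P Q) f = expct Q (\<lambda>y. expct P (\<lambda>x. f (x, y)))"
  unfolding expectation_pair_finite[OF assms]
  unfolding expectation_finite[OF assms(1)] expectation_finite[OF assms(2)] sum_distrib_left
  by (subst sum.swap) (simp add: mult.left_commute)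

lemma prob_pair_le_fst:
  assumes "finite (set_pmf P)" "finite (set_pmf Q)" "\<And>x. prb Q {y. R x y} \<le> c"
  shows "prb (pair_pmf P Q) {(x, y). R x y} \<le> c"
  unfolding prob_eq_expectation expectation_pair_finite[OF assms(1,2)]
proof (rule expectation_le_const[OF assms(1)])
  fix x
  have "expct Q (\<lambda>y. indicat_real {(x, y). R x y} (x, y)) = prb Q {y. R x y}"
    unfolding prob_eq_expectation by (rule arg_cong[where f = "expct Q"]) (auto simp: indicator_def)
  then show "expct Q (\<lambda>y. indicat_real {(x, y). R x y} (x, y)) \<le> c" using assms(3)[of x] by simp
qed

lemma prob_pair_le_snd:
  assumes "finite (set_pmf P)" "finite (set_pmf Q)" "\<And>y. prb P {x. R x y} \<le> c"
  shows "prb (pair_pmf P Q) {(x, y). R x y} \<le> c"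
  unfolding prob_eq_expectation expectation_pair_swap[OF assms(1,2)]
proof (rule expectation_le_const[OF assms(2)])
  fix y
  have "expct P (\<lambda>x. indicat_real {(x, y). R x y} (x, y)) = prb P {x. R x y}"
    unfolding prob_eq_expectation by (rule arg_cong[where f = "expct P"]) (auto simp: indicator_def)
  then show "expct P (\<lambda>x. indicat_real {(x, y). R x y} (x, y)) \<le> c" using assms(3)[of y] by simp
qed

lemma prob_pair_times:
  assumes "finite (set_pmf P)" "finite (set_pmf Q)"
  shows "prb (pair_pmf P Q) (A \<times> B) = prb P A * prb Q B"
  unfolding prob_eq_expectation expectation_pair_finite[OF assms] by (simp add: indicator_times)

section \<open>Independence in finite product measures\<close>

lemma finite_set_Pi_pmf:
  assumes "finite A" "\<And>x. x \<in> A \<Longrightarrow> finite (set_pmf (P x))"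
  shows "finite (set_pmf (Pi_pmf A d P))"
  unfolding set_Pi_pmf[OF assms(1)] using assms by (intro finite_PiE_dflt) auto

lemma expectation_prod_subset_Pi_pmf:
  fixes h :: "'a \<Rightarrow> 'b \<Rightarrow> real"
  assumes "finite A" "\<And>x. x \<in> A \<Longrightarrow> finite (set_pmf (P x))" "B \<subseteq> A"
    "\<And>x y. x \<in> B \<Longrightarrow> 0 \<le> h x y"
  shows "expct (Pi_pmf A d P) (\<lambda>f. \<Prod>x\<in>B. h x (f x)) = (\<Prod>x\<in>B. expct (P x) (h x))"
proof -
  define h' where "h' x y = (if x \<in> B then h x y else 1)" for x y
  have eq: "(\<Prod>x\<in>B. h x (f x)) = (\<Prod>x\<in>A. h' x (f x))" for f
    using assms by (intro prod.mono_neutral_cong_left) (auto simp: h'_def)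
  have "expct (Pi_pmf A d P) (\<lambda>f. \<Prod>x\<in>A. h' x (f x)) = (\<Prod>x\<in>A. expct (P x) (h' x))"
    using assms by (intro expectation_prod_Pi_pmf) (auto simp: h'_def[abs_def] intro: integrable_measure_pmf_finite)
  also have "\<dots> = (\<Prod>x\<in>B. expct (P x) (h x))"
    using assms by (intro prod.mono_neutral_cong_right) (auto simp: h'_def[abs_def])
  finally show ?thesis by (simp add: eq)
qed

lemma expectation_Pi_pmf_split:
  fixes G :: "('a \<Rightarrow> 'b) \<Rightarrow> real"
  assumes "finite A" "\<And>x. x \<in> A \<Longrightarrow> finite (set_pmf (P x))" "B \<subseteq> A"
  shows "expct (Pi_pmf A d P) G =
    expct (Pi_pmf (A - B) d P) (\<lambda>g. expct (Pi_pmf B d P) (\<lambda>f. G (\<lambda>x. if x \<in> B then f x else g x)))"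
proof -
  have fB: "finite B" using assms finite_subset by blast
  have A: "A = B \<union> (A - B)" using assms by auto
  have "Pi_pmf A d P = map_pmf (\<lambda>(f,g) x. if x \<in> B then f x else g x)
             (pair_pmf (Pi_pmf B d P) (Pi_pmf (A - B) d P))"
    by (subst A, rule Pi_pmf_union) (use fB assms in auto)
  then have "expct (Pi_pmf A d P) G = expct (pair_pmf (Pi_pmf B d P) (Pi_pmf (A - B) d P))
      (\<lambda>(f,g). G (\<lambda>x. if x \<in> B then f x else g x))"
    by (simp add: case_prod_unfold)
  also have "\<dots> = expct (Pi_pmf (A - B) d P) (\<lambda>g. expct (Pi_pmf B d P) (\<lambda>f. G (\<lambda>x. if x \<in> B then f x else g x)))"
    by (subst expectation_pair_swap) (use assms fB in \<open>auto intro!: finite_set_Pi_pmf\<close>)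
  finally show ?thesis .
qed

text \<open>Once the coordinates outside \<open>B\<close> are fixed, so are \<open>F\<close> and the
  targets \<open>W i\<close>, and the coordinates in \<open>B\<close> hit their targets
  independently. The targets may thus depend on the rest of the sample, as when points are required
  to fall into the image of a random set.\<close>

lemma expectation_eliminate:
  fixes F :: "('a \<Rightarrow> 'b) \<Rightarrow> real"
  assumes A: "finite A" "\<And>x. x \<in> A \<Longrightarrow> finite (set_pmf (P x))" "B \<subseteq> A"
    and F: "\<And>f. 0 \<le> F f" "\<And>f g. (\<And>x. x \<notin> B \<Longrightarrow> f x = g x) \<Longrightarrow> F f = F g"
    and W: "\<And>i f g. i \<in> B \<Longrightarrow> (\<And>x. x \<notin> B \<Longrightarrow> f x = g x) \<Longrightarrow> W i f = W i g"
    and w: "\<And>i f. i \<in> B \<Longrightarrow> prb (P i) (W i f) \<le> w i"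
  shows "expct (Pi_pmf A d P) (\<lambda>f. F f * of_bool (\<forall>i\<in>B. f i \<in> W i f)) \<le> (\<Prod>i\<in>B. w i) * expct (Pi_pmf A d P) F"
proof -
  have fB: "finite B" using A finite_subset by blast
  let ?m = "\<lambda>f g x. if x \<in> B then f x else g x"
  have Fm: "F (?m f g) = F g" for f g by (rule F(2)) auto
  have Wm: "W i (?m f g) = W i g" if "i \<in> B" for i f g by (rule W[OF that]) auto
  have inner: "expct (Pi_pmf B d P) (\<lambda>f. F (?m f g) * of_bool (\<forall>i\<in>B. ?m f g i \<in> W i (?m f g)))
      \<le> (\<Prod>i\<in>B. w i) * F g" for g
  proof -
    have "of_bool (\<forall>i\<in>B. ?m f g i \<in> W i (?m f g)) = indicat_real (Pi B (\<lambda>i. W i g)) f" for f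
      using Wm by (auto simp: indicator_def Pi_def)
    then have "expct (Pi_pmf B d P) (\<lambda>f. F (?m f g) * of_bool (\<forall>i\<in>B. ?m f g i \<in> W i (?m f g)))
      = F g * prb (Pi_pmf B d P) (Pi B (\<lambda>i. W i g))" by (simp add: Fm)
    also have "\<dots> = F g * (\<Prod>i\<in>B. prb (P i) (W i g))"
      by (simp only: measure_Pi_pmf_Pi[OF fB])
    also have "\<dots> \<le> F g * (\<Prod>i\<in>B. w i)"
      by (intro mult_left_mono prod_mono conjI F w measure_nonneg)
    finally show ?thesis by (simp only: mult.commute)
  qed
  have "expct (Pi_pmf A d P) (\<lambda>f. F f * of_bool (\<forall>i\<in>B. f i \<in> W i f)) \<le>
      expct (Pi_pmf (A - B) d P) (\<lambda>g. (\<Prod>i\<in>B. w i) * F g)"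
    by (subst expectation_Pi_pmf_split[OF A], assumption, rule expectation_mono_finite[OF finite_set_Pi_pmf])
      (use A inner in auto)
  also have "\<dots> = (\<Prod>i\<in>B. w i) * expct (Pi_pmf A d P) F"
    by (subst expectation_Pi_pmf_split[OF A], assumption) (simp add: Fm)
  finally show ?thesis .
qed

text \<open>Induction on \<open>Z\<close>: the block of one factor is split off, and the remaining
  factors do not see its coordinates.\<close>

lemma expectation_prod_blocks:
  fixes F :: "'c \<Rightarrow> ('a \<Rightarrow> 'b) \<Rightarrow> real"
  assumes A: "finite A" "\<And>x. x \<in> A \<Longrightarrow> finite (set_pmf (P x))" and Z: "finite Z"
    and B: "\<And>z. z \<in> Z \<Longrightarrow> B z \<subseteq> A" "\<And>z z'. z \<in> Z \<Longrightarrow> z' \<in> Z \<Longrightarrow> z \<noteq> z' \<Longrightarrow> B z \<inter> B z' = {}"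
    and F: "\<And>z f g. z \<in> Z \<Longrightarrow> (\<And>x. x \<in> B z \<Longrightarrow> f x = g x) \<Longrightarrow> F z f = F z g"
  shows "expct (Pi_pmf A d P) (\<lambda>f. \<Prod>z\<in>Z. F z f) = (\<Prod>z\<in>Z. expct (Pi_pmf A d P) (F z))"
  using Z B F
proof (induction Z rule: finite_induct)
  case empty
  then show ?case by simp
next
  case (insert z Z)
  let ?B = "B z"
  let ?m = "\<lambda>f g x. if x \<in> ?B then f x else g x"
  have BA: "?B \<subseteq> A" by (rule insert.prems(1)) simp
  let ?G = "\<lambda>f. \<Prod>z\<in>Z. F z f"
  have Fz: "F z (?m f g) = F z f" for f g by (rule insert.prems(3)) auto
  have Gz: "?G (?m f g) = ?G g" for f g
  proof (rule prod.cong[OF refl])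
    fix y assume y: "y \<in> Z"
    then have "B z \<inter> B y = {}" using insert.prems(2)[of z y] insert.hyps(2) by auto
    then show "F y (?m f g) = F y g" using y by (intro insert.prems(3)) auto
  qed
  have split: "expct (Pi_pmf A d P) G = expct (Pi_pmf (A - ?B) d P)
      (\<lambda>g. expct (Pi_pmf ?B d P) (\<lambda>f. G (?m f g)))" for G :: "_ \<Rightarrow> real"
    by (rule expectation_Pi_pmf_split) (use A BA in auto)
  have Fzz: "expct (Pi_pmf A d P) (F z) = expct (Pi_pmf ?B d P) (F z)"
    unfolding split[of "F z"] Fz by simp
  have "expct (Pi_pmf A d P) (\<lambda>f. F z f * ?G f) = expct (Pi_pmf ?B d P) (F z) * expct (Pi_pmf A d P) ?G"
    unfolding split[of "?G"] split[of "\<lambda>f. F z f * ?G f"] Fz Gz by simp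
  moreover have "expct (Pi_pmf A d P) ?G = (\<Prod>z\<in>Z. expct (Pi_pmf A d P) (F z))"
    by (rule insert.IH[OF insert.prems(1) insert.prems(2) insert.prems(3)]) auto
  ultimately show ?case using insert.hyps Fzz by simp
qed

subsection \<open>The random base graph and the random vertex map\<close>

definition edges :: "nat \<Rightarrow> nat set set" where
  "edges m = {{x, y} | x y. x < m \<and> y < m \<and> x \<noteq> y}"

text \<open>A graph is a predicate on sets, which makes adjacency symmetric by construction. The
  default \<open>False\<close> outside \<open>edges m\<close> means that on the support no
  singleton, that is no loop \<open>{z, z}\<close>, is an edge.\<close>

definition gnp :: "nat \<Rightarrow> real \<Rightarrow> (nat set \<Rightarrow> bool) pmf" where
  "gnp m p = Pi_pmf (edges m) False (\<lambda>_. bernoulli_pmf p)"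

definition rmap :: "nat \<Rightarrow> nat \<Rightarrow> (nat \<Rightarrow> nat) pmf" where
  "rmap n m = Pi_pmf {..<n} 0 (\<lambda>_. pmf_of_set {..<m})"

lemma edges_iff: "{x, y} \<in> edges m \<longleftrightarrow> x < m \<and> y < m \<and> x \<noteq> y"
  unfolding edges_def by (auto simp: doubleton_eq_iff)

lemma finite_edges: "finite (edges m)"
proof -
  have "edges m \<subseteq> Pow {..<m}" by (auto simp: edges_def)
  then show ?thesis by (rule finite_subset) simp
qed

lemma finite_set_gnp: "finite (set_pmf (gnp m p))"
  unfolding gnp_def by (rule finite_set_Pi_pmf[OF finite_edges]) (rule finite_subset[of _ UNIV], auto)

lemma finite_set_rmap:
  assumes "0 < m" shows "finite (set_pmf (rmap n m))"
  unfolding rmap_def using assms by (intro finite_set_Pi_pmf) (auto simp: set_pmf_of_set lessThan_empty_iff)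

lemma gnp_support:
  assumes "e \<in> set_pmf (gnp m p)" "e d" shows "d \<in> edges m"
  using assms set_Pi_pmf_subset[OF finite_edges, of m False "\<lambda>_. bernoulli_pmf p"]
  unfolding gnp_def by auto

lemma rmap_support:
  assumes "r \<in> set_pmf (rmap n m)" "i < n" "0 < m" shows "r i < m"
proof -
  have "r \<in> PiE_dflt {..<n} 0 (set_pmf \<circ> (\<lambda>_. pmf_of_set {..<m}))"
    using assms(1) unfolding rmap_def by (simp add: set_Pi_pmf)
  then show ?thesis using assms(2,3) by (auto simp: PiE_dflt_def set_pmf_of_set lessThan_empty_iff)
qed

lemma gnp_prod:
  fixes h :: "nat set \<Rightarrow> bool \<Rightarrow> real"
  assumes "0 \<le> p" "p \<le> 1" "Q \<subseteq> edges m" "\<And>d b. d \<in> Q \<Longrightarrow> 0 \<le> h d b"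
  shows "expct (gnp m p) (\<lambda>e. \<Prod>d\<in>Q. h d (e d)) = (\<Prod>d\<in>Q. p * h d True + (1 - p) * h d False)"
proof -
  have "expct (gnp m p) (\<lambda>e. \<Prod>d\<in>Q. h d (e d)) = (\<Prod>d\<in>Q. expct (bernoulli_pmf p) (h d))"
    unfolding gnp_def
  proof (rule expectation_prod_subset_Pi_pmf[OF finite_edges])
    show "finite (set_pmf (bernoulli_pmf p))" by (rule finite_subset[of _ UNIV]) auto
  qed (use assms in auto)
  also have "\<dots> = (\<Prod>d\<in>Q. p * h d True + (1 - p) * h d False)"
    using assms by (simp add: mult.commute)
  finally show ?thesis .
qed

text \<open>The factor of one pair is \<open>1 + p * (exp l - 1)\<close>, at most
  \<open>exp (p * (exp l - 1))\<close>. The sign of \<open>l\<close> is free: positive values give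
  upper tails, a negative one the lower tail behind the main union bound.\<close>

lemma gnp_exp:
  fixes p l :: real
  assumes "0 \<le> p" "p \<le> 1" "Q \<subseteq> edges m"
  shows "expct (gnp m p) (\<lambda>e. exp (l * card {d\<in>Q. e d})) \<le> exp (p * card Q * (exp l - 1))"
proof -
  have fQ: "finite Q" using assms(3) finite_edges finite_subset by blast
  have "exp (l * card {d\<in>Q. e d}) = (\<Prod>d\<in>Q. if e d then exp l else 1)" for e
  proof -
    have "(\<Prod>d\<in>Q. if e d then exp l else 1) = (\<Prod>d\<in>{d\<in>Q. e d}. exp l)"
      using fQ by (subst prod.inter_filter[symmetric]) auto
    then show ?thesis by (simp add: exp_of_nat2_mult)
  qed
  then have "expct (gnp m p) (\<lambda>e. exp (l * card {d\<in>Q. e d}))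
     = expct (gnp m p) (\<lambda>e. \<Prod>d\<in>Q. (\<lambda>_ b. if b then exp l else 1) d (e d))" by simp
  also have "\<dots> = (\<Prod>d\<in>Q. p * exp l + (1 - p) * 1)"
    by (subst gnp_prod[OF assms]) auto
  also have "\<dots> \<le> (\<Prod>d\<in>Q. exp (p * (exp l - 1)))"
  proof (rule prod_mono)
    fix d
    have "1 + p * (exp l - 1) \<le> exp (p * (exp l - 1))" by (rule exp_ge_add_one_self)
    then have "p * exp l + (1 - p) * 1 \<le> exp (p * (exp l - 1))" by (simp add: algebra_simps)
    moreover have "0 \<le> p * exp l + (1 - p) * 1" using assms by (intro add_nonneg_nonneg) auto
    ultimately show "0 \<le> p * exp l + (1 - p) * 1 \<and> p * exp l + (1 - p) * 1 \<le> exp (p * (exp l - 1))" by simp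
  qed
  also have "\<dots> = exp (p * card Q * (exp l - 1))"
    by (simp add: algebra_simps flip: exp_of_nat_mult)
  finally show ?thesis .
qed

lemma gnp_tail:
  fixes p l a :: real
  assumes "0 \<le> p" "p \<le> 1" "Q \<subseteq> edges m" "\<And>e. e \<in> S \<Longrightarrow> a \<le> l * card {d\<in>Q. e d}"
  shows "prb (gnp m p) S \<le> exp (p * card Q * (exp l - 1) - a)"
proof -
  have "prb (gnp m p) S \<le> exp (- a) * expct (gnp m p) (\<lambda>e. exp (l * card {d\<in>Q. e d}))"
    using assms(4) by (intro prob_exp_markov[OF finite_set_gnp]) auto
  also have "\<dots> \<le> exp (- a) * exp (p * card Q * (exp l - 1))"
    by (intro mult_left_mono gnp_exp assms) auto
  finally show ?thesis by (simp flip: exp_add)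
qed

lemma gnp_all_present:
  fixes p :: real
  assumes "0 \<le> p" "p \<le> 1" "Q \<subseteq> edges m"
  shows "prb (gnp m p) {e. \<forall>d\<in>Q. e d} = p ^ card Q"
proof -
  have fQ: "finite Q" using assms(3) finite_edges finite_subset by blast
  have ind: "indicat_real {e. \<forall>d\<in>Q. e d} = (\<lambda>e. \<Prod>d\<in>Q. of_bool (e d))"
    using fQ by (intro ext) (auto simp: indicator_def intro!: prod.neutral)
  have "prb (gnp m p) {e. \<forall>d\<in>Q. e d} = expct (gnp m p) (\<lambda>e. \<Prod>d\<in>Q. (\<lambda>_. of_bool) d (e d))"
    unfolding prob_eq_expectation ind by (rule refl)
  also have "\<dots> = p ^ card Q" by (subst gnp_prod[OF assms]) auto
  finally show ?thesis .
qed

lemma rmap_prob_one: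
  fixes m :: nat
  assumes "0 < m" shows "prb (pmf_of_set {..<m}) S = card ({..<m} \<inter> S) / m"
  using assms by (subst measure_pmf_of_set) (auto simp: lessThan_empty_iff)

lemma rmap_exp:
  fixes l :: real
  assumes "0 < m" "J \<subseteq> {..<n}" "S \<subseteq> {..<m}"
  shows "expct (rmap n m) (\<lambda>r. exp (l * card {i\<in>J. r i \<in> S})) \<le> exp (card J * (card S / m) * (exp l - 1))"
proof -
  let ?U = "pmf_of_set {..<m}"
  have fJ: "finite J" using assms(2) finite_subset by blast
  have fU: "finite (set_pmf ?U)" using assms by (auto simp: set_pmf_of_set lessThan_empty_iff)
  have "exp (l * card {i\<in>J. r i \<in> S}) = (\<Prod>i\<in>J. if r i \<in> S then exp l else 1)" for r :: "nat \<Rightarrow> nat"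
  proof -
    have "(\<Prod>i\<in>J. if r i \<in> S then exp l else 1) = (\<Prod>i\<in>{i\<in>J. r i \<in> S}. exp l)"
      using fJ by (subst prod.inter_filter[symmetric]) auto
    then show ?thesis by (simp add: exp_of_nat2_mult)
  qed
  then have "expct (rmap n m) (\<lambda>r. exp (l * card {i\<in>J. r i \<in> S}))
     = expct (rmap n m) (\<lambda>r. \<Prod>i\<in>J. (\<lambda>_ x. if x \<in> S then exp l else 1) i (r i))" by simp
  also have "\<dots> = (\<Prod>i\<in>J. expct ?U (\<lambda>x. if x \<in> S then exp l else 1))"
    unfolding rmap_def using assms fU by (intro expectation_prod_subset_Pi_pmf) auto
  also have "expct ?U (\<lambda>x. if x \<in> S then exp l else 1) = 1 + card S / m * (exp l - 1)"
  proof -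
    have "expct ?U (\<lambda>x. if x \<in> S then exp l else 1) = expct ?U (\<lambda>x. 1 + (exp l - 1) * indicat_real S x)"
      by (rule arg_cong[where f = "expct ?U"]) (auto simp: indicator_def)
    also have "\<dots> = 1 + (exp l - 1) * prb ?U S"
      by (subst expectation_add_finite[OF fU]) simp
    also have "prb ?U S = card S / m" using assms rmap_prob_one[of m S] by (simp add: Int_absorb1)
    finally show ?thesis by (simp add: mult.commute)
  qed
  also have "(\<Prod>i\<in>J. 1 + card S / m * (exp l - 1)) \<le> (\<Prod>i\<in>J. exp (card S / m * (exp l - 1)))"
  proof (rule prod_mono)
    fix i
    have c: "card S \<le> m" using card_mono[OF _ assms(3)] by simp
    have "0 \<le> 1 - card S / m + card S / m * exp l"
      using assms c by (intro add_nonneg_nonneg) (auto simp: field_simps)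
    then have "0 \<le> 1 + card S / m * (exp l - 1)" by (simp add: right_diff_distrib)
    then show "0 \<le> 1 + card S / m * (exp l - 1) \<and> 1 + card S / m * (exp l - 1) \<le> exp (card S / m * (exp l - 1))"
      using exp_ge_add_one_self[of "card S / m * (exp l - 1)"] by blast
  qed
  also have "\<dots> = exp (card J * (card S / m) * (exp l - 1))"
    by (simp add: algebra_simps flip: exp_of_nat_mult)
  finally show ?thesis .
qed

lemma rmap_tail:
  fixes l a :: real
  assumes "0 < m" "J \<subseteq> {..<n}" "S \<subseteq> {..<m}" "\<And>r. r \<in> R \<Longrightarrow> a \<le> l * card {i\<in>J. r i \<in> S}"
  shows "prb (rmap n m) R \<le> exp (card J * (card S / m) * (exp l - 1) - a)"
proof -
  have "prb (rmap n m) R \<le> exp (- a) * expct (rmap n m) (\<lambda>r. exp (l * card {i\<in>J. r i \<in> S}))"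
    using assms(4) by (intro prob_exp_markov[OF finite_set_rmap]) (auto simp: assms)
  also have "\<dots> \<le> exp (- a) * exp (card J * (card S / m) * (exp l - 1))"
    by (intro mult_left_mono rmap_exp assms) auto
  finally show ?thesis by (simp flip: exp_add)
qed

section \<open>Tails for codegrees, degrees and fibres\<close>

lemma choose_le_pow: "m choose h \<le> m ^ h"
proof -
  have "(m choose h) * 1 \<le> (m choose h) * fact h" by (rule mult_le_mono2) (rule fact_ge_1)
  then show ?thesis using binomial_fact_pow[of m h] by linarith
qed

text \<open>Union over two vertices and \<open>h\<close> common neighbours, which need
  \<open>2 * h\<close> distinct edges. Since \<open>m p^2\<close> tends to 0, each further common
  neighbour costs a small factor, and \<open>h\<close> can be polylogarithmic.\<close>

lemma codegree_tail:
  fixes p :: real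
  assumes "0 \<le> p" "p \<le> 1"
  shows "prb (gnp m p) {e. \<exists>x<m. \<exists>x'<m. x \<noteq> x' \<and> h \<le> card {y. y < m \<and> e {x,y} \<and> e {x',y}}}
     \<le> real m ^ 2 * (m * p\<^sup>2) ^ h"
proof -
  let ?I = "{..<m} \<times> {..<m} \<times> {Y. Y \<subseteq> {..<m} \<and> card Y = h}"
  let ?Q = "\<lambda>x x' Y. (\<lambda>y. {x,y}) ` Y \<union> (\<lambda>y. {x',y}) ` Y"
  let ?B = "\<lambda>(x,x',Y). if x \<noteq> x' \<and> x \<notin> Y \<and> x' \<notin> Y then {e. \<forall>d\<in>?Q x x' Y. e d} else {}"
  have fin: "finite ?I" by (intro finite_cartesian_product) auto
  have one: "prb (gnp m p) (?B i) \<le> p ^ (2 * h)" if "i \<in> ?I" for i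
  proof -
    obtain x x' Y where i: "i = (x,x',Y)" by (cases i)
    show ?thesis
    proof (cases "x \<noteq> x' \<and> x \<notin> Y \<and> x' \<notin> Y")
      case True
      have Q: "?Q x x' Y \<subseteq> edges m" using that True unfolding i by (auto simp: edges_iff)
      have "inj_on (\<lambda>y. {x,y}) Y" "inj_on (\<lambda>y. {x',y}) Y" by (auto simp: inj_on_def doubleton_eq_iff)
      moreover have "(\<lambda>y. {x,y}) ` Y \<inter> (\<lambda>y. {x',y}) ` Y = {}" using True by (auto simp: doubleton_eq_iff)
      moreover have "finite Y" using that unfolding i by (auto intro: finite_subset)
      ultimately have "card (?Q x x' Y) = 2 * h"
        using that unfolding i by (subst card_Un_disjoint) (auto simp: card_image)
      then show ?thesis using True gnp_all_present[OF assms Q] unfolding i by simp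
    next
      case False then show ?thesis using assms unfolding i by auto
    qed
  qed
  have "prb (gnp m p) {e. \<exists>x<m. \<exists>x'<m. x \<noteq> x' \<and> h \<le> card {y. y < m \<and> e {x,y} \<and> e {x',y}}}
    \<le> prb (gnp m p) (\<Union>i\<in>?I. ?B i)"
  proof (rule prob_mono_support)
    fix e assume e: "e \<in> set_pmf (gnp m p)"
      and "e \<in> {e. \<exists>x<m. \<exists>x'<m. x \<noteq> x' \<and> h \<le> card {y. y < m \<and> e {x,y} \<and> e {x',y}}}"
    then obtain x x' where x: "x < m" "x' < m" "x \<noteq> x'" "h \<le> card {y. y < m \<and> e {x,y} \<and> e {x',y}}"
      by blast
    obtain Y where Y: "Y \<subseteq> {y. y < m \<and> e {x,y} \<and> e {x',y}}" "card Y = h"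
      by (rule obtain_subset_with_card_n[OF x(4)])
    have nl: "\<not> e {z, z}" for z using gnp_support[OF e, of "{z,z}"] edges_iff[of z z m] by auto
    \<comment> \<open>There are no loops on the support, so the two stars towards \<open>Y\<close>
      consist of \<open>2 * h\<close> distinct edges.\<close>
    have "x \<notin> Y" "x' \<notin> Y" using Y(1) nl by auto
    moreover have "(x,x',Y) \<in> ?I" using Y x by auto
    ultimately show "e \<in> (\<Union>i\<in>?I. ?B i)" using x Y by (intro UN_I[of "(x,x',Y)"]) auto
  qed
  also have "\<dots> \<le> card ?I * p ^ (2 * h)" by (rule prob_UN_le[OF fin one])
  also have "card ?I = m ^ 2 * (m choose h)"
    by (simp add: card_cartesian_product n_subsets power2_eq_square)
  also have "real (m ^ 2 * (m choose h)) * p ^ (2*h) \<le> real (m ^ 2 * m ^ h) * p ^ (2*h)"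
    using assms choose_le_pow[of m h] by (intro mult_right_mono of_nat_mono mult_le_mono2) auto
  also have "\<dots> = real m ^ 2 * (m * p\<^sup>2) ^ h"
    by (simp add: power_mult_distrib power_mult)
  finally show ?thesis .
qed

lemma degree_tail:
  fixes p l a :: real
  assumes "0 \<le> p" "p \<le> 1" "0 \<le> l"
  shows "prb (gnp m p) {e. \<exists>x<m. a \<le> l * card {y. y < m \<and> e {x,y}}} \<le> m * exp (p * m * (exp l - 1) - a)"
proof -
  have one: "prb (gnp m p) {e. e \<in> set_pmf (gnp m p) \<and> a \<le> l * card {y. y < m \<and> e {x,y}}}
      \<le> exp (p * m * (exp l - 1) - a)" if "x \<in> {..<m}" for x
  proof -
    let ?Q = "(\<lambda>y. {x,y}) ` ({..<m} - {x})"
    have Q: "?Q \<subseteq> edges m" using that by (auto simp: edges_iff)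
    have "card ?Q \<le> card ({..<m} - {x})" by (rule card_image_le) simp
    also have "\<dots> \<le> card {..<m}" by (rule card_mono) auto
    finally have cQ: "card ?Q \<le> m" by simp
    have "prb (gnp m p) {e. e \<in> set_pmf (gnp m p) \<and> a \<le> l * card {y. y < m \<and> e {x,y}}}
      \<le> exp (p * card ?Q * (exp l - 1) - a)"
    proof (rule gnp_tail[OF assms(1,2) Q])
      fix e assume e: "e \<in> {e. e \<in> set_pmf (gnp m p) \<and> a \<le> l * card {y. y < m \<and> e {x,y}}}"
      then have "\<not> e {x}" using gnp_support[of e m p "{x}"] edges_iff[of x x m] by auto
      then have nx: "y \<noteq> x" if "e {x,y}" for y using that by (cases "y = x") auto
      have "{d\<in>?Q. e d} = (\<lambda>y. {x,y}) ` {y\<in>{..<m} - {x}. e {x,y}}" by blast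
      also have "{y\<in>{..<m} - {x}. e {x,y}} = {y. y < m \<and> e {x,y}}" using nx by blast
      finally have "{d\<in>?Q. e d} = (\<lambda>y. {x,y}) ` {y. y < m \<and> e {x,y}}" .
      moreover have "inj_on (\<lambda>y. {x,y}) {y. y < m \<and> e {x,y}}" by (auto simp: inj_on_def doubleton_eq_iff)
      ultimately show "a \<le> l * card {d\<in>?Q. e d}" using e by (simp add: card_image)
    qed
    also have "\<dots> \<le> exp (p * m * (exp l - 1) - a)"
      using assms cQ by (auto intro!: mult_right_mono mult_left_mono)
    finally show ?thesis .
  qed
  have "prb (gnp m p) {e. \<exists>x<m. a \<le> l * card {y. y < m \<and> e {x,y}}}
    \<le> prb (gnp m p) (\<Union>x\<in>{..<m}. {e. e \<in> set_pmf (gnp m p) \<and> a \<le> l * card {y. y < m \<and> e {x,y}}})"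
    by (rule prob_mono_support) auto
  also have "\<dots> \<le> card {..<m} * exp (p * m * (exp l - 1) - a)" by (rule prob_UN_le[OF _ one]) auto
  finally show ?thesis by simp
qed

text \<open>Used twice: with singletons \<open>S x\<close> for the fibres of the vertex map, and
  with neighbourhoods in a base graph for the number of points mapped into them.\<close>

lemma fibre_tail:
  fixes l a \<Delta> :: real
  assumes "0 < m" "0 \<le> l" "\<And>x. x < m \<Longrightarrow> S x \<subseteq> {..<m}" "\<And>x. x < m \<Longrightarrow> card (S x) \<le> \<Delta>"
  shows "prb (rmap n m) {r. \<exists>x<m. a \<le> l * card {i. i < n \<and> r i \<in> S x}} \<le> m * exp (n * (\<Delta> / m) * (exp l - 1) - a)"
proof -
  have one: "prb (rmap n m) {r. a \<le> l * card {i. i < n \<and> r i \<in> S x}}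
      \<le> exp (n * (\<Delta> / m) * (exp l - 1) - a)" if "x \<in> {..<m}" for x
  proof -
    have "prb (rmap n m) {r. a \<le> l * card {i. i < n \<and> r i \<in> S x}}
      \<le> exp (card {..<n} * (card (S x) / m) * (exp l - 1) - a)"
      using that assms by (intro rmap_tail) auto
    also have "\<dots> \<le> exp (n * (\<Delta> / m) * (exp l - 1) - a)"
      using assms that by (auto intro!: mult_right_mono mult_left_mono divide_right_mono)
    finally show ?thesis .
  qed
  have "{r. \<exists>x<m. a \<le> l * card {i. i < n \<and> r i \<in> S x}} = (\<Union>x\<in>{..<m}. {r. a \<le> l * card {i. i < n \<and> r i \<in> S x}})"
    by auto
  also have "prb (rmap n m) \<dots> \<le> card {..<m} * exp (n * (\<Delta> / m) * (exp l - 1) - a)"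
    by (rule prob_UN_le[OF _ one]) auto
  finally show ?thesis by simp
qed

subsection \<open>Edge-disjoint triangles\<close>

definition edges_in :: "nat set \<Rightarrow> nat set set" where
  "edges_in A = {d. d \<subseteq> A \<and> card d = 2}"

lemma edges_in_lessThan: "edges_in {..<m} = edges m"
  unfolding edges_in_def edges_def by (auto simp: card_2_iff)

lemma edges_in_mono: "A \<subseteq> B \<Longrightarrow> edges_in A \<subseteq> edges_in B"
  unfolding edges_in_def by auto

lemma finite_edges_in: "finite A \<Longrightarrow> finite (edges_in A)"
  unfolding edges_in_def by (rule finite_subset[of _ "Pow A"]) auto

lemma image_edges:
  assumes inj: "inj_on r J" and D: "D \<subseteq> edges_in J"
  shows "inj_on ((`) r) D" "r ` J \<subseteq> {..<m} \<Longrightarrow> (`) r ` D \<subseteq> edges m"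
    "card {d\<in>(`) r ` D. e d} = card {d\<in>D. e (r ` d)}"
proof -
  have DJ: "d \<subseteq> J \<and> card d = 2" if "d \<in> D" for d using that D unfolding edges_in_def by blast
  show i: "inj_on ((`) r) D"
  proof (rule inj_onI)
    fix d d' assume "d \<in> D" "d' \<in> D" and eq: "r ` d = r ` d'"
    then have "d \<subseteq> J" "d' \<subseteq> J" using DJ by blast+
    then show "d = d'" using eq inj_on_image_eq_iff[OF inj] by blast
  qed
  show "(`) r ` D \<subseteq> edges m" if rJ: "r ` J \<subseteq> {..<m}"
  proof (rule image_subsetI)
    fix d assume "d \<in> D"
    then have d: "d \<subseteq> J" "card d = 2" using DJ by blast+
    have "inj_on r d" by (rule inj_on_subset[OF inj d(1)])
    then have "card (r ` d) = 2" using d(2) by (simp add: card_image)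
    moreover have "r ` d \<subseteq> {..<m}" using rJ d(1) by blast
    ultimately show "r ` d \<in> edges m" unfolding edges_in_lessThan[symmetric] edges_in_def by simp
  qed
  have "{d\<in>(`) r ` D. e d} = (`) r ` {d\<in>D. e (r ` d)}" by blast
  moreover have "inj_on ((`) r) {d\<in>D. e (r ` d)}" using i by (rule inj_on_subset) blast
  ultimately show "card {d\<in>(`) r ` D. e d} = card {d\<in>D. e (r ` d)}" by (simp add: card_image)
qed

lemma card_edges_in: "finite A \<Longrightarrow> card (edges_in A) = card A choose 2"
  unfolding edges_in_def by (rule n_subsets)

definition triangle_packing :: "nat \<Rightarrow> (nat set \<Rightarrow> bool) \<Rightarrow> nat set set \<Rightarrow> bool" where
  "triangle_packing m e \<T> \<longleftrightarrow> \<T> \<subseteq> {T. T \<subseteq> {..<m} \<and> card T = 3} \<and>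
     (\<forall>T\<in>\<T>. \<forall>d\<in>edges_in T. e d) \<and> (\<forall>T\<in>\<T>. \<forall>T'\<in>\<T>. T \<noteq> T' \<longrightarrow> edges_in T \<inter> edges_in T' = {})"

lemma triangle_packingD:
  assumes "triangle_packing m e \<T>" "T \<in> \<T>"
  shows "T \<subseteq> {..<m}" "card T = 3" "finite T" "\<And>d. d \<in> edges_in T \<Longrightarrow> e d"
    "\<And>T'. T' \<in> \<T> \<Longrightarrow> T \<noteq> T' \<Longrightarrow> edges_in T \<inter> edges_in T' = {}"
proof -
  note * = assms(1)[unfolded triangle_packing_def]
  have "T \<in> {T. T \<subseteq> {..<m} \<and> card T = 3}" by (rule subsetD[OF conjunct1[OF *] assms(2)])
  then show "T \<subseteq> {..<m}" "card T = 3" by simp_all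
  then show "finite T" using finite_subset by blast
  show "e d" if "d \<in> edges_in T" for d
    using conjunct1[OF conjunct2[OF *]] assms(2) that by (meson bspec)
  show "edges_in T \<inter> edges_in T' = {}" if "T' \<in> \<T>" "T \<noteq> T'" for T'
    using conjunct2[OF conjunct2[OF *]] assms(2) that by (meson bspec)
qed

lemma triangle_packingI:
  assumes "\<And>T. T \<in> \<T> \<Longrightarrow> T \<subseteq> {..<m}" "\<And>T. T \<in> \<T> \<Longrightarrow> card T = 3"
    "\<And>T d. T \<in> \<T> \<Longrightarrow> d \<in> edges_in T \<Longrightarrow> e d"
    "\<And>T T'. T \<in> \<T> \<Longrightarrow> T' \<in> \<T> \<Longrightarrow> T \<noteq> T' \<Longrightarrow> edges_in T \<inter> edges_in T' = {}"
  shows "triangle_packing m e \<T>"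
  unfolding triangle_packing_def using assms by (intro conjI ballI impI allI) (simp_all add: subset_iff)

lemma triangle_packing_subset:
  assumes "triangle_packing m e \<T>" "\<S> \<subseteq> \<T>"
  shows "triangle_packing m e \<S>"
  by (rule triangle_packingI) (use assms(2) triangle_packingD[OF assms(1)] in \<open>meson subsetD\<close>)+

lemma triangle_packing_finite: "triangle_packing m e \<T> \<Longrightarrow> finite \<T>"
  unfolding triangle_packing_def by (rule finite_subset[of _ "Pow {..<m}"]) auto

lemma card_three_meeting_le:
  assumes "A \<subseteq> {..<m}"
  shows "card {T. T \<subseteq> {..<m} \<and> card T = 3 \<and> 2 \<le> card (T \<inter> A)} \<le> card A ^ 2 * m"
proof -
  have fA: "finite A" using assms finite_subset by blast
  have "{T. T \<subseteq> {..<m} \<and> card T = 3 \<and> 2 \<le> card (T \<inter> A)} \<subseteq> (\<lambda>(x,y,z). {x,y,z}) ` (A \<times> A \<times> {..<m})"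
  proof
    fix T assume "T \<in> {T. T \<subseteq> {..<m} \<and> card T = 3 \<and> 2 \<le> card (T \<inter> A)}"
    then have T: "T \<subseteq> {..<m}" "card T = 3" "2 \<le> card (T \<inter> A)" by blast+
    obtain d where d: "d \<subseteq> T \<inter> A" "card d = 2"
      by (rule obtain_subset_with_card_n[OF T(3)])
    from d(2) obtain x y where xy: "d = {x,y}" "x \<noteq> y" unfolding card_2_iff by blast
    have fT: "finite T" using T(2) by (intro card_ge_0_finite) simp
    have "card (T - {x,y}) = 1" using T(2) d xy fT by (subst card_Diff_subset) auto
    then obtain z where z: "T - {x,y} = {z}" by (auto simp: card_1_singleton_iff)
    have "T = {x,y,z}" using z d xy by auto
    moreover have "x \<in> A" "y \<in> A" "z < m" using d xy z T(1) by auto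
    ultimately show "T \<in> (\<lambda>(x,y,z). {x,y,z}) ` (A \<times> A \<times> {..<m})" by (intro image_eqI[of _ _ "(x,y,z)"]) auto
  qed
  then have "card {T. T \<subseteq> {..<m} \<and> card T = 3 \<and> 2 \<le> card (T \<inter> A)}
      \<le> card ((\<lambda>(x,y,z). {x,y,z}) ` (A \<times> A \<times> {..<m}))"
    using fA by (intro card_mono) auto
  also have "\<dots> \<le> card (A \<times> A \<times> {..<m})" by (rule card_image_le) (use fA in auto)
  also have "\<dots> = card A ^ 2 * m" by (simp add: card_cartesian_product power2_eq_square)
  finally show ?thesis .
qed

text \<open>Edge-disjoint triangles have distinct edges, so a family of \<open>F\<close> of them is
  present with probability \<open>p ^ (3 * F)\<close>. The families are unordered, and the resulting
  \<open>fact F\<close> makes the bound smaller than any fixed exponential in \<open>F\<close> once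
  \<open>F\<close> is far above the mean; this is what beats the number of k-sets.\<close>

lemma triangle_packing_tail:
  fixes p :: real
  assumes "0 \<le> p" "p \<le> 1" "A \<subseteq> {..<m}"
  shows "prb (gnp m p) {e. \<exists>\<T>. triangle_packing m e \<T> \<and> (\<forall>T\<in>\<T>. 2 \<le> card (T \<inter> A)) \<and> F \<le> card \<T>}
    \<le> (real (card A ^ 2 * m) * p ^ 3) ^ F / fact F"
proof -
  let ?K = "{T. T \<subseteq> {..<m} \<and> card T = 3 \<and> 2 \<le> card (T \<inter> A)}"
  let ?I = "{\<T>. \<T> \<subseteq> ?K \<and> card \<T> = F}"
  let ?B = "\<lambda>\<T>. {e. triangle_packing m e \<T>}"
  have fK: "finite ?K" by (rule finite_subset[of _ "Pow {..<m}"]) auto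
  then have fI: "finite ?I" by (intro finite_subset[of ?I "Pow ?K"]) auto
  have one: "prb (gnp m p) (?B \<T>) \<le> p ^ (3 * F)" if "\<T> \<in> ?I" for \<T>
  proof (cases "\<forall>T\<in>\<T>. \<forall>T'\<in>\<T>. T \<noteq> T' \<longrightarrow> edges_in T \<inter> edges_in T' = {}")
    case True
    let ?Q = "\<Union>T\<in>\<T>. edges_in T"
    have fT: "finite \<T>" using that fK finite_subset by blast
    have K: "finite T \<and> card (edges_in T) = 3" if T: "T \<in> \<T>" for T
    proof -
      have "T \<subseteq> {..<m}" "card T = 3" using that T \<open>\<T> \<in> ?I\<close> by auto
      then show ?thesis using card_edges_in[of T] finite_subset[of T "{..<m}"] by (auto simp: choose_two)
    qed
    have Q: "?Q \<subseteq> edges m"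
      using that edges_in_mono[of _ "{..<m}"] unfolding edges_in_lessThan[symmetric] by blast
    have "card ?Q = (\<Sum>T\<in>\<T>. card (edges_in T))"
      using fT K finite_edges_in True by (intro card_UN_disjoint) auto
    also have "\<dots> = 3 * F" using K that by simp
    finally have "card ?Q = 3 * F" .
    then have "prb (gnp m p) {e. \<forall>d\<in>?Q. e d} = p ^ (3 * F)"
      using gnp_all_present[OF assms(1,2) Q] by simp
    moreover have "prb (gnp m p) (?B \<T>) \<le> prb (gnp m p) {e. \<forall>d\<in>?Q. e d}"
      by (intro measure_pmf.finite_measure_mono) (auto dest: triangle_packingD(4))
    ultimately show ?thesis by simp
  next
    case False
    then have "\<not> triangle_packing m e \<T>" for e using triangle_packingD(5)[of m e \<T>] by metis
    then have "?B \<T> = {}" by simp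
    then show ?thesis using assms by simp
  qed
  have "prb (gnp m p) {e. \<exists>\<T>. triangle_packing m e \<T> \<and> (\<forall>T\<in>\<T>. 2 \<le> card (T \<inter> A)) \<and> F \<le> card \<T>}
      \<le> prb (gnp m p) (\<Union>\<T>\<in>?I. ?B \<T>)"
  proof (rule measure_pmf.finite_measure_mono)
    show "{e. \<exists>\<T>. triangle_packing m e \<T> \<and> (\<forall>T\<in>\<T>. 2 \<le> card (T \<inter> A)) \<and> F \<le> card \<T>}
      \<subseteq> (\<Union>\<T>\<in>?I. ?B \<T>)"
    proof
      fix e assume "e \<in> {e. \<exists>\<T>. triangle_packing m e \<T> \<and> (\<forall>T\<in>\<T>. 2 \<le> card (T \<inter> A)) \<and> F \<le> card \<T>}"
      then obtain \<T> where \<T>: "triangle_packing m e \<T>" "\<forall>T\<in>\<T>. 2 \<le> card (T \<inter> A)" "F \<le> card \<T>" by blast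
      obtain \<S> where \<S>: "\<S> \<subseteq> \<T>" "card \<S> = F"
      by (rule obtain_subset_with_card_n[OF \<T>(3)])
      have "\<S> \<subseteq> ?K"
      proof
        fix T assume "T \<in> \<S>"
        then have "T \<in> \<T>" using \<S>(1) by blast
        then show "T \<in> ?K" using triangle_packingD(1,2)[OF \<T>(1)] \<T>(2) by simp
      qed
      then have "\<S> \<in> ?I" using \<S>(2) by simp
      then show "e \<in> (\<Union>\<T>\<in>?I. ?B \<T>)" using triangle_packing_subset[OF \<T>(1) \<S>(1)] by blast
    qed
  qed simp
  also have "\<dots> \<le> card ?I * p ^ (3 * F)" by (rule prob_UN_le[OF fI one])
  also have "card ?I = card ?K choose F" by (rule n_subsets[OF fK])
  also have "real (card ?K choose F) * p ^ (3 * F) \<le> (real (card A ^ 2 * m) ^ F / fact F) * p ^ (3 * F)"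
  proof (rule mult_right_mono)
    have "(card ?K choose F) * fact F \<le> card ?K ^ F" by (rule binomial_fact_pow)
    also have "\<dots> \<le> (card A ^ 2 * m) ^ F" by (rule power_mono[OF card_three_meeting_le[OF assms(3)]]) simp
    finally have "real ((card ?K choose F) * fact F) \<le> real ((card A ^ 2 * m) ^ F)" by (rule of_nat_mono)
    then show "real (card ?K choose F) \<le> real (card A ^ 2 * m) ^ F / fact F"
      by (simp add: field_simps)
  qed (use assms in simp)
  also have "\<dots> = (real (card A ^ 2 * m) * p ^ 3) ^ F / fact F"
    by (simp add: power_mult_distrib power_mult)
  finally show ?thesis .
qed

lemma ex_maximal_triangle_packing:
  "\<exists>\<T>. triangle_packing m e \<T> \<and> (\<forall>T. T \<subseteq> {..<m} \<longrightarrow> card T = 3 \<longrightarrow> (\<forall>d\<in>edges_in T. e d) \<longrightarrow>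
     (\<exists>T'\<in>\<T>. edges_in T \<inter> edges_in T' \<noteq> {}))"
proof -
  have bnd: "card \<T> \<le> card (Pow {..<m})" if "triangle_packing m e \<T>" for \<T>
    by (rule card_mono) (use triangle_packingD(1)[OF that] in \<open>simp_all add: subset_iff\<close>)
  have "triangle_packing m e {}" by (rule triangle_packingI) simp_all
  \<comment> \<open>A packing of largest size is in particular maximal under inclusion.\<close>
  then obtain \<T> where \<T>: "triangle_packing m e \<T>"
      "\<forall>\<S>. triangle_packing m e \<S> \<longrightarrow> card \<S> \<le> card \<T>"
    using ex_has_greatest_nat[of "triangle_packing m e" "{}" card "Suc (card (Pow {..<m}))"] bnd
    by (meson less_Suc_eq_le)
  have "\<exists>T'\<in>\<T>. edges_in T \<inter> edges_in T' \<noteq> {}"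
    if T: "T \<subseteq> {..<m}" "card T = 3" "\<forall>d\<in>edges_in T. e d" for T
  proof (rule ccontr)
    assume neg: "\<not> (\<exists>T'\<in>\<T>. edges_in T \<inter> edges_in T' \<noteq> {})"
    have "finite T" using T(1) finite_subset by blast
    then have "edges_in T \<noteq> {}" using card_edges_in[of T] T(2) by (auto simp: choose_two)
    then have "T \<notin> \<T>" using neg by blast
    moreover have "triangle_packing m e (insert T \<T>)"
    proof (rule triangle_packingI)
      fix U U' assume "U \<in> insert T \<T>" "U' \<in> insert T \<T>" "U \<noteq> U'"
      then show "edges_in U \<inter> edges_in U' = {}"
        using neg triangle_packingD(5)[OF \<T>(1), of U U'] by (metis Int_commute insertE)
    qed (use T triangle_packingD[OF \<T>(1)] in auto)
    ultimately show False using \<T>(2) triangle_packing_finite[OF \<T>(1)] by force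
  qed
  then show ?thesis using \<T>(1) by blast
qed

definition max_packing :: "nat \<Rightarrow> (nat set \<Rightarrow> bool) \<Rightarrow> nat set set" where
  "max_packing m e = (SOME \<T>. triangle_packing m e \<T> \<and>
     (\<forall>T. T \<subseteq> {..<m} \<longrightarrow> card T = 3 \<longrightarrow> (\<forall>d\<in>edges_in T. e d) \<longrightarrow> (\<exists>T'\<in>\<T>. edges_in T \<inter> edges_in T' \<noteq> {})))"

text \<open>Krivelevich's deletion: removing a maximal family of edge-disjoint triangles destroys all triangles,
  and, unlike the number of triangles, the number of edge-disjoint triangles meeting a \<open>k\<close>-set in an edge
  has an upper tail small enough for a union bound over all \<open>k\<close>-sets.\<close>

definition thin :: "nat \<Rightarrow> (nat set \<Rightarrow> bool) \<Rightarrow> nat set \<Rightarrow> bool" where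
  "thin m e d \<longleftrightarrow> e d \<and> (\<forall>T\<in>max_packing m e. \<not> d \<subseteq> T)"

lemma max_packing: "triangle_packing m e (max_packing m e)"
  and max_packing_meets: "T \<subseteq> {..<m} \<Longrightarrow> card T = 3 \<Longrightarrow> (\<And>d. d \<in> edges_in T \<Longrightarrow> e d) \<Longrightarrow>
     \<exists>T'\<in>max_packing m e. edges_in T \<inter> edges_in T' \<noteq> {}"
  using someI_ex[OF ex_maximal_triangle_packing[of m e], folded max_packing_def] by blast+

text \<open>By maximality a surviving triangle would share an edge with a triangle of the packing,
  but all edges of those were removed.\<close>

lemma thin_triangle_free:
  assumes "x < m" "y < m" "z < m" "x \<noteq> y" "y \<noteq> z" "x \<noteq> z"
    "thin m e {x,y}" "thin m e {y,z}" "thin m e {x,z}"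
  shows False
proof -
  let ?T = "{x,y,z}"
  have "thin m e d" if d: "d \<in> edges_in ?T" for d
  proof -
    obtain u v where uv: "d = {u,v}" "u \<noteq> v" using d unfolding edges_in_def by (auto simp: card_2_iff)
    then have "u \<in> ?T" "v \<in> ?T" using d unfolding edges_in_def by auto
    then show ?thesis using uv assms(7-9) by (auto simp: insert_commute)
  qed
  then have all: "\<And>d. d \<in> edges_in ?T \<Longrightarrow> thin m e d" .
  have "\<exists>T'\<in>max_packing m e. edges_in ?T \<inter> edges_in T' \<noteq> {}"
    using all assms(1-6) by (intro max_packing_meets) (auto simp: thin_def)
  then obtain T' d where "T' \<in> max_packing m e" "d \<in> edges_in ?T" "d \<in> edges_in T'" by blast
  then show False using all[of d] unfolding thin_def edges_in_def by blast
qed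

text \<open>A removed edge inside \<open>A\<close> lies in a triangle of the packing with two
  vertices in \<open>A\<close>, and every triangle accounts for three edges.\<close>

lemma card_removed_edges_le:
  assumes "A \<subseteq> {..<m}"
  shows "card {d\<in>edges_in A. e d \<and> \<not> thin m e d} \<le> 3 * card {T\<in>max_packing m e. 2 \<le> card (T \<inter> A)}"
proof -
  let ?S = "{T\<in>max_packing m e. 2 \<le> card (T \<inter> A)}"
  have fS: "finite ?S" using triangle_packing_finite[OF max_packing] by simp
  have T3: "finite T \<and> card (edges_in T) = 3" if "T \<in> ?S" for T
  proof -
    have "T \<in> max_packing m e" using that by simp
    from triangle_packingD(2,3)[OF max_packing this] show ?thesis
      using card_edges_in[of T] by (simp add: choose_two)
  qed
  have fin: "finite (\<Union>T\<in>?S. edges_in T)"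
    by (rule finite_UN_I[OF fS finite_edges_in]) (use T3 in blast)
  have sub: "{d\<in>edges_in A. e d \<and> \<not> thin m e d} \<subseteq> (\<Union>T\<in>?S. edges_in T)"
  proof
    fix d assume d: "d \<in> {d\<in>edges_in A. e d \<and> \<not> thin m e d}"
    then obtain T where T: "T \<in> max_packing m e" "d \<subseteq> T" unfolding thin_def by blast
    have "finite T" by (rule triangle_packingD(3)[OF max_packing T(1)])
    then have "card d \<le> card (T \<inter> A)" using d T unfolding edges_in_def by (intro card_mono) auto
    then show "d \<in> (\<Union>T\<in>?S. edges_in T)" using d T unfolding edges_in_def by auto
  qed
  have "card {d\<in>edges_in A. e d \<and> \<not> thin m e d} \<le> card (\<Union>T\<in>?S. edges_in T)"
    by (rule card_mono[OF fin sub])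
  also have "\<dots> \<le> (\<Sum>T\<in>?S. card (edges_in T))" by (rule card_UN_le[OF fS])
  also have "\<dots> = (\<Sum>T\<in>?S. 3)" by (rule sum.cong[OF refl]) (rule conjunct2[OF T3])
  also have "\<dots> = 3 * card ?S" by simp
  finally show ?thesis .
qed

lemma card_removed_edges_packing:
  assumes "A \<subseteq> {..<m}"
    "\<nexists>\<T>. triangle_packing m e \<T> \<and> (\<forall>T\<in>\<T>. 2 \<le> card (T \<inter> A)) \<and> F \<le> card \<T>"
  shows "card {d\<in>edges_in A. e d \<and> \<not> thin m e d} \<le> 3 * F"
proof -
  have "triangle_packing m e {T\<in>max_packing m e. 2 \<le> card (T \<inter> A)}"
    by (rule triangle_packing_subset[OF max_packing Collect_subset])
  then have "\<not> F \<le> card {T\<in>max_packing m e. 2 \<le> card (T \<inter> A)}"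
    using assms(2) by (intro notI) (erule notE, intro exI conjI, assumption, simp_all)
  then show ?thesis using card_removed_edges_le[OF assms(1), of e] by linarith
qed

subsection \<open>Pairs closed by light vertices\<close>

lemma gnp_prod_inj:
  fixes h :: "'a \<Rightarrow> bool \<Rightarrow> real" and p :: real
  assumes "0 \<le> p" "p \<le> 1" "inj_on g S" "g ` S \<subseteq> edges m" "\<And>y b. y \<in> S \<Longrightarrow> 0 \<le> h y b"
  shows "expct (gnp m p) (\<lambda>e. \<Prod>y\<in>S. h y (e (g y))) = (\<Prod>y\<in>S. p * h y True + (1 - p) * h y False)"
proof -
  let ?i = "inv_into S g"
  have i: "?i (g y) = y" if "y \<in> S" for y using assms(3) that by (rule inv_into_f_f)
  have "(\<Prod>d\<in>g ` S. h (?i d) (e d)) = (\<Prod>y\<in>S. h y (e (g y)))" for e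
    unfolding prod.reindex[OF assms(3)] o_def by (rule prod.cong[OF refl]) (simp add: i)
  then have "expct (gnp m p) (\<lambda>e. \<Prod>y\<in>S. h y (e (g y))) = expct (gnp m p) (\<lambda>e. \<Prod>d\<in>g ` S. h (?i d) (e d))"
    by simp
  also have "\<dots> = (\<Prod>d\<in>g ` S. p * h (?i d) True + (1 - p) * h (?i d) False)"
    by (rule gnp_prod[OF assms(1,2,4)]) (use i assms(5) in force)
  also have "\<dots> = (\<Prod>y\<in>S. p * h y True + (1 - p) * h y False)"
    unfolding prod.reindex[OF assms(3)] o_def by (rule prod.cong[OF refl]) (simp add: i)
  finally show ?thesis .
qed

definition nbrs :: "(nat set \<Rightarrow> bool) \<Rightarrow> (nat \<Rightarrow> nat) \<Rightarrow> nat set \<Rightarrow> nat \<Rightarrow> nat set" where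
  "nbrs e r I z = {i\<in>I. e {z, r i}}"

definition closed_pairs :: "(nat set \<Rightarrow> bool) \<Rightarrow> (nat \<Rightarrow> nat) \<Rightarrow> nat set \<Rightarrow> nat \<Rightarrow> (nat \<times> nat) set" where
  "closed_pairs e r I z = {(i, j). i \<in> nbrs e r I z \<and> j \<in> nbrs e r I z \<and> r i \<noteq> r j}"

text \<open>The edges from \<open>z\<close> to distinct points of the image are independent, each
  weighted by the size of its fibre. By \<open>\<eta> * M \<le> 1\<close> the two prescribed edges
  contribute at most \<open>p * exp 1\<close> each, and all correction factors together at most
  \<open>exp (2 * (p * \<eta> * card I))\<close>, hence at most \<open>exp 2\<close>.\<close>

lemma pair_moment:
  fixes p \<eta> M :: real
  assumes p: "0 \<le> p" "p \<le> 1" and I: "finite I" and A: "r ` I \<subseteq> {..<m}" and z: "z < m" "z \<notin> r ` I"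
    and \<eta>: "0 \<le> \<eta>" "\<eta> * M \<le> 1" "p * \<eta> * card I \<le> 1"
    and M: "\<And>y. y \<in> r ` I \<Longrightarrow> card {i\<in>I. r i = y} \<le> M"
    and ij: "i \<in> I" "j \<in> I" "r i \<noteq> r j"
  shows "expct (gnp m p) (\<lambda>e. of_bool (e {z, r i} \<and> e {z, r j}) * exp (\<eta> * card (nbrs e r I z))) \<le> p\<^sup>2 * exp 4"
proof -
  let ?A = "r ` I"
  define c where "c y = real (card {i\<in>I. r i = y})" for y
  define h where "h y b = (if b then exp (\<eta> * c y) else if y \<in> {r i, r j} then 0 else 1)" for y b
  have fA: "finite ?A" using I by simp
  have expD: "exp (\<eta> * card (nbrs e r I z)) = (\<Prod>y\<in>?A. if e {z, y} then exp (\<eta> * c y) else 1)" for e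
  proof -
    have "exp (\<eta> * card (nbrs e r I z)) = (\<Prod>i\<in>nbrs e r I z. exp \<eta>)" by (simp add: exp_of_nat2_mult)
    also have "\<dots> = (\<Prod>i\<in>I. if e {z, r i} then exp \<eta> else 1)"
      unfolding nbrs_def by (rule prod.inter_filter[OF I])
    also have "\<dots> = (\<Prod>y\<in>?A. \<Prod>i\<in>{i\<in>I. r i = y}. if e {z, r i} then exp \<eta> else 1)"
      by (rule prod.group[symmetric, OF I fA]) simp
    also have "\<dots> = (\<Prod>y\<in>?A. if e {z, y} then exp (\<eta> * c y) else 1)"
      by (rule prod.cong[OF refl]) (simp add: c_def exp_of_nat2_mult)
    finally show ?thesis .
  qed
  have eq: "of_bool (e {z, r i} \<and> e {z, r j}) * exp (\<eta> * card (nbrs e r I z)) = (\<Prod>y\<in>?A. h y (e {z, y}))" for e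
  proof (cases "e {z, r i} \<and> e {z, r j}")
    case True
    then have "(\<Prod>y\<in>?A. h y (e {z, y})) = (\<Prod>y\<in>?A. if e {z, y} then exp (\<eta> * c y) else 1)"
      by (intro prod.cong[OF refl]) (auto simp: h_def)
    then show ?thesis using True by (simp add: expD)
  next
    case False
    then obtain y where y: "y \<in> {r i, r j}" "\<not> e {z, y}" by blast
    then have "h y (e {z, y}) = 0" "y \<in> ?A" using ij(1,2) by (auto simp: h_def)
    then have "(\<Prod>y\<in>?A. h y (e {z, y})) = 0" by (intro prod_zero[OF fA]) (rule bexI)
    then show ?thesis using False by simp
  qed
  have c1: "\<eta> * c y \<le> 1" if "y \<in> ?A" for y
  proof -
    have "\<eta> * c y \<le> \<eta> * M" unfolding c_def by (intro mult_left_mono M that \<eta>(1))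
    then show ?thesis using \<eta>(2) by linarith
  qed
  have c0: "0 \<le> \<eta> * c y" for y using \<eta>(1) unfolding c_def by simp
  have sumc: "(\<Sum>y\<in>?A. c y) = card I"
  proof -
    have "(\<Sum>y\<in>?A. \<Sum>i\<in>{i\<in>I. r i = y}. 1) = (\<Sum>i\<in>I. 1::real)"
      by (rule sum.group[OF I fA]) simp
    then show ?thesis by (simp add: c_def)
  qed
  have inj: "inj_on (\<lambda>y. {z, y}) ?A" using z(2) by (auto simp: inj_on_def doubleton_eq_iff)
  have im: "(\<lambda>y. {z, y}) ` ?A \<subseteq> edges m" using z A by (auto simp: edges_iff image_subset_iff)
  have "expct (gnp m p) (\<lambda>e. of_bool (e {z, r i} \<and> e {z, r j}) * exp (\<eta> * card (nbrs e r I z)))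
      = expct (gnp m p) (\<lambda>e. \<Prod>y\<in>?A. h y (e {z, y}))" by (simp only: eq)
  also have "\<dots> = (\<Prod>y\<in>?A. p * h y True + (1 - p) * h y False)"
    by (rule gnp_prod_inj[OF p inj im]) (simp add: h_def)
  also have "\<dots> \<le> (\<Prod>y\<in>?A. (if y \<in> {r i, r j} then p * exp 1 else 1) * exp (2 * (p * (\<eta> * c y))))"
  proof (rule prod_mono, rule conjI)
    fix y assume y: "y \<in> ?A"
    show "0 \<le> p * h y True + (1 - p) * h y False" using p by (simp add: h_def)
    have pc: "0 \<le> p * (\<eta> * c y)" using p c0 by simp
    show "p * h y True + (1 - p) * h y False
        \<le> (if y \<in> {r i, r j} then p * exp 1 else 1) * exp (2 * (p * (\<eta> * c y)))"
    proof (cases "y \<in> {r i, r j}")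
      case True
      have "p * exp (\<eta> * c y) \<le> p * exp 1" using c1[OF y] p by (intro mult_left_mono) auto
      also have "p * exp 1 * 1 \<le> p * exp 1 * exp (2 * (p * (\<eta> * c y)))"
        using pc p by (intro mult_left_mono) auto
      finally show ?thesis using True by (simp add: h_def)
    next
      case False
      have "exp (\<eta> * c y) \<le> 1 + \<eta> * c y + (\<eta> * c y)\<^sup>2" using c0 c1[OF y] by (rule exp_bound)
      also have "(\<eta> * c y)\<^sup>2 \<le> \<eta> * c y"
        using mult_left_mono[OF c1[OF y] c0[of y]] by (simp add: power2_eq_square)
      finally have "p * (exp (\<eta> * c y) - 1) \<le> p * (2 * (\<eta> * c y))" using p by (intro mult_left_mono) auto
      then have "1 + p * (exp (\<eta> * c y) - 1) \<le> 1 + 2 * (p * (\<eta> * c y))" by simp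
      also have "\<dots> \<le> exp (2 * (p * (\<eta> * c y)))" by (rule exp_ge_add_one_self)
      finally show ?thesis using False by (simp add: h_def algebra_simps)
    qed
  qed
  also have "\<dots> = (\<Prod>y\<in>?A. if y \<in> {r i, r j} then p * exp 1 else 1) * exp (\<Sum>y\<in>?A. 2 * (p * (\<eta> * c y)))"
    using fA by (simp add: prod.distrib exp_sum)
  also have "(\<Prod>y\<in>?A. if y \<in> {r i, r j} then p * exp 1 else 1) = (\<Prod>y\<in>{r i, r j}. p * exp 1)"
    using fA ij by (subst prod.inter_restrict[symmetric]) (auto intro!: arg_cong2[where f = prod])
  also have "\<dots> = p\<^sup>2 * exp 2"
    using ij(3) by (simp add: power2_eq_square mult_ac flip: exp_add)
  also have "(\<Sum>y\<in>?A. 2 * (p * (\<eta> * c y))) = 2 * (p * \<eta> * card I)"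
    by (simp add: sumc[symmetric] sum_distrib_left mult_ac)
  also have "p\<^sup>2 * exp 2 * exp (2 * (p * \<eta> * card I)) \<le> p\<^sup>2 * exp 2 * exp 2"
    using \<eta>(3) by (intro mult_left_mono) auto
  also have "\<dots> = p\<^sup>2 * exp 4" by (simp flip: exp_add)
  finally show ?thesis .
qed

text \<open>The image of \<open>I\<close> is left out so that the stars from the remaining vertices
  \<open>z\<close> to the image are disjoint sets of pairs, hence independent. Light vertices inside
  the image are treated in \<open>card_exceptional_le\<close>.\<close>

abbreviation light_pairs :: "nat \<Rightarrow> real \<Rightarrow> (nat \<Rightarrow> nat) \<Rightarrow> (nat set \<Rightarrow> bool) \<Rightarrow> nat set \<Rightarrow> real" where
  "light_pairs m t r e I \<equiv>
     (\<Sum>z\<in>{..<m} - r ` I. if real (card (nbrs e r I z)) < t then real (card (closed_pairs e r I z)) else 0)"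

lemma finite_nbrs: "finite I \<Longrightarrow> finite (nbrs e r I z)"
  unfolding nbrs_def by simp

lemma closed_pairs_subset: "closed_pairs e r I z \<subseteq> nbrs e r I z \<times> nbrs e r I z"
  unfolding closed_pairs_def by blast

lemma card_closed_pairs_le:
  assumes "finite I"
  shows "card (closed_pairs e r I z) \<le> card (nbrs e r I z) * card (nbrs e r I z)"
proof -
  have "finite (nbrs e r I z \<times> nbrs e r I z)" using finite_nbrs[OF assms] by (intro finite_cartesian_product)
  from card_mono[OF this closed_pairs_subset] show ?thesis by (simp only: card_cartesian_product)
qed

text \<open>A vertex with \<open>D < t\<close> neighbours closes at most
  \<open>D^2 \<le> t D\<close> pairs, so by \<open>e^x \<le> 1 + x e^x\<close> its count
  \<open>Y\<close> satisfies
  \<open>exp (\<theta> Y) \<le> 1 + \<theta> Y exp (\<theta> t D)\<close>. The truncation at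
  \<open>t\<close> thus turns a quadratic exponent into a linear one, and \<open>pair_moment\<close>
  applies to each pair counted by \<open>Y\<close> with \<open>\<eta> = \<theta> * t\<close>.
  Different vertices contribute independent factors.\<close>

lemma light_tail:
  fixes p \<theta> t M y0 :: real
  assumes p: "0 \<le> p" "p \<le> 1" and I: "finite I" and A: "r ` I \<subseteq> {..<m}"
    and \<theta>: "0 \<le> \<theta>" "0 \<le> t" "\<theta> * t * M \<le> 1" "p * (\<theta> * t) * card I \<le> 1"
    and M: "\<And>y. y \<in> r ` I \<Longrightarrow> card {i\<in>I. r i = y} \<le> M"
  shows "prb (gnp m p) {e. y0 \<le> light_pairs m t r e I}
     \<le> exp (m * (\<theta> * (card I)\<^sup>2 * p\<^sup>2 * exp 4) - \<theta> * y0)"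
proof -
  let ?Z = "{..<m} - r ` I"
  define Y where "Y z e = (if card (nbrs e r I z) < t then real (card (closed_pairs e r I z)) else 0)" for z e
  define P where "P = {(i, j). i \<in> I \<and> j \<in> I \<and> r i \<noteq> r j}"
  let ?\<eta> = "\<theta> * t"
  let ?c = "\<theta> * (card I)\<^sup>2 * p\<^sup>2 * exp 4"
  have PI: "P \<subseteq> I \<times> I" unfolding P_def by blast
  have fII: "finite (I \<times> I)" using I by simp
  have fP: "finite P" using PI fII by (rule finite_subset)
  have cP: "card P \<le> (card I)\<^sup>2"
    using card_mono[OF fII PI] by (simp add: card_cartesian_product power2_eq_square)
  have cl: "real (card (closed_pairs e r I z)) = (\<Sum>(i,j)\<in>P. of_bool (e {z, r i} \<and> e {z, r j}))" for e z
  proof -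
    have "closed_pairs e r I z = {ij\<in>P. e {z, r (fst ij)} \<and> e {z, r (snd ij)}}"
      unfolding closed_pairs_def P_def nbrs_def by auto
    then have "real (card (closed_pairs e r I z)) = (\<Sum>ij\<in>{ij\<in>P. e {z, r (fst ij)} \<and> e {z, r (snd ij)}}. 1)" by simp
    also have "\<dots> = (\<Sum>ij\<in>P. if e {z, r (fst ij)} \<and> e {z, r (snd ij)} then 1 else 0)"
      by (rule sum.inter_filter[OF fP])
    finally show ?thesis by (simp add: case_prod_beta of_bool_def)
  qed
  have pt: "exp (\<theta> * Y z e) \<le> 1 + \<theta> * (\<Sum>(i,j)\<in>P. of_bool (e {z, r i} \<and> e {z, r j}) * exp (?\<eta> * card (nbrs e r I z)))" for z e
  proof (cases "card (nbrs e r I z) < t")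
    case True
    let ?D = "real (card (nbrs e r I z))"
    let ?x = "\<theta> * card (closed_pairs e r I z)"
    have x0: "0 \<le> ?x" using \<theta> by simp
    have "real (card (closed_pairs e r I z)) \<le> ?D * ?D"
      using card_closed_pairs_le[OF I, of e r z] by (simp flip: of_nat_mult)
    also have "\<dots> \<le> t * ?D" using True by (intro mult_right_mono) auto
    finally have "?x \<le> \<theta> * (t * ?D)" using \<theta>(1) by (intro mult_left_mono) auto
    then have "exp ?x \<le> exp (?\<eta> * ?D)" by (simp add: mult.assoc)
    then have le: "?x * exp ?x \<le> ?x * exp (?\<eta> * ?D)" using x0 by (intro mult_left_mono)
    have "1 - ?x \<le> exp (- ?x)" using exp_ge_add_one_self[of "- ?x"] by simp
    then have "(1 - ?x) * exp ?x \<le> exp (- ?x) * exp ?x" by (intro mult_right_mono) auto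
    then have "exp ?x \<le> 1 + ?x * exp ?x" by (simp add: algebra_simps flip: exp_add)
    also have "\<dots> \<le> 1 + ?x * exp (?\<eta> * ?D)" using le by simp
    also have "?x * exp (?\<eta> * ?D) = \<theta> * (\<Sum>(i,j)\<in>P. of_bool (e {z, r i} \<and> e {z, r j}) * exp (?\<eta> * ?D))"
      unfolding cl by (simp add: sum_distrib_right case_prod_beta mult.assoc)
    finally show ?thesis using True by (simp add: Y_def)
  next
    case False
    have "0 \<le> \<theta> * (\<Sum>(i,j)\<in>P. of_bool (e {z, r i} \<and> e {z, r j}) * exp (?\<eta> * card (nbrs e r I z)))"
      using \<theta>(1) by (intro mult_nonneg_nonneg sum_nonneg) auto
    then show ?thesis using False by (simp add: Y_def)
  qed
  have one: "expct (gnp m p) (\<lambda>e. exp (\<theta> * Y z e)) \<le> exp ?c" if z: "z \<in> ?Z" for z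
  proof -
    have "expct (gnp m p) (\<lambda>e. exp (\<theta> * Y z e)) \<le>
      expct (gnp m p) (\<lambda>e. 1 + \<theta> * (\<Sum>(i,j)\<in>P. of_bool (e {z, r i} \<and> e {z, r j}) * exp (?\<eta> * card (nbrs e r I z))))"
      by (intro expectation_mono_finite[OF finite_set_gnp] pt)
    also have "\<dots> = 1 + \<theta> * (\<Sum>ij\<in>P. expct (gnp m p)
        (\<lambda>e. of_bool (e {z, r (fst ij)} \<and> e {z, r (snd ij)}) * exp (?\<eta> * card (nbrs e r I z))))"
      by (subst expectation_add_finite[OF finite_set_gnp])
         (simp add: case_prod_beta expectation_sum_finite[OF finite_set_gnp])
    also have "\<dots> \<le> 1 + \<theta> * (\<Sum>ij\<in>P. p\<^sup>2 * exp 4)"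
    proof (intro add_left_mono mult_left_mono sum_mono \<theta>(1))
      fix ij assume ij: "ij \<in> P"
      show "expct (gnp m p) (\<lambda>e. of_bool (e {z, r (fst ij)} \<and> e {z, r (snd ij)}) * exp (?\<eta> * card (nbrs e r I z))) \<le> p\<^sup>2 * exp 4"
        by (rule pair_moment[OF p I A _ _ _ \<theta>(3) \<theta>(4) M]) (use ij z \<theta> in \<open>auto simp: P_def\<close>)
    qed
    also have "\<dots> = 1 + \<theta> * (card P * (p\<^sup>2 * exp 4))" by simp
    also have "\<dots> \<le> 1 + \<theta> * ((card I)\<^sup>2 * (p\<^sup>2 * exp 4))"
      using cP \<theta>(1) by (intro add_left_mono mult_left_mono mult_right_mono of_nat_mono) auto
    also have "\<dots> = 1 + ?c" by (simp add: mult.assoc)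
    also have "\<dots> \<le> exp ?c" by (rule exp_ge_add_one_self)
    finally show ?thesis .
  qed
  let ?Bl = "\<lambda>z. (\<lambda>y. {z, y}) ` (r ` I)"
  have "expct (gnp m p) (\<lambda>e. exp (\<theta> * (\<Sum>z\<in>?Z. Y z e))) = expct (gnp m p) (\<lambda>e. \<Prod>z\<in>?Z. exp (\<theta> * Y z e))"
    by (simp add: sum_distrib_left exp_sum)
  also have "\<dots> = (\<Prod>z\<in>?Z. expct (gnp m p) (\<lambda>e. exp (\<theta> * Y z e)))"
    unfolding gnp_def
  proof (rule expectation_prod_blocks[OF finite_edges, where B = ?Bl])
    show "finite (set_pmf (bernoulli_pmf p))" by (rule finite_subset[of _ UNIV]) auto
    show "?Bl z \<subseteq> edges m" if "z \<in> ?Z" for z using that A by (auto simp: edges_iff image_subset_iff)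
    show "?Bl z \<inter> ?Bl z' = {}" if "z \<in> ?Z" "z' \<in> ?Z" "z \<noteq> z'" for z z'
      using that by (auto simp: doubleton_eq_iff)
    show "exp (\<theta> * Y z f) = exp (\<theta> * Y z g)" if "z \<in> ?Z" "\<And>x. x \<in> ?Bl z \<Longrightarrow> f x = g x" for z f g
    proof -
      have "f {z, r i} = g {z, r i}" if "i \<in> I" for i using \<open>\<And>x. x \<in> ?Bl z \<Longrightarrow> f x = g x\<close> that by blast
      then have "nbrs f r I z = nbrs g r I z" unfolding nbrs_def by auto
      then show ?thesis unfolding Y_def closed_pairs_def by simp
    qed
  qed simp
  also have "\<dots> \<le> (\<Prod>z\<in>?Z. exp ?c)"
    by (intro prod_mono conjI one) (auto intro: Bochner_Integration.integral_nonneg)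
  also have "\<dots> = exp ?c ^ card ?Z" by simp
  also have "\<dots> \<le> exp ?c ^ m"
  proof (rule power_increasing)
    show "card ?Z \<le> m" using card_mono[of "{..<m}" ?Z] by simp
    show "1 \<le> exp ?c" using \<theta> p by simp
  qed
  also have "\<dots> = exp (m * ?c)" by (simp add: exp_of_nat_mult)
  finally have fin: "expct (gnp m p) (\<lambda>e. exp (\<theta> * (\<Sum>z\<in>?Z. Y z e))) \<le> exp (m * ?c)" .
  have "prb (gnp m p) {e. y0 \<le> (\<Sum>z\<in>?Z. Y z e)} \<le> exp (- (\<theta> * y0)) * expct (gnp m p) (\<lambda>e. exp (\<theta> * (\<Sum>z\<in>?Z. Y z e)))"
    using \<theta>(1) by (intro prob_exp_markov[OF finite_set_gnp]) (auto intro: mult_left_mono)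
  also have "\<dots> \<le> exp (- (\<theta> * y0)) * exp (m * ?c)" using fin by (intro mult_left_mono) auto
  finally show ?thesis unfolding Y_def by (simp flip: exp_add)
qed

text \<open>\<open>U\<close> is the part of \<open>I\<close> inside large neighbourhoods, \<open>J\<close> a transversal of the fibres of the rest.
  Each point of \<open>U\<close> costs a factor \<open>\<Delta> / m\<close>, each further point outside \<open>J\<close> a factor \<open>|J| / m\<close>, so only
  the points of \<open>J\<close> contribute entropy.\<close>

lemma piece_tail:
  fixes p \<Delta> \<tau> :: real
  assumes p: "0 \<le> p" "p \<le> 1" and m: "0 < m" and \<Delta>: "0 \<le> \<Delta>" and I: "I \<subseteq> {..<n}" "U \<subseteq> I" "J \<subseteq> I - U"
    and T: "T \<subseteq> edges_in J" and w: "\<And>i. i \<in> U \<Longrightarrow> w i < m"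
  shows "prb (pair_pmf (rmap n m) (gnp m p))
     {(r, e). (\<forall>z<m. card {y. y < m \<and> e {z, y}} \<le> \<Delta>) \<and> (\<forall>i\<in>U. e {w i, r i}) \<and> r ` (I - U) \<subseteq> r ` J \<and>
        inj_on r J \<and> card {d\<in>T. e (r ` d)} \<le> \<tau>}
     \<le> (\<Delta> / m) ^ card U * (card J / m) ^ (card I - card U - card J) * exp (3 * \<tau> - (1 - exp (- 3)) * p * card T)"
    (is "prb ?PP ?S \<le> _")
proof -
  let ?R = "rmap n m" and ?G = "gnp m p" and ?U1 = "pmf_of_set {..<m}"
  have fI: "finite I" using I finite_subset by blast
  have fJ: "finite J" and fU: "finite U" using I fI finite_subset by blast+
  have fT: "finite T" using T finite_edges_in[OF fJ] finite_subset by blast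
  note fR = finite_set_rmap[OF m, of n] and fG = finite_set_gnp[of m p]
  \<comment> \<open>The coordinates of the vertex map to be integrated out: all of \<open>I\<close>
    except the transversal \<open>J\<close>.\<close>
  define B where "B = U \<union> (I - U - J)"
  define W where "W e i r = (if i \<in> U then {y. y < m \<and> e {w i, y}} else r ` J)" for e i and r :: "nat \<Rightarrow> nat"
  \<comment> \<open>What remains after the elimination depends on \<open>r\<close> only through
    \<open>J\<close>. The exponent -3 is a compromise: the lower tail keeps the fraction
    \<open>1 - exp (- 3)\<close> of the expected edges on \<open>T\<close> and pays
    \<open>3 * \<tau>\<close> for those that may be present.\<close>
  define F where "F e r = of_bool (inj_on r J \<and> r ` J \<subseteq> {..<m}) * exp (- 3 * real (card {d\<in>T. e (r ` d)}))" for e and r :: "nat \<Rightarrow> nat"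
  define v where "v i = (if i \<in> U then \<Delta> / m else card J / m)" for i
  let ?c = "(\<Delta> / m) ^ card U * (card J / m) ^ (card I - card U - card J)"
  have BJ: "B \<inter> J = {}" "B \<subseteq> {..<n}" unfolding B_def using I by auto
  have prodv: "(\<Prod>i\<in>B. v i) = ?c"
  proof -
    have "(\<Prod>i\<in>B. v i) = (\<Prod>i\<in>U. v i) * (\<Prod>i\<in>I - U - J. v i)"
      unfolding B_def using fU fI by (intro prod.union_disjoint) auto
    also have "(\<Prod>i\<in>U. v i) = (\<Delta> / m) ^ card U" by (simp add: v_def)
    also have "(\<Prod>i\<in>I - U - J. v i) = (card J / m) ^ card (I - U - J)" by (simp add: v_def)
    also have "card (I - U - J) = card I - card U - card J"
      using I fU fJ by (simp add: card_Diff_subset)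
    finally show ?thesis .
  qed
  have Fdep: "F e f = F e g" if "\<And>x. x \<notin> B \<Longrightarrow> f x = g x" for e f g
  proof -
    have eqJ: "f x = g x" if "x \<in> J" for x using BJ that \<open>\<And>x. x \<notin> B \<Longrightarrow> f x = g x\<close> by blast
    have "f ` d = g ` d" if "d \<in> T" for d
    proof (rule image_cong[OF refl])
      fix x assume "x \<in> d"
      then show "f x = g x" using that T eqJ unfolding edges_in_def by blast
    qed
    then have "{d\<in>T. e (f ` d)} = {d\<in>T. e (g ` d)}" by auto
    moreover have "inj_on f J = inj_on g J" using eqJ by (rule inj_on_cong)
    moreover have "f ` J = g ` J" using eqJ by (rule image_cong[OF refl])
    ultimately show ?thesis unfolding F_def by simp
  qed
  have F0: "0 \<le> F e r" for e r unfolding F_def by simp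
  \<comment> \<open>For a fixed graph \<open>e\<close> the points of \<open>B\<close> are exposed
    last: those in \<open>U\<close> must fall into a neighbourhood of size at most
    \<open>\<Delta>\<close>, the others into the image of \<open>J\<close>.\<close>
  have step1: "expct ?R (\<lambda>r. indicator ?S (r, e)) \<le> exp (3 * \<tau>) * ?c * expct ?R (F e)" for e
  proof (cases "\<forall>z<m. card {y. y < m \<and> e {z, y}} \<le> \<Delta>")
    case deg: True
    have "expct ?R (\<lambda>r. indicator ?S (r, e)) \<le> expct ?R (\<lambda>r. exp (3 * \<tau>) * (F e r * of_bool (\<forall>i\<in>B. r i \<in> W e i r)))"
    proof (rule expectation_mono_finite[OF fR])
      fix r assume r: "r \<in> set_pmf ?R"
      show "indicat_real ?S (r, e) \<le> exp (3 * \<tau>) * (F e r * of_bool (\<forall>i\<in>B. r i \<in> W e i r))"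
      proof (cases "(r, e) \<in> ?S")
        case True
        then have S: "\<forall>i\<in>U. e {w i, r i}" "r ` (I - U) \<subseteq> r ` J" "inj_on r J" "card {d\<in>T. e (r ` d)} \<le> \<tau>"
          by simp_all
        have rm: "r i < m" if "i \<in> I" for i using rmap_support[OF r _ m] that I(1) by blast
        have rJ: "r ` J \<subseteq> {..<m}" using rm I(3) by blast
        have "r i \<in> W e i r" if "i \<in> B" for i
        proof (cases "i \<in> U")
          case True then show ?thesis using S(1) rm I(2) by (auto simp: W_def)
        next
          case False
          then have "i \<in> I - U" using that unfolding B_def by blast
          then show ?thesis using S(2) False by (auto simp: W_def)
        qed
        moreover have "1 \<le> exp (3 * \<tau>) * exp (- 3 * real (card {d\<in>T. e (r ` d)}))"
          using S(4) by (simp flip: exp_add)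
        ultimately show ?thesis using S rJ True by (simp add: F_def)
      next
        case False then show ?thesis using F0 by simp
      qed
    qed
    also have "\<dots> = exp (3 * \<tau>) * expct ?R (\<lambda>r. F e r * of_bool (\<forall>i\<in>B. r i \<in> W e i r))" by simp
    also have "expct ?R (\<lambda>r. F e r * of_bool (\<forall>i\<in>B. r i \<in> W e i r)) \<le> (\<Prod>i\<in>B. v i) * expct ?R (F e)"
      unfolding rmap_def
    proof (rule expectation_eliminate)
      show "finite {..<n}" by simp
      show "finite (set_pmf ?U1)" using m by (simp add: set_pmf_of_set lessThan_empty_iff)
      show "B \<subseteq> {..<n}" by (rule BJ)
      show "0 \<le> F e r" for r by (rule F0)
      show "F e f = F e g" if "\<And>x. x \<notin> B \<Longrightarrow> f x = g x" for f g using that by (rule Fdep)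
      show "W e i f = W e i g" if "i \<in> B" "\<And>x. x \<notin> B \<Longrightarrow> f x = g x" for i f g
      proof -
        have "f ` J = g ` J"
        proof (rule image_cong[OF refl])
          fix x assume "x \<in> J" then show "f x = g x" using BJ that(2) by blast
        qed
        then show ?thesis unfolding W_def by simp
      qed
      show "prb ?U1 (W e i f) \<le> v i" if "i \<in> B" for i f
      proof (cases "i \<in> U")
        case True
        have "prb ?U1 (W e i f) = card ({..<m} \<inter> W e i f) / m" by (rule rmap_prob_one[OF m])
        also have "{..<m} \<inter> W e i f = {y. y < m \<and> e {w i, y}}" using True by (auto simp: W_def)
        also have "card {y. y < m \<and> e {w i, y}} / m \<le> \<Delta> / m"
          using deg w[OF True] by (intro divide_right_mono) auto
        finally show ?thesis using True by (simp add: v_def)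
      next
        case False
        have "prb ?U1 (W e i f) = card ({..<m} \<inter> W e i f) / m" by (rule rmap_prob_one[OF m])
        also have "card ({..<m} \<inter> W e i f) \<le> card (f ` J)"
          using False fJ by (intro card_mono) (auto simp: W_def)
        also have "card (f ` J) \<le> card J" by (rule card_image_le[OF fJ])
        finally show ?thesis using False m by (simp add: v_def divide_right_mono)
      qed
    qed
    finally show ?thesis unfolding prodv by (simp add: mult.assoc)
  next
    case False
    then have z: "indicat_real ?S (r, e) = 0" for r by (auto simp: indicator_def)
    have "0 \<le> exp (3 * \<tau>) * ?c * expct ?R (F e)"
      using \<Delta> F0 by (intro mult_nonneg_nonneg) (auto intro: Bochner_Integration.integral_nonneg)
    then show ?thesis by (simp add: z)
  qed
  have step2: "expct ?G (\<lambda>e. F e r) \<le> exp (- (1 - exp (- 3)) * p * card T)" if r: "r \<in> set_pmf ?R" for r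
  proof (cases "inj_on r J \<and> r ` J \<subseteq> {..<m}")
    case True
    note im = image_edges[OF conjunct1[OF True] T]
    have injT: "inj_on ((`) r) T" and Q: "(`) r ` T \<subseteq> edges m" using im(1,2) True by blast+
    have cd: "card {q\<in>(`) r ` T. e q} = card {d\<in>T. e (r ` d)}" for e by (rule im(3))
    have "expct ?G (\<lambda>e. F e r) = expct ?G (\<lambda>e. exp (- 3 * real (card {q\<in>(`) r ` T. e q})))"
      unfolding F_def cd using True by simp
    also have "\<dots> \<le> exp (p * card ((`) r ` T) * (exp (- 3) - 1))" by (rule gnp_exp[OF p Q])
    also have "card ((`) r ` T) = card T" by (rule card_image[OF injT])
    finally show ?thesis by (simp add: algebra_simps)
  next
    case False then have "(\<lambda>e. F e r) = (\<lambda>e. 0)" by (auto simp: F_def)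
    then show ?thesis by simp
  qed
  \<comment> \<open>The order of integration is exchanged twice: the graph is fixed while
    \<open>B\<close> is eliminated, and then the map is fixed while the edges on the image of
    \<open>T\<close> are exposed.\<close>
  have "prb ?PP ?S = expct ?G (\<lambda>e. expct ?R (\<lambda>r. indicator ?S (r, e)))"
    unfolding prob_eq_expectation by (rule expectation_pair_swap[OF fR fG])
  also have "\<dots> \<le> expct ?G (\<lambda>e. exp (3 * \<tau>) * ?c * expct ?R (F e))"
    by (rule expectation_mono_finite[OF fG step1])
  also have "\<dots> = exp (3 * \<tau>) * ?c * expct ?G (\<lambda>e. expct ?R (F e))" by simp
  also have "expct ?G (\<lambda>e. expct ?R (F e)) = expct (pair_pmf ?R ?G) (\<lambda>x. F (snd x) (fst x))"
    by (subst expectation_pair_swap[OF fR fG]) simp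
  also have "\<dots> = expct ?R (\<lambda>r. expct ?G (\<lambda>e. F e r))"
    by (subst expectation_pair_finite[OF fR fG]) simp
  also have "exp (3 * \<tau>) * ?c * \<dots> \<le> exp (3 * \<tau>) * ?c * exp (- (1 - exp (- 3)) * p * card T)"
    using \<Delta> by (intro mult_left_mono expectation_le_const[OF fR step2]) auto
  also have "\<dots> = ?c * (exp (3 * \<tau>) * exp (- (1 - exp (- 3)) * p * card T))" by (simp only: mult_ac)
  also have "exp (3 * \<tau>) * exp (- (1 - exp (- 3)) * p * card T) = exp (3 * \<tau> - (1 - exp (- 3)) * p * card T)"
    unfolding exp_add[symmetric] by (rule arg_cong[where f = exp]) (simp add: algebra_simps)
  finally show ?thesis .
qed

subsection \<open>Heavy neighbourhoods\<close>

definition heavy :: "nat \<Rightarrow> real \<Rightarrow> (nat \<Rightarrow> nat) \<Rightarrow> (nat set \<Rightarrow> bool) \<Rightarrow> nat set \<Rightarrow> nat set" where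
  "heavy m t r e I = {z. z < m \<and> t \<le> card (nbrs e r I z)}"

text \<open>Away from these points the neighbourhoods of the vertices of \<open>Z\<close> are
  pairwise disjoint.\<close>

definition multi :: "(nat \<Rightarrow> nat) \<Rightarrow> (nat set \<Rightarrow> bool) \<Rightarrow> nat set \<Rightarrow> nat set \<Rightarrow> nat set" where
  "multi r e I Z = {i\<in>I. \<exists>z\<in>Z. \<exists>z'\<in>Z. z \<noteq> z' \<and> e {z, r i} \<and> e {z', r i}}"

text \<open>A pair of points of \<open>I\<close> with a common neighbour either lies in a single heavy neighbourhood or is
  one of the following few pairs.\<close>

definition exceptional :: "nat \<Rightarrow> real \<Rightarrow> (nat \<Rightarrow> nat) \<Rightarrow> (nat set \<Rightarrow> bool) \<Rightarrow> nat set \<Rightarrow> (nat \<times> nat) set" where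
  "exceptional m t r e I = {(i, j). i \<in> I \<and> j \<in> I \<and> r i = r j} \<union>
     (\<Union>z\<in>{..<m} - heavy m t r e I. closed_pairs e r I z) \<union>
     (multi r e I (heavy m t r e I) \<times> I \<union> I \<times> multi r e I (heavy m t r e I))"

lemma of_nat_le_sum: "n \<le> (\<Sum>x\<in>S. f x) \<Longrightarrow> real n \<le> (\<Sum>x\<in>S. real (f x))"
  by (simp flip: of_nat_sum)

text \<open>Two vertices of \<open>Z\<close> have at most \<open>h\<close> common neighbours, and
  the fibre over each of them has at most \<open>M\<close> points.\<close>

lemma card_multi_le:
  fixes M :: real
  assumes I: "I \<subseteq> {..<n}" and r: "\<And>i. i \<in> I \<Longrightarrow> r i < m" and Z: "finite Z" "Z \<subseteq> {..<m}"
    and codeg: "\<And>x x'. x < m \<Longrightarrow> x' < m \<Longrightarrow> x \<noteq> x' \<Longrightarrow> card {y. y < m \<and> e {x, y} \<and> e {x', y}} \<le> h"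
    and M: "\<And>x. x < m \<Longrightarrow> card {i. i < n \<and> r i = x} \<le> M" "0 \<le> M"
  shows "card (multi r e I Z) \<le> (card Z)\<^sup>2 * (h * M)"
proof -
  have fI: "finite I" using I finite_subset by blast
  let ?P = "{(z, z'). z \<in> Z \<and> z' \<in> Z \<and> z \<noteq> z'}"
  let ?S = "\<lambda>(z, z'). {i\<in>I. e {z, r i} \<and> e {z', r i}}"
  have PZ: "?P \<subseteq> Z \<times> Z" by blast
  have fZZ: "finite (Z \<times> Z)" using Z by simp
  have fP: "finite ?P" by (rule finite_subset[OF PZ fZZ])
  have one: "real (card (?S zz)) \<le> h * M" if "zz \<in> ?P" for zz
  proof -
    obtain z z' where zz: "zz = (z, z')" by (cases zz)
    have z: "z < m" "z' < m" "z \<noteq> z'" using that Z unfolding zz by auto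
    let ?Y = "{y. y < m \<and> e {z, y} \<and> e {z', y}}"
    have fY: "finite ?Y" by simp
    have sub: "?S zz \<subseteq> (\<Union>y\<in>?Y. {i. i < n \<and> r i = y})" using I r unfolding zz by auto
    have "card (?S zz) \<le> card (\<Union>y\<in>?Y. {i. i < n \<and> r i = y})"
      by (rule card_mono[OF _ sub]) simp
    also have "\<dots> \<le> (\<Sum>y\<in>?Y. card {i. i < n \<and> r i = y})" by (rule card_UN_le[OF fY])
    finally have "real (card (?S zz)) \<le> (\<Sum>y\<in>?Y. real (card {i. i < n \<and> r i = y}))"
      by (rule of_nat_le_sum)
    also have "\<dots> \<le> (\<Sum>y\<in>?Y. M)" by (rule sum_mono) (simp add: M)
    also have "\<dots> \<le> h * M" using codeg[OF z] M(2) by (simp add: mult_right_mono)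
    finally show ?thesis .
  qed
  have "multi r e I Z \<subseteq> (\<Union>zz\<in>?P. ?S zz)" unfolding multi_def by auto
  moreover have "finite (\<Union>zz\<in>?P. ?S zz)" using fP fI by (intro finite_UN_I) auto
  ultimately have "card (multi r e I Z) \<le> card (\<Union>zz\<in>?P. ?S zz)" by (intro card_mono)
  also have "\<dots> \<le> (\<Sum>zz\<in>?P. card (?S zz))" by (rule card_UN_le[OF fP])
  finally have "real (card (multi r e I Z)) \<le> (\<Sum>zz\<in>?P. real (card (?S zz)))"
    by (rule of_nat_le_sum)
  also have "\<dots> \<le> (\<Sum>zz\<in>?P. h * M)" by (rule sum_mono[OF one])
  also have "\<dots> = card ?P * (h * M)" by simp
  also have "\<dots> \<le> card (Z \<times> Z) * (h * M)"
    using card_mono[OF fZZ PZ] M(2) by (intro mult_right_mono of_nat_mono) auto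
  finally show ?thesis by (simp add: card_cartesian_product power2_eq_square)
qed

text \<open>From \<open>q\<close> heavy vertices remove the points seen by two of them. The rests of
  their neighbourhoods are disjoint, each still has \<open>t\<close> points up to a small error, and
  together they would exceed \<open>I\<close>.\<close>

lemma card_heavy_less:
  fixes M t :: real
  assumes I: "I \<subseteq> {..<n}" and r: "\<And>i. i \<in> I \<Longrightarrow> r i < m"
    and codeg: "\<And>x x'. x < m \<Longrightarrow> x' < m \<Longrightarrow> x \<noteq> x' \<Longrightarrow> card {y. y < m \<and> e {x, y} \<and> e {x', y}} \<le> h"
    and M: "\<And>x. x < m \<Longrightarrow> card {i. i < n \<and> r i = x} \<le> M" "0 \<le> M"
    and q: "card I < q * (t - (real q)\<^sup>2 * (h * M))"
  shows "card (heavy m t r e I) < q"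
proof (rule ccontr)
  assume "\<not> card (heavy m t r e I) < q"
  then have le: "q \<le> card (heavy m t r e I)" by simp
  obtain Z where Z: "Z \<subseteq> heavy m t r e I" "card Z = q" "finite Z"
    by (rule obtain_subset_with_card_n[OF le])
  have Zm: "Z \<subseteq> {..<m}" using Z(1) unfolding heavy_def by blast
  have fI: "finite I" using I finite_subset by blast
  let ?N = "\<lambda>z. nbrs e r I z - multi r e I Z"
  have cm: "card (multi r e I Z) \<le> (real q)\<^sup>2 * (h * M)"
    using card_multi_le[OF I r Z(3) Zm codeg M] Z(2) by simp
  have fN: "finite (nbrs e r I z)" for z by (rule finite_nbrs[OF fI])
  have fM: "finite (multi r e I Z)" unfolding multi_def using fI by simp
  have one: "t - (real q)\<^sup>2 * (h * M) \<le> card (?N z)" if "z \<in> Z" for z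
  proof -
    have "t \<le> card (nbrs e r I z)" using that Z(1) unfolding heavy_def by blast
    moreover have "card (nbrs e r I z) \<le> card (?N z) + card (multi r e I Z)"
      using diff_card_le_card_Diff[OF fM, of "nbrs e r I z"] by linarith
    ultimately show ?thesis using cm by linarith
  qed
  have "q * (t - (real q)\<^sup>2 * (h * M)) = (\<Sum>z\<in>Z. t - (real q)\<^sup>2 * (h * M))" by (simp add: Z(2))
  also have "\<dots> \<le> (\<Sum>z\<in>Z. real (card (?N z)))" by (rule sum_mono[OF one])
  also have "\<dots> = real (card (\<Union>z\<in>Z. ?N z))"
  proof -
    have "card (\<Union>z\<in>Z. ?N z) = (\<Sum>z\<in>Z. card (?N z))"
    proof (rule card_UN_disjoint[OF Z(3)])
      show "\<forall>z\<in>Z. finite (?N z)" using fN by simp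
      show "\<forall>z\<in>Z. \<forall>z'\<in>Z. z \<noteq> z' \<longrightarrow> ?N z \<inter> ?N z' = {}"
        unfolding multi_def nbrs_def by blast
    qed
    then show ?thesis by simp
  qed
  also have "\<dots> \<le> card I" using fI by (intro of_nat_mono card_mono) (auto simp: nbrs_def)
  finally show False using q by simp
qed

lemma card_ordered_edges_le:
  assumes "finite A" "\<And>z. \<not> e {z}"
  shows "card {(z, y). z \<in> A \<and> y \<in> A \<and> e {z, y}} \<le> 2 * card {d\<in>edges_in A. e d}"
proof -
  let ?D = "{d\<in>edges_in A. e d}"
  have fD: "finite ?D" using finite_edges_in[OF assms(1)] by simp
  let ?L = "{(z, y). z \<in> A \<and> y \<in> A \<and> e {z, y} \<and> z < (y::nat)}"
  let ?G = "{(z, y). z \<in> A \<and> y \<in> A \<and> e {z, y} \<and> y < z}"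
  have im: "(\<lambda>(z, y). {z, y}) ` ?L \<subseteq> ?D" "(\<lambda>(z, y). {z, y}) ` ?G \<subseteq> ?D"
    unfolding edges_in_def by auto
  have "inj_on (\<lambda>(z, y). {z, y}) ?L" "inj_on (\<lambda>(z, y). {z, y}) ?G"
    by (auto simp: inj_on_def doubleton_eq_iff)
  then have "card ?L \<le> card ?D" "card ?G \<le> card ?D"
    using im fD by (auto intro: card_inj_on_le)
  moreover have "{(z, y). z \<in> A \<and> y \<in> A \<and> e {z, y}} = ?L \<union> ?G"
  proof (rule equalityI)
    show "{(z, y). z \<in> A \<and> y \<in> A \<and> e {z, y}} \<subseteq> ?L \<union> ?G"
    proof clarify
      fix z y assume a: "z \<in> A" "y \<in> A" "e {z, y}" "\<not> y < z"
      have "z \<noteq> y" using a(3) assms(2)[of z] by auto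
      then show "z < y" using a(4) by simp
    qed
  qed blast
  ultimately show ?thesis using card_Un_le[of ?L ?G] by simp
qed

text \<open>There are four sources. Each point shares its fibre with at most \<open>M\<close>
  points. Light vertices outside the image of \<open>I\<close> are bounded by \<open>y0\<close>. A
  light vertex inside the image closes at most \<open>t\<close> times as many pairs as it has
  neighbours in \<open>I\<close>, and these neighbours number at most \<open>2 * M * E0\<close> in
  total, as an edge inside the image is seen from both ends. Points in two heavy neighbourhoods are
  few and are given up together with all their pairs.\<close>

lemma card_exceptional_le:
  fixes M t E0 y0 :: real
  assumes I: "I \<subseteq> {..<n}" and r: "\<And>i. i \<in> I \<Longrightarrow> r i < m" and loop: "\<And>z. \<not> e {z}"
    and codeg: "\<And>x x'. x < m \<Longrightarrow> x' < m \<Longrightarrow> x \<noteq> x' \<Longrightarrow> card {y. y < m \<and> e {x, y} \<and> e {x', y}} \<le> h"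
    and M: "\<And>x. x < m \<Longrightarrow> card {i. i < n \<and> r i = x} \<le> M" "0 \<le> M"
    and q: "card (heavy m t r e I) \<le> q" and t: "0 \<le> t"
    and E0: "card {d\<in>edges_in (r ` I). e d} \<le> E0"
    and y0: "light_pairs m t r e I \<le> y0"
  shows "card (exceptional m t r e I) \<le> card I * M + (y0 + t * (2 * M * E0)) + 2 * real (card I) * ((real q)\<^sup>2 * (h * M))"
proof -
  have fI: "finite I" using I finite_subset by blast
  let ?A = "r ` I" and ?H = "heavy m t r e I"
  let ?X = "multi r e I ?H"
  have A: "?A \<subseteq> {..<m}" using r by blast
  have fA: "finite ?A" using fI by simp
  have fH: "finite ?H" "?H \<subseteq> {..<m}" unfolding heavy_def by auto
  have fX: "finite ?X" unfolding multi_def using fI by simp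
  have fib: "real (card {i\<in>I. r i = y}) \<le> M" if "y \<in> ?A" for y
  proof -
    have "card {i\<in>I. r i = y} \<le> card {i. i < n \<and> r i = y}" using I by (intro card_mono) auto
    then show ?thesis using M(1)[of y] that A by (auto intro: order_trans[rotated])
  qed
  have c1: "card {(i, j). i \<in> I \<and> j \<in> I \<and> r i = r j} \<le> card I * M"
  proof -
    have "{(i, j). i \<in> I \<and> j \<in> I \<and> r i = r j} = (SIGMA i:I. {j\<in>I. r j = r i})" by auto
    then have "card {(i, j). i \<in> I \<and> j \<in> I \<and> r i = r j} = (\<Sum>i\<in>I. card {j\<in>I. r j = r i})"
      using fI by (simp add: card_SigmaI)
    then have "real (card {(i, j). i \<in> I \<and> j \<in> I \<and> r i = r j}) = (\<Sum>i\<in>I. real (card {j\<in>I. r j = r i}))"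
      by simp
    also have "\<dots> \<le> (\<Sum>i\<in>I. M)" by (rule sum_mono[OF fib]) simp
    finally show ?thesis by simp
  qed
  have cN: "(\<Sum>z\<in>?A. real (card (nbrs e r I z))) \<le> 2 * M * E0"
  proof -
    have nb: "real (card (nbrs e r I z)) \<le> card {y\<in>?A. e {z, y}} * M" for z
    proof -
      have "nbrs e r I z \<subseteq> (\<Union>y\<in>{y\<in>?A. e {z, y}}. {i\<in>I. r i = y})" unfolding nbrs_def by auto
      then have "card (nbrs e r I z) \<le> card (\<Union>y\<in>{y\<in>?A. e {z, y}}. {i\<in>I. r i = y})"
        using fI by (intro card_mono) auto
      also have "\<dots> \<le> (\<Sum>y\<in>{y\<in>?A. e {z, y}}. card {i\<in>I. r i = y})" by (rule card_UN_le) (use fA in simp)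
      finally have "real (card (nbrs e r I z)) \<le> (\<Sum>y\<in>{y\<in>?A. e {z, y}}. real (card {i\<in>I. r i = y}))"
        by (rule of_nat_le_sum)
      also have "\<dots> \<le> (\<Sum>y\<in>{y\<in>?A. e {z, y}}. M)" by (rule sum_mono[OF fib]) blast
      finally show ?thesis by simp
    qed
    have "(\<Sum>z\<in>?A. real (card (nbrs e r I z))) \<le> (\<Sum>z\<in>?A. card {y\<in>?A. e {z, y}} * M)"
      by (rule sum_mono[OF nb])
    also have "\<dots> = real (\<Sum>z\<in>?A. card {y\<in>?A. e {z, y}}) * M" by (simp add: sum_distrib_right)
    also have "(\<Sum>z\<in>?A. card {y\<in>?A. e {z, y}}) = card (SIGMA z:?A. {y\<in>?A. e {z, y}})"
      using fA by (simp add: card_SigmaI)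
    also have "(SIGMA z:?A. {y\<in>?A. e {z, y}}) = {(z, y). z \<in> ?A \<and> y \<in> ?A \<and> e {z, y}}" by blast
    also have "card {(z, y). z \<in> ?A \<and> y \<in> ?A \<and> e {z, y}} * M \<le> (2 * E0) * M"
      using card_ordered_edges_le[where A = ?A and e = e, OF fA loop] E0 M(2) by (intro mult_right_mono) auto
    finally show ?thesis by (simp add: mult_ac)
  qed
  let ?L = "{..<m} - ?H"
  have c2: "card (\<Union>z\<in>?L. closed_pairs e r I z) \<le> y0 + t * (2 * M * E0)"
  proof -
    have lt: "card (nbrs e r I z) < t" if "z \<in> ?L" for z using that unfolding heavy_def by auto
    have "card (\<Union>z\<in>?L. closed_pairs e r I z) \<le> (\<Sum>z\<in>?L. card (closed_pairs e r I z))"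
      by (rule card_UN_le) simp
    then have "real (card (\<Union>z\<in>?L. closed_pairs e r I z)) \<le> (\<Sum>z\<in>?L. real (card (closed_pairs e r I z)))"
      by (rule of_nat_le_sum)
    also have "\<dots> = (\<Sum>z\<in>?L \<inter> ?A. real (card (closed_pairs e r I z))) + (\<Sum>z\<in>?L - ?A. real (card (closed_pairs e r I z)))"
      by (rule sum.Int_Diff) simp
    also have "(\<Sum>z\<in>?L - ?A. real (card (closed_pairs e r I z))) =
        (\<Sum>z\<in>?L - ?A. if card (nbrs e r I z) < t then real (card (closed_pairs e r I z)) else 0)"
      by (rule sum.cong[OF refl]) (use lt in simp)
    also have "\<dots> \<le> (\<Sum>z\<in>{..<m} - ?A. if card (nbrs e r I z) < t then real (card (closed_pairs e r I z)) else 0)"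
      by (rule sum_mono2) auto
    also have "\<dots> \<le> y0" by (rule y0)
    also have "(\<Sum>z\<in>?L \<inter> ?A. real (card (closed_pairs e r I z))) \<le> (\<Sum>z\<in>?L \<inter> ?A. t * real (card (nbrs e r I z)))"
    proof (rule sum_mono)
      fix z assume "z \<in> ?L \<inter> ?A"
      then have l: "card (nbrs e r I z) < t" using lt by blast
      have "real (card (closed_pairs e r I z)) \<le> real (card (nbrs e r I z)) * card (nbrs e r I z)"
        using card_closed_pairs_le[OF fI, of e r z] by (simp flip: of_nat_mult)
      also have "\<dots> \<le> t * card (nbrs e r I z)" using l by (intro mult_right_mono) auto
      finally show "real (card (closed_pairs e r I z)) \<le> t * real (card (nbrs e r I z))" .
    qed
    also have "\<dots> \<le> (\<Sum>z\<in>?A. t * real (card (nbrs e r I z)))"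
      using t fA by (intro sum_mono2) auto
    also have "\<dots> = t * (\<Sum>z\<in>?A. real (card (nbrs e r I z)))" by (simp add: sum_distrib_left)
    also have "\<dots> \<le> t * (2 * M * E0)" using cN t by (rule mult_left_mono)
    finally show ?thesis by simp
  qed
  have h0: "0 \<le> h * M" using M(2) by simp
  have cX: "card ?X \<le> (real q)\<^sup>2 * (h * M)"
  proof -
    have "card ?X \<le> (real (card ?H))\<^sup>2 * (h * M)" using card_multi_le[OF I r fH codeg M] by simp
    also have "\<dots> \<le> (real q)\<^sup>2 * (h * M)" using q h0 by (intro mult_right_mono power_mono) auto
    finally show ?thesis .
  qed
  have "card (?X \<times> I \<union> I \<times> ?X) \<le> card (?X \<times> I) + card (I \<times> ?X)" by (rule card_Un_le)
  then have "card (?X \<times> I \<union> I \<times> ?X) \<le> 2 * card I * card ?X"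
    unfolding card_cartesian_product by (simp add: mult.commute)
  then have "real (card (?X \<times> I \<union> I \<times> ?X)) \<le> 2 * real (card I) * real (card ?X)"
    by (metis of_nat_le_iff of_nat_mult of_nat_numeral)
  also have "\<dots> \<le> 2 * real (card I) * ((real q)\<^sup>2 * (h * M))" using cX by (intro mult_left_mono) auto
  finally have c3: "real (card (?X \<times> I \<union> I \<times> ?X)) \<le> 2 * real (card I) * ((real q)\<^sup>2 * (h * M))" .
  have "card (exceptional m t r e I) \<le> card {(i, j). i \<in> I \<and> j \<in> I \<and> r i = r j}
      + card (\<Union>z\<in>?L. closed_pairs e r I z) + card (?X \<times> I \<union> I \<times> ?X)"
    unfolding exceptional_def by (intro order_trans[OF card_Un_le] add_right_mono card_Un_le)
  then show ?thesis using c1 c2 c3 by linarith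
qed

text \<open>This encodes the heavy neighbourhoods by finite data: a list \<open>\<zeta>\<close> of
  vertices and the index \<open>a i\<close> of one neighbourhood containing \<open>i\<close>. The
  data range over extensional function spaces, so that the union bound can count them.\<close>

lemma ex_piece_assignment:
  fixes I :: "nat set"
  assumes m: "0 < m" and H: "card (heavy m t r e I) \<le> q" and fI: "finite I"
  shows "\<exists>\<zeta>\<in>{..<q} \<rightarrow>\<^sub>E {..<m}. \<exists>a\<in>I \<rightarrow>\<^sub>E {..q}.
     (\<forall>i\<in>I. a i < q \<longrightarrow> e {\<zeta> (a i), r i}) \<and>
     (\<forall>i\<in>I. \<forall>j\<in>I. (\<exists>z<m. e {z, r i} \<and> e {z, r j}) \<longrightarrow> (a i = a j \<and> a i < q) \<or> (i, j) \<in> exceptional m t r e I)"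
proof -
  let ?H = "heavy m t r e I"
  have fH: "finite ?H" unfolding heavy_def by simp
  obtain f where f: "bij_betw f {..<card ?H} ?H" using ex_bij_betw_nat_finite[OF fH] by (auto simp: atLeast0LessThan)
  \<comment> \<open>The list is padded by 0 to the fixed length \<open>q\<close>; an index below
    \<open>q\<close> taken by \<open>a\<close> always points to a genuine heavy vertex.\<close>
  define \<zeta> where "\<zeta> = (\<lambda>c\<in>{..<q}. if c < card ?H then f c else 0)"
  have fm: "f c \<in> ?H" if "c < card ?H" for c using bij_betwE[OF f] that by blast
  have fm': "f c < m" if "c < card ?H" for c using fm[OF that] unfolding heavy_def by blast
  have \<zeta>: "\<zeta> \<in> {..<q} \<rightarrow>\<^sub>E {..<m}" unfolding \<zeta>_def using m fm' by auto
  have \<zeta>c: "\<zeta> c = f c" if "c < card ?H" for c using that H unfolding \<zeta>_def by simp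
  have onto: "\<exists>c<card ?H. \<zeta> c = z" if "z \<in> ?H" for z
  proof -
    have "z \<in> f ` {..<card ?H}" using f that unfolding bij_betw_def by blast
    then show ?thesis using \<zeta>c by auto
  qed
  let ?P = "\<lambda>i c. c < card ?H \<and> e {\<zeta> c, r i}"
  \<comment> \<open>The least index makes the choice canonical; the value \<open>q\<close> marks
    points in no heavy neighbourhood.\<close>
  define a where "a = (\<lambda>i\<in>I. if \<exists>c. ?P i c then (LEAST c. ?P i c) else q)"
  have a1: "?P i (a i)" if "i \<in> I" "?P i c" for i c
  proof -
    have "?P i (LEAST c. ?P i c)" by (rule LeastI) (rule that(2))
    moreover have "a i = (LEAST c. ?P i c)" unfolding a_def using that by auto
    ultimately show ?thesis by simp
  qed
  have a2: "a i \<le> c" if "i \<in> I" "?P i c" for i c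
  proof -
    have "(LEAST c. ?P i c) \<le> c" by (rule Least_le) (rule that(2))
    moreover have "a i = (LEAST c. ?P i c)" unfolding a_def using that by auto
    ultimately show ?thesis by simp
  qed
  have a3: "a i = q" if "i \<in> I" "\<nexists>c. ?P i c" for i using that unfolding a_def by auto
  have aP: "?P i (a i)" if "i \<in> I" "a i < q" for i using a1[OF that(1)] a3[OF that(1)] that(2) by fastforce
  have aq: "a i \<le> q" if "i \<in> I" for i using a1[OF that] a3[OF that] H by (metis le_trans less_imp_le order_refl)
  have aE: "a \<in> I \<rightarrow>\<^sub>E {..q}"
  proof (rule PiE_I)
    show "a i \<in> {..q}" if "i \<in> I" for i using aq[OF that] by simp
    show "a i = undefined" if "i \<notin> I" for i using that by (simp add: a_def)
  qed
  have "(a i = a j \<and> a i < q) \<or> (i, j) \<in> exceptional m t r e I"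
    if ij: "i \<in> I" "j \<in> I" and z: "z < m" "e {z, r i}" "e {z, r j}" for i j z
  proof (cases "z \<in> ?H")
    case False
    then show ?thesis using ij z unfolding exceptional_def closed_pairs_def nbrs_def by blast
  next
    case True
    obtain c where c: "c < card ?H" "\<zeta> c = z" using onto[OF True] by blast
    have Pi: "?P i c" and Pj: "?P j c" using c z by simp_all
    have ai: "?P i (a i)" by (rule a1[OF ij(1) Pi])
    have aj: "?P j (a j)" by (rule a1[OF ij(2) Pj])
    have ih: "\<zeta> (a i) \<in> ?H" "\<zeta> (a j) \<in> ?H" using ai aj fm \<zeta>c by auto
    show ?thesis
    \<comment> \<open>If both points were assigned to \<open>z\<close>, minimality makes their
      indices equal. Otherwise one of them sees \<open>z\<close> and a second heavy vertex, so it
      belongs to \<open>multi\<close>.\<close>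
    proof (cases "\<zeta> (a i) = z \<and> \<zeta> (a j) = z")
      case True
      then have "?P j (a i)" "?P i (a j)" using ai aj z by simp_all
      then have "a j \<le> a i" "a i \<le> a j" using a2 ij by blast+
      then show ?thesis using ai H by simp
    next
      case False
      then have "i \<in> multi r e I ?H \<or> j \<in> multi r e I ?H"
        using ai aj ih z ij \<open>z \<in> ?H\<close> unfolding multi_def by blast
      then show ?thesis using ij unfolding exceptional_def by blast
    qed
  qed
  then have "\<forall>i\<in>I. \<forall>j\<in>I. (\<exists>z<m. e {z, r i} \<and> e {z, r j}) \<longrightarrow> (a i = a j \<and> a i < q) \<or> (i, j) \<in> exceptional m t r e I"
    by (intro ballI impI, elim exE conjE)
  moreover have "\<forall>i\<in>I. a i < q \<longrightarrow> e {\<zeta> (a i), r i}" using aP by (intro ballI impI) simp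
  ultimately show ?thesis by (intro bexI[OF _ \<zeta>] bexI[OF _ aE] conjI)
qed

text \<open>In use, \<open>J\<close> belongs to one colour and \<open>a\<close> to the other: a pair
  inside a single piece may lose its edge for free, a separated pair only for an exceptional
  reason.\<close>

definition separated :: "nat \<Rightarrow> (nat \<Rightarrow> nat) \<Rightarrow> nat set \<Rightarrow> nat set set" where
  "separated q a J = {d\<in>edges_in J. \<not> (\<exists>c<q. \<forall>i\<in>d. a i = c)}"

definition pair_edges :: "(nat \<times> nat) set \<Rightarrow> nat set \<Rightarrow> nat set set" where
  "pair_edges X J = {d\<in>edges_in J. \<exists>(i, j)\<in>X. d = {i, j}}"

lemma card_pair_edges_le: "finite X \<Longrightarrow> card (pair_edges X J) \<le> card X"
proof -
  assume X: "finite X"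
  have "pair_edges X J \<subseteq> (\<lambda>(i, j). {i, j}) ` X" unfolding pair_edges_def by auto
  then have "card (pair_edges X J) \<le> card ((\<lambda>(i, j). {i, j}) ` X)" using X by (intro card_mono) auto
  also have "\<dots> \<le> card X" by (rule card_image_le[OF X])
  finally show ?thesis .
qed

text \<open>Here \<open>e0\<close> is the triangle-free part of \<open>e\<close>. The hypothesis
  \<open>closed\<close> is what independence of a k-set yields, so a separated edge of
  \<open>e\<close> either was removed with a triangle or lies on an exceptional pair.\<close>

lemma card_coloured_separated_le:
  assumes fJ: "finite J" and J: "J \<subseteq> I" and inj: "inj_on r J"
    and closed: "\<And>i j. i \<in> J \<Longrightarrow> j \<in> J \<Longrightarrow> e0 {r i, r j} \<Longrightarrow> (a i = a j \<and> a i < q) \<or> (i, j) \<in> X"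
  shows "card {d\<in>separated q a J. e (r ` d)} \<le>
     card {d\<in>edges_in (r ` J). e d \<and> \<not> e0 d} + card {d\<in>pair_edges X J. e (r ` d)}"
proof -
  let ?S = "{d\<in>separated q a J. e (r ` d)}"
  let ?S1 = "{d\<in>edges_in J. e (r ` d) \<and> \<not> e0 (r ` d)}"
  let ?S2 = "{d\<in>pair_edges X J. e (r ` d)}"
  have fE: "finite (edges_in J)" by (rule finite_edges_in[OF fJ])
  have "?S \<subseteq> ?S1 \<union> ?S2"
  proof
    fix d assume d: "d \<in> ?S"
    then have dJ: "d \<in> edges_in J" "e (r ` d)" "\<not> (\<exists>c<q. \<forall>i\<in>d. a i = c)" unfolding separated_def by blast+
    show "d \<in> ?S1 \<union> ?S2"
    proof (cases "e0 (r ` d)")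
      case True
      obtain i j where ij: "d = {i, j}" using dJ(1) unfolding edges_in_def card_2_iff by blast
      have "i \<in> J" "j \<in> J" using dJ(1) ij unfolding edges_in_def by blast+
      moreover have "e0 {r i, r j}" using True ij by simp
      ultimately have "(a i = a j \<and> a i < q) \<or> (i, j) \<in> X" by (rule closed)
      moreover have "\<not> (a i = a j \<and> a i < q)" using dJ(3) ij by auto
      ultimately have "(i, j) \<in> X" by blast
      then show ?thesis using dJ ij unfolding pair_edges_def by blast
    next
      case False then show ?thesis using dJ by blast
    qed
  qed
  moreover have "finite (?S1 \<union> ?S2)" using fE unfolding pair_edges_def by simp
  ultimately have "card ?S \<le> card (?S1 \<union> ?S2)" by (intro card_mono)
  also have "\<dots> \<le> card ?S1 + card ?S2" by (rule card_Un_le)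
  also have "card ?S1 \<le> card {d\<in>edges_in (r ` J). e d \<and> \<not> e0 d}"
  proof (rule card_inj_on_le)
    show "inj_on ((`) r) ?S1" by (rule image_edges(1)[OF inj]) blast
    show "(`) r ` ?S1 \<subseteq> {d\<in>edges_in (r ` J). e d \<and> \<not> e0 d}"
    proof (rule image_subsetI)
      fix d assume "d \<in> ?S1"
      then have d: "d \<subseteq> J" "card d = 2" "e (r ` d)" "\<not> e0 (r ` d)" unfolding edges_in_def by blast+
      have "card (r ` d) = 2" using d(2) card_image[OF inj_on_subset[OF inj d(1)]] by simp
      then show "r ` d \<in> {d\<in>edges_in (r ` J). e d \<and> \<not> e0 d}" using d unfolding edges_in_def by blast
    qed
    show "finite {d\<in>edges_in (r ` J). e d \<and> \<not> e0 d}" using finite_edges_in[of "r ` J"] fJ by simp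
  qed
  finally show ?thesis by simp
qed

lemma card_separated_ge:
  assumes fJ: "finite J"
  shows "((real (card J))\<^sup>2 - card J - (\<Sum>c<q. (real (card {i\<in>J. a i = c}))\<^sup>2)) / 2 \<le> card (separated q a J)"
proof -
  let ?K = "\<lambda>c. {i\<in>J. a i = c}"
  have ch: "real (n choose 2) = ((real n)\<^sup>2 - n) / 2" for n
    by (cases n) (auto simp: choose_two real_of_nat_div power2_eq_square algebra_simps)
  have fE: "finite (edges_in J)" by (rule finite_edges_in[OF fJ])
  have "edges_in J \<subseteq> separated q a J \<union> (\<Union>c\<in>{..<q}. edges_in (?K c))"
  proof
    fix d assume d: "d \<in> edges_in J"
    show "d \<in> separated q a J \<union> (\<Union>c\<in>{..<q}. edges_in (?K c))"
    proof (cases "\<exists>c<q. \<forall>i\<in>d. a i = c")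
      case True
      then obtain c where "c < q" "\<forall>i\<in>d. a i = c" by blast
      then have "d \<in> edges_in (?K c)" "c \<in> {..<q}" using d unfolding edges_in_def by auto
      then show ?thesis by blast
    next
      case False then show ?thesis using d unfolding separated_def by blast
    qed
  qed
  moreover have "finite (separated q a J \<union> (\<Union>c\<in>{..<q}. edges_in (?K c)))"
    using fE fJ finite_edges_in unfolding separated_def by simp
  ultimately have "card (edges_in J) \<le> card (separated q a J \<union> (\<Union>c\<in>{..<q}. edges_in (?K c)))"
    by (intro card_mono)
  also have "\<dots> \<le> card (separated q a J) + card (\<Union>c\<in>{..<q}. edges_in (?K c))" by (rule card_Un_le)
  also have "card (\<Union>c\<in>{..<q}. edges_in (?K c)) \<le> (\<Sum>c<q. card (edges_in (?K c)))" by (rule card_UN_le) simp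
  finally have "real (card (edges_in J)) \<le> real (card (separated q a J) + (\<Sum>c<q. card (edges_in (?K c))))"
    by (intro of_nat_mono) simp
  also have "\<dots> = card (separated q a J) + (\<Sum>c<q. real (card (edges_in (?K c))))" by simp
  also have "(\<Sum>c<q. real (card (edges_in (?K c)))) = (\<Sum>c<q. ((real (card (?K c)))\<^sup>2 - card (?K c)) / 2)"
    using fJ by (intro sum.cong refl) (simp add: card_edges_in ch)
  also have "\<dots> \<le> (\<Sum>c<q. (real (card (?K c)))\<^sup>2 / 2)" by (rule sum_mono) simp
  also have "\<dots> = (\<Sum>c<q. (real (card (?K c)))\<^sup>2) / 2" by (simp add: sum_divide_distrib)
  finally show ?thesis using fJ by (simp add: card_edges_in ch)
qed

text \<open>The extremal inequality behind the union bound: \<open>x\<close>, \<open>y\<close> are the numbers of rows and columns,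
  \<open>u\<close>, \<open>v\<close> the sizes of the parts of a \<open>k\<close>-set covered by large neighbourhoods, and \<open>S\<close>, \<open>S'\<close>
  the sums of the squares of the pieces. For \<open>\<beta> = 1\<close> the bound \<open>x\<^sup>2 + y\<^sup>2 - S - S' \<ge> 2 (x + y - k)\<close>
  is tight, so any density \<open>\<beta> > 1\<close> gives room.\<close>

lemma density_beats_entropy:
  fixes x y u v S S' k :: real
  assumes k: "0 < k" and nn: "0 \<le> x" "0 \<le> y" "0 \<le> u" "0 \<le> v"
    and xu: "x \<le> k - u" and yv: "y \<le> k - v"
    and S: "S \<le> v\<^sup>2" "S \<le> x\<^sup>2" "S \<le> 9/20 * k * x"
    and S': "S' \<le> u\<^sup>2" "S' \<le> y\<^sup>2" "S' \<le> 9/20 * k * y"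
  shows "k * (x + y - k) + 1/1000 * k\<^sup>2 \<le> 11/20 * (x\<^sup>2 + y\<^sup>2 - S - S')"
proof -
  have a: "2 * k * (x + y - k) \<le> x\<^sup>2 + y\<^sup>2 - S - S'"
  proof -
    have "u\<^sup>2 \<le> (k - x)\<^sup>2" using nn xu by (intro power_mono) auto
    moreover have "v\<^sup>2 \<le> (k - y)\<^sup>2" using nn yv by (intro power_mono) auto
    ultimately show ?thesis using S(1) S'(1) by (simp add: power2_eq_square algebra_simps)
  qed
  have b: "0 \<le> x\<^sup>2 + y\<^sup>2 - S - S'" using S(2) S'(2) by linarith
  \<comment> \<open>Well above \<open>x + y = k\<close> the bound \<open>a\<close> leaves a surplus
    of one tenth, and well below it the left side is not positive. In between, \<open>x\<close> or
    \<open>y\<close> is about \<open>k/2\<close>, which exceeds the cap \<open>9/20 * k\<close> on a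
    single piece, so that a fixed part of its square survives.\<close>
  consider "x + y - k \<ge> 1/100 * k" | "x + y - k \<le> - (1/1000) * k" | "x + y - k \<le> 1/100 * k" "- (1/1000) * k \<le> x + y - k"
    by linarith
  then show ?thesis
  proof cases
    case 1
    then have "k * (1/100 * k) \<le> k * (x + y - k)" using k by (intro mult_left_mono) auto
    then show ?thesis using a by (simp add: power2_eq_square algebra_simps)
  next
    case 2
    then have "k * (x + y - k) \<le> k * (- (1/1000) * k)" using k by (intro mult_left_mono) auto
    then show ?thesis using b by (simp add: power2_eq_square)
  next
    case 3
    have one: "247/10000 * k\<^sup>2 \<le> s\<^sup>2 - 9/20 * k * s" if "999/2000 * k \<le> s" for s :: real
    proof -
      have "(999/2000 * k) * (99/2000 * k) \<le> s * (s - 9/20 * k)" using that k by (intro mult_mono) auto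
      then have "98901/4000000 * k\<^sup>2 \<le> s\<^sup>2 - 9/20 * k * s" by (simp add: power2_eq_square algebra_simps)
      moreover have "0 \<le> k\<^sup>2" by simp
      ultimately show ?thesis by linarith
    qed
    have "999/2000 * k \<le> x \<or> 999/2000 * k \<le> y" using 3 by linarith
    then have "247/10000 * k\<^sup>2 \<le> x\<^sup>2 + y\<^sup>2 - S - S'"
      using one[of x] one[of y] S S' by (elim disjE) linarith+
    moreover have "k * (x + y - k) \<le> k * (1/100 * k)" using 3 k by (intro mult_left_mono) auto
    then have "k * (x + y - k) \<le> 1/100 * k\<^sup>2" by (simp add: power2_eq_square)
    moreover have "0 \<le> k\<^sup>2" by simp
    moreover define P Q where "P = k * (x + y - k)" and "Q = x\<^sup>2 + y\<^sup>2 - S - S'"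
    ultimately have "P + 1/1000 * k\<^sup>2 \<le> 11/20 * Q" by linarith
    then show ?thesis by (simp only: P_def Q_def)
  qed
qed

subsection \<open>The union bound\<close>

text \<open>\<open>m\<close> is the order of a base graph of density \<open>p\<close>; degrees in it are at most \<open>\<Delta>\<close>, codegrees at most \<open>h\<close>,
  and \<open>M\<close> bounds the fibres of the vertex map. A base vertex is heavy for a \<open>k\<close>-set if it sees at least \<open>t\<close>
  of its points; there are fewer than \<open>q\<close> such vertices. At most \<open>x0\<close> pairs of a \<open>k\<close>-set are exceptional,
  \<open>F\<close> bounds the edge-disjoint triangles, \<open>\<tau>1\<close> the edges on exceptional pairs, and \<open>\<tau>\<close> all edges that may
  be lost in a \<open>k\<close>-set without lying in a common heavy neighbourhood. \<open>\<theta>\<close> and \<open>\<mu>\<close> are exponents of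
  exponential moments.\<close>

locale two_bites =
  fixes k n m h q F :: nat and p M t \<Delta> \<tau> \<tau>1 E0 y0 x0 \<theta> \<mu> \<Lambda> :: real
  assumes p: "0 \<le> p" "p \<le> 1" and m0: "0 < m" and k0: "0 < k" and M0: "0 \<le> M" and t0: "0 \<le> t" and \<Delta>0: "0 \<le> \<Delta>"
    and \<theta>: "0 \<le> \<theta>" "\<theta> * t * M \<le> 1" "p * (\<theta> * t) * k \<le> 1" and \<mu>0: "0 \<le> \<mu>"
    and codeg_num: "real m ^ 2 * (m * p\<^sup>2) ^ h \<le> 1/64"
    and deg_num: "m * exp (p * m * (exp (1/50) - 1) - 1/50 * \<Delta>) \<le> 1/64"
    and fibre_num: "m * exp (n * (1 / m) * (exp 1 - 1) - M) \<le> 1/64"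
    and nbr_num: "m * exp (n * (\<Delta> / m) * (exp (1/50) - 1) - 1/50 * (9/20 * k)) \<le> 1/64"
    and packing_num: "(n choose k) * ((real (k\<^sup>2 * m) * p ^ 3) ^ F / fact F) \<le> 1/64"
    and edge_num: "(n choose k) * exp (p * k\<^sup>2 * (exp 1 - 1) - E0) \<le> 1/64"
    and light_num: "(n choose k) * exp (m * (\<theta> * (real k)\<^sup>2 * p\<^sup>2 * exp 4) - \<theta> * y0) \<le> 1/64"
    and exc_num: "(n choose k) * (2 ^ k * exp (p * x0 * (exp \<mu> - 1) - \<mu> * \<tau>1)) \<le> 1/64"
    and heavy_num: "k < q * (t - (real q)\<^sup>2 * (h * M))"
    and x0: "k * M + (y0 + t * (2 * M * E0)) + 2 * real k * ((real q)\<^sup>2 * (h * M)) \<le> x0"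
    and \<tau>: "3 * F + \<tau>1 \<le> \<tau>"
    and \<Lambda>: "1 \<le> \<Lambda>" "\<Delta> / m \<le> \<Lambda> / k" "k / m \<le> \<Lambda> / k"
    and density: "(1 - exp (- 3)) * p \<ge> 57/50 * (ln k / k)" and lnk: "0 \<le> ln k"
    and main_num: "(n choose k) * (((real m ^ q) * real (q + 1) ^ k * 2 ^ k)\<^sup>2 *
       exp (2 * k * ln \<Lambda> + 6 * \<tau> - 1001/1000 * (k * ln k) + 57/50 * ln k)) \<le> 1/64"
begin

abbreviation "St \<equiv> pair_pmf (rmap n m) (gnp m p)"

section \<open>Typical behaviour of one colour\<close>

definition ksets :: "nat set set" where "ksets = {I. I \<subseteq> {..<n} \<and> card I = k}"

lemma finite_ksets: "finite ksets" unfolding ksets_def by (rule finite_subset[of _ "Pow {..<n}"]) auto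
lemma card_ksets: "card ksets = n choose k" unfolding ksets_def using n_subsets[of "{..<n}" k] by simp
lemma ksetD: "I \<in> ksets \<Longrightarrow> I \<subseteq> {..<n} \<and> card I = k \<and> finite I"
  unfolding ksets_def using finite_subset by blast

lemma fin_R: "finite (set_pmf (rmap n m))" by (rule finite_set_rmap[OF m0])
lemma fin_G: "finite (set_pmf (gnp m p))" by (rule finite_set_gnp)
lemma fin_St: "finite (set_pmf St)" using fin_R fin_G by simp

definition codeg_ok where "codeg_ok e \<longleftrightarrow> (\<forall>x<m. \<forall>x'<m. x \<noteq> x' \<longrightarrow> card {y. y < m \<and> e {x, y} \<and> e {x', y}} \<le> h)"
definition deg_ok where "deg_ok e \<longleftrightarrow> (\<forall>z<m. card {y. y < m \<and> e {z, y}} \<le> \<Delta>)"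
definition fibre_ok where "fibre_ok r \<longleftrightarrow> (\<forall>x<m. card {i. i < n \<and> r i = x} \<le> M)"
definition nbr_ok where "nbr_ok r e \<longleftrightarrow> (\<forall>z<m. card {i. i < n \<and> e {z, r i}} \<le> 9/20 * k)"
definition packing_ok where "packing_ok r e I \<longleftrightarrow> (\<nexists>\<T>. triangle_packing m e \<T> \<and> (\<forall>T\<in>\<T>. 2 \<le> card (T \<inter> r ` I)) \<and> F \<le> card \<T>)"
definition edge_ok where "edge_ok r e I \<longleftrightarrow> card {d\<in>edges_in (r ` I). e d} \<le> E0"
definition light_ok where "light_ok r e I \<longleftrightarrow> light_pairs m t r e I \<le> y0"

definition good where "good r e \<longleftrightarrow> (\<forall>i<n. r i < m) \<and> (\<forall>z. \<not> e {z}) \<and> codeg_ok e \<and> deg_ok e \<and> fibre_ok r \<and> nbr_ok r e \<and>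
  (\<forall>I\<in>ksets. packing_ok r e I \<and> edge_ok r e I \<and> light_ok r e I)"

lemma prob_ksets_le:
  fixes c d :: real
  assumes "\<And>I. I \<in> ksets \<Longrightarrow> prb P {x. Q I x} \<le> c" "(n choose k) * c \<le> d"
  shows "prb P {x. \<exists>I\<in>ksets. Q I x} \<le> d"
proof -
  have "{x. \<exists>I\<in>ksets. Q I x} = (\<Union>I\<in>ksets. {x. Q I x})" by blast
  also have "prb P \<dots> \<le> card ksets * c" by (rule prob_UN_le[OF finite_ksets assms(1)])
  also have "\<dots> \<le> d" using assms(2) by (simp add: card_ksets)
  finally show ?thesis .
qed

lemma prob_conj_const:
  fixes c :: real
  assumes "A \<Longrightarrow> prb P {x. Q x} \<le> c" "0 \<le> c" shows "prb P {x. A \<and> Q x} \<le> c"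
  using assms by (cases A) simp_all

lemma prob_codeg: "prb (gnp m p) {e. \<not> codeg_ok e} \<le> 1/64"
proof -
  have "prb (gnp m p) {e. \<not> codeg_ok e} \<le>
    prb (gnp m p) {e. \<exists>x<m. \<exists>x'<m. x \<noteq> x' \<and> h \<le> card {y. y < m \<and> e {x,y} \<and> e {x',y}}}"
    by (rule measure_pmf.finite_measure_mono) (force simp: codeg_ok_def not_le)+
  also have "\<dots> \<le> 1/64" using codegree_tail[OF p, of m h] codeg_num by linarith
  finally show ?thesis .
qed

lemma prob_deg: "prb (gnp m p) {e. \<not> deg_ok e} \<le> 1/64"
proof -
  have "prb (gnp m p) {e. \<not> deg_ok e} \<le> prb (gnp m p) {e. \<exists>x<m. 1/50 * \<Delta> \<le> 1/50 * card {y. y < m \<and> e {x,y}}}"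
    by (rule measure_pmf.finite_measure_mono) (force simp: deg_ok_def not_le)+
  also have "\<dots> \<le> 1/64" using degree_tail[OF p, of "1/50" m "1/50 * \<Delta>"] deg_num by linarith
  finally show ?thesis .
qed

lemma prob_fibre: "prb (rmap n m) {r. \<not> fibre_ok r} \<le> 1/64"
proof -
  have "prb (rmap n m) {r. \<not> fibre_ok r} \<le> prb (rmap n m) {r. \<exists>x<m. M \<le> 1 * real (card {i. i < n \<and> r i \<in> {x}})}"
    by (rule measure_pmf.finite_measure_mono) (force simp: fibre_ok_def not_le)+
  also have "\<dots> \<le> m * exp (n * (1 / m) * (exp 1 - 1) - M)"
    by (rule fibre_tail[OF m0]) auto
  finally show ?thesis using fibre_num by linarith
qed

text \<open>For a fixed graph the points mapped into a neighbourhood are binomially distributed with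
  mean at most \<open>n * \<Delta> / m\<close>. The gap between this mean and
  \<open>9/20 * k\<close> is linear in \<open>k\<close>, so a small fixed exponent is enough for a
  union over all base vertices.\<close>

lemma prob_nbr:
  assumes "deg_ok e" shows "prb (rmap n m) {r. (\<forall>i<n. r i < m) \<and> \<not> nbr_ok r e} \<le> 1/64"
proof -
  let ?S = "\<lambda>x. {y. y < m \<and> e {x, y}}"
  have "prb (rmap n m) {r. (\<forall>i<n. r i < m) \<and> \<not> nbr_ok r e} \<le> prb (rmap n m) {r. \<exists>x<m. 1/50 * (9/20 * k) \<le> 1/50 * card {i. i < n \<and> r i \<in> ?S x}}"
  proof (rule measure_pmf.finite_measure_mono)
    show "{r. (\<forall>i<n. r i < m) \<and> \<not> nbr_ok r e}
      \<subseteq> {r. \<exists>x<m. 1/50 * (9/20 * k) \<le> 1/50 * real (card {i. i < n \<and> r i \<in> ?S x})}"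
    proof
      fix r assume "r \<in> {r. (\<forall>i<n. r i < m) \<and> \<not> nbr_ok r e}"
      then obtain z where r: "\<forall>i<n. r i < m" and z: "z < m" "\<not> card {i. i < n \<and> e {z, r i}} \<le> 9/20 * k"
        unfolding nbr_ok_def by blast
      have "{i. i < n \<and> r i \<in> ?S z} = {i. i < n \<and> e {z, r i}}" using r by auto
      then show "r \<in> {r. \<exists>x<m. 1/50 * (9/20 * k) \<le> 1/50 * real (card {i. i < n \<and> r i \<in> ?S x})}"
        using z by (intro CollectI exI[of _ z]) simp
    qed
  qed simp
  also have "\<dots> \<le> m * exp (n * (\<Delta> / m) * (exp (1/50) - 1) - 1/50 * (9/20 * k))"
    by (rule fibre_tail[OF m0]) (use assms in \<open>auto simp: deg_ok_def\<close>)
  finally show ?thesis using nbr_num by linarith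
qed

lemma card_image_ksets:
  assumes "I \<in> ksets" shows "card (r ` I) \<le> k"
  using ksetD[OF assms] card_image_le[of I r] by simp

lemma prob_packing:
  assumes r: "\<forall>i<n. r i < m"
  shows "prb (gnp m p) {e. \<exists>I\<in>ksets. \<not> packing_ok r e I} \<le> 1/64"
proof (rule prob_ksets_le[OF _ packing_num])
  fix I assume I: "I \<in> ksets"
  have A: "r ` I \<subseteq> {..<m}" using ksetD[OF I] r by auto
  have "prb (gnp m p) {e. \<not> packing_ok r e I} \<le> (real (card (r ` I) ^ 2 * m) * p ^ 3) ^ F / fact F"
    unfolding packing_ok_def not_not by (rule triangle_packing_tail[OF p A])
  also have "\<dots> \<le> (real (k\<^sup>2 * m) * p ^ 3) ^ F / fact F"
    using card_image_ksets[OF I, of r] p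
    by (intro divide_right_mono power_mono mult_right_mono of_nat_mono mult_le_mono1) auto
  finally show "prb (gnp m p) {e. \<not> packing_ok r e I} \<le> (real (k\<^sup>2 * m) * p ^ 3) ^ F / fact F" .
qed

lemma card_edges_in_le: "finite A \<Longrightarrow> card (edges_in A) \<le> (card A)\<^sup>2"
  by (subst card_edges_in) (auto intro: choose_le_pow)

lemma prob_edge:
  assumes r: "\<forall>i<n. r i < m"
  shows "prb (gnp m p) {e. \<exists>I\<in>ksets. \<not> edge_ok r e I} \<le> 1/64"
proof (rule prob_ksets_le[OF _ edge_num])
  fix I assume I: "I \<in> ksets"
  have A: "r ` I \<subseteq> {..<m}" using ksetD[OF I] r by auto
  then have Q: "edges_in (r ` I) \<subseteq> edges m" using edges_in_mono unfolding edges_in_lessThan[symmetric] by blast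
  have "card (edges_in (r ` I)) \<le> (card (r ` I))\<^sup>2" using ksetD[OF I] by (intro card_edges_in_le) auto
  also have "\<dots> \<le> k\<^sup>2" by (rule power_mono[OF card_image_ksets[OF I]]) simp
  finally have c: "real (card (edges_in (r ` I))) \<le> (real k)\<^sup>2" by (metis of_nat_le_iff of_nat_power)
  have "prb (gnp m p) {e. \<not> edge_ok r e I} \<le> exp (p * card (edges_in (r ` I)) * (exp 1 - 1) - E0)"
    by (rule gnp_tail[OF p Q]) (auto simp: edge_ok_def)
  also have "\<dots> \<le> exp (p * (real k)\<^sup>2 * (exp 1 - 1) - E0)"
    using p c by (auto intro!: mult_right_mono mult_left_mono)
  finally show "prb (gnp m p) {e. \<not> edge_ok r e I} \<le> exp (p * k\<^sup>2 * (exp 1 - 1) - E0)" by simp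
qed

lemma fibre_in_kset:
  assumes "fibre_ok r" "I \<in> ksets" "x < m"
  shows "card {i\<in>I. r i = x} \<le> M"
proof -
  have "card {i\<in>I. r i = x} \<le> card {i. i < n \<and> r i = x}" using ksetD[OF assms(2)] by (intro card_mono) auto
  moreover have "card {i. i < n \<and> r i = x} \<le> M" using assms(1,3) unfolding fibre_ok_def by blast
  ultimately show ?thesis by linarith
qed

lemma prob_light:
  assumes r: "\<forall>i<n. r i < m" and f: "fibre_ok r"
  shows "prb (gnp m p) {e. \<exists>I\<in>ksets. \<not> light_ok r e I} \<le> 1/64"
proof (rule prob_ksets_le[OF _ light_num])
  fix I assume I: "I \<in> ksets"
  have A: "r ` I \<subseteq> {..<m}" using ksetD[OF I] r by auto
  have fI: "finite I" "card I = k" using ksetD[OF I] by auto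
  have "prb (gnp m p) {e. \<not> light_ok r e I} \<le> prb (gnp m p) {e. y0 \<le> light_pairs m t r e I}"
    by (rule measure_pmf.finite_measure_mono) (force simp: light_ok_def not_le)+
  also have "\<dots> \<le> exp (m * (\<theta> * (card I)\<^sup>2 * p\<^sup>2 * exp 4) - \<theta> * y0)"
  proof (rule light_tail[OF p fI(1) A \<theta>(1) t0 \<theta>(2)])
    show "p * (\<theta> * t) * card I \<le> 1" using \<theta>(3) fI by simp
    show "card {i\<in>I. r i = y} \<le> M" if "y \<in> r ` I" for y using fibre_in_kset[OF f I] that A by blast
  qed
  finally show "prb (gnp m p) {e. \<not> light_ok r e I} \<le> exp (m * (\<theta> * (real k)\<^sup>2 * p\<^sup>2 * exp 4) - \<theta> * y0)"
    using fI by simp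
qed

text \<open>Codegrees and degrees concern \<open>e\<close> alone, fibres \<open>r\<close> alone.
  Neighbourhood sizes are bounded for fixed \<open>e\<close>, the statements about k-sets for fixed
  \<open>r\<close>. Each event includes the earlier property that its bound relies on, which is why
  \<open>deg_ok e\<close> and \<open>fibre_ok r\<close> occur inside.\<close>

lemma prob_not_good: "prb St {(r, e). \<not> good r e} \<le> 7/64"
proof -
  let ?V = "\<lambda>r. \<forall>i<n. r i < m"
  let ?B1 = "{(r, e). \<not> codeg_ok e}" and ?B2 = "{(r, e). \<not> deg_ok e}" and ?B3 = "{(r, e :: nat set \<Rightarrow> bool). \<not> fibre_ok r}"
  let ?B4 = "{(r, e). ?V r \<and> deg_ok e \<and> \<not> nbr_ok r e}" and ?B5 = "{(r, e). ?V r \<and> (\<exists>I\<in>ksets. \<not> packing_ok r e I)}"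
  let ?B6 = "{(r, e). ?V r \<and> (\<exists>I\<in>ksets. \<not> edge_ok r e I)}"
  let ?B7 = "{(r, e). ?V r \<and> fibre_ok r \<and> (\<exists>I\<in>ksets. \<not> light_ok r e I)}"
  let ?L = "[?B1, ?B2, ?B3, ?B4, ?B5, ?B6, ?B7]"
  have b1: "prb St ?B1 \<le> 1/64" by (rule prob_pair_le_fst[OF fin_R fin_G prob_codeg])
  have b2: "prb St ?B2 \<le> 1/64" by (rule prob_pair_le_fst[OF fin_R fin_G prob_deg])
  have b3: "prb St ?B3 \<le> 1/64" by (rule prob_pair_le_snd[OF fin_R fin_G prob_fibre])
  have b4: "prb St ?B4 \<le> 1/64"
  proof (rule prob_pair_le_snd[OF fin_R fin_G])
    fix e
    have "prb (rmap n m) {r. deg_ok e \<and> ?V r \<and> \<not> nbr_ok r e} \<le> 1/64"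
      by (rule prob_conj_const[OF prob_nbr]) simp_all
    then show "prb (rmap n m) {r. ?V r \<and> deg_ok e \<and> \<not> nbr_ok r e} \<le> 1/64"
      by (simp only: conj_left_commute)
  qed
  have b5: "prb St ?B5 \<le> 1/64"
    by (rule prob_pair_le_fst[OF fin_R fin_G prob_conj_const[OF prob_packing]]) simp_all
  have b6: "prb St ?B6 \<le> 1/64"
    by (rule prob_pair_le_fst[OF fin_R fin_G prob_conj_const[OF prob_edge]]) simp_all
  have b7: "prb St ?B7 \<le> 1/64"
    by (rule prob_pair_le_fst[OF fin_R fin_G prob_conj_const[OF prob_conj_const[OF prob_light]]]) simp_all
  have "prb St {(r, e). \<not> good r e} \<le> prb St (\<Union>i\<in>{..<7}. ?L ! i)"
  proof (rule prob_mono_support)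
    fix x assume x: "x \<in> set_pmf St" "x \<in> {(r, e). \<not> good r e}"
    obtain r e where re: "x = (r, e)" by (cases x)
    have V: "?V r" using x(1) rmap_support[OF _ _ m0] unfolding re by auto
    have loop: "\<not> e {z}" for z using x(1) gnp_support[of e m p "{z}"] edges_iff[of z z m] unfolding re by auto
    have "x \<in> ?B1 \<union> ?B2 \<union> ?B3 \<union> ?B4 \<union> ?B5 \<union> ?B6 \<union> ?B7"
      using x(2) V loop unfolding re good_def by auto
    then have "\<exists>i<7. x \<in> ?L ! i"
      by (elim UnE) (rule exI[of _ 0], simp, rule exI[of _ 1], simp, rule exI[of _ 2], simp,
       rule exI[of _ 3], simp, rule exI[of _ 4], simp, rule exI[of _ 5], simp, rule exI[of _ 6], simp)
    then show "x \<in> (\<Union>i\<in>{..<7}. ?L ! i)" by blast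
  qed
  also have "\<dots> \<le> card {..<7::nat} * (1/64)"
  proof (rule prob_UN_le)
    fix i :: nat assume "i \<in> {..<7}"
    then have "i \<in> {0,1,2,3,4,5,6}" by auto
    then show "prb St (?L ! i) \<le> 1/64" using b1 b2 b3 b4 b5 b6 b7 by (elim insertE emptyE) simp_all
  qed simp
  finally show ?thesis by simp
qed

text \<open>The sets \<open>X I\<close> are arbitrary but fixed. They will be the exceptional pairs
  of the other colour, which is independent of this one, and so conditioning on that colour is
  legitimate. For a map injective on \<open>J\<close> distinct pairs give distinct base edges, and
  the \<open>2 ^ k\<close> choices of \<open>J\<close> are affordable.\<close>

lemma prob_exceptional:
  "prb St {(r, e). \<exists>I\<in>ksets. \<exists>J\<subseteq>I. finite (X I) \<and> card (X I) \<le> x0 \<and> inj_on r J \<and> r ` J \<subseteq> {..<m} \<and>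
     \<tau>1 < card {d\<in>pair_edges (X I) J. e (r ` d)}} \<le> 1/64"
proof (rule prob_pair_le_fst[OF fin_R fin_G])
  fix r :: "nat \<Rightarrow> nat"
  let ?Q = "\<lambda>I J e. finite (X I) \<and> card (X I) \<le> x0 \<and> inj_on r J \<and> r ` J \<subseteq> {..<m} \<and>
     \<tau>1 < card {d\<in>pair_edges (X I) J. e (r ` d)}"
  let ?c = "exp (p * x0 * (exp \<mu> - 1) - \<mu> * \<tau>1)"
  have one: "prb (gnp m p) {e. ?Q I J e} \<le> ?c" for I J
  proof (cases "finite (X I) \<and> card (X I) \<le> x0 \<and> inj_on r J \<and> r ` J \<subseteq> {..<m}")
    case True
    let ?D = "pair_edges (X I) J"
    have DJ: "?D \<subseteq> edges_in J" unfolding pair_edges_def by blast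
    have "inj_on r J" "r ` J \<subseteq> {..<m}" using True by blast+
    note im = image_edges[OF this(1) DJ]
    have inj: "inj_on ((`) r) ?D" and Q: "(`) r ` ?D \<subseteq> edges m" using im(1,2) \<open>r ` J \<subseteq> {..<m}\<close> by blast+
    have cd: "card {d\<in>(`) r ` ?D. e d} = card {d\<in>?D. e (r ` d)}" for e by (rule im(3))
    have "prb (gnp m p) {e. ?Q I J e} \<le> exp (p * card ((`) r ` ?D) * (exp \<mu> - 1) - \<mu> * \<tau>1)"
      by (rule gnp_tail[OF p Q]) (use \<mu>0 in \<open>auto simp: cd intro!: mult_left_mono\<close>)
    also have "card ((`) r ` ?D) = card ?D" by (rule card_image[OF inj])
    also have "exp (p * card ?D * (exp \<mu> - 1) - \<mu> * \<tau>1) \<le> ?c"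
    proof -
      have "card ?D \<le> x0" using card_pair_edges_le[of "X I" J] True by linarith
      then show ?thesis using p \<mu>0 by (auto intro!: mult_right_mono mult_left_mono)
    qed
    finally show ?thesis .
  next
    case False
    then have "{e. ?Q I J e} = {}" by blast
    then show ?thesis by (simp only: measure_empty) simp
  qed
  show "prb (gnp m p) {e. \<exists>I\<in>ksets. \<exists>J\<subseteq>I. ?Q I J e} \<le> 1/64"
  proof (rule prob_ksets_le[OF _ exc_num])
    fix I assume I: "I \<in> ksets"
    have "{e. \<exists>J\<subseteq>I. ?Q I J e} = (\<Union>J\<in>Pow I. {e. ?Q I J e})" by blast
    also have "prb (gnp m p) \<dots> \<le> card (Pow I) * ?c" by (rule prob_UN_le[OF _ one]) (use ksetD[OF I] in simp)
    also have "\<dots> = 2 ^ k * ?c" using ksetD[OF I] by (simp add: card_Pow)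
    finally show "prb (gnp m p) {e. \<exists>J\<subseteq>I. ?Q I J e} \<le> 2 ^ k * ?c" .
  qed
qed

end

lemma sum_squares_pieces:
  fixes K :: real and q :: nat
  assumes fJ: "finite J" and K: "\<And>c. c < q \<Longrightarrow> card {i\<in>J. b i = c} \<le> K"
  shows "(\<Sum>c<q. (real (card {i\<in>J. b i = c}))\<^sup>2) \<le> (real (card {i\<in>J. b i < q}))\<^sup>2"
    "(\<Sum>c<q. (real (card {i\<in>J. b i = c}))\<^sup>2) \<le> K * real (card {i\<in>J. b i < q})"
proof -
  let ?s = "\<lambda>c. real (card {i\<in>J. b i = c})"
  have "card (\<Union>c\<in>{..<q}. {i\<in>J. b i = c}) = (\<Sum>c<q. card {i\<in>J. b i = c})"
    by (rule card_UN_disjoint) (use fJ in auto)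
  moreover have "(\<Union>c\<in>{..<q}. {i\<in>J. b i = c}) = {i\<in>J. b i < q}" by auto
  ultimately have tot: "real (card {i\<in>J. b i < q}) = (\<Sum>c<q. ?s c)" by simp
  have gen: "(\<Sum>c<q. (?s c)\<^sup>2) \<le> X * (\<Sum>c<q. ?s c)" if "\<And>c. c < q \<Longrightarrow> ?s c \<le> X" for X
    unfolding sum_distrib_left power2_eq_square using that by (intro sum_mono mult_right_mono) auto
  show "(\<Sum>c<q. (?s c)\<^sup>2) \<le> K * real (card {i\<in>J. b i < q})" unfolding tot by (rule gen[OF K])
  have "?s c \<le> (\<Sum>c<q. ?s c)" if "c < q" for c by (rule member_le_sum) (use that in auto)
  from gen[OF this] show "(\<Sum>c<q. (?s c)\<^sup>2) \<le> (real (card {i\<in>J. b i < q}))\<^sup>2"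
    unfolding tot power2_eq_square .
qed

context two_bites
begin

lemma good_heavy:
  assumes "good r e" "I \<in> ksets"
  shows "card (heavy m t r e I) \<le> q"
proof -
  note I = ksetD[OF assms(2)]
  have "card (heavy m t r e I) < q"
  proof (rule card_heavy_less[where n = n and M = M and h = h])
    show "I \<subseteq> {..<n}" using I by blast
    show "r i < m" if "i \<in> I" for i using that I assms(1) unfolding good_def by blast
    show "card {y. y < m \<and> e {x, y} \<and> e {x', y}} \<le> h" if "x < m" "x' < m" "x \<noteq> x'" for x x'
      using assms(1) that unfolding good_def codeg_ok_def by blast
    show "card {i. i < n \<and> r i = x} \<le> M" if "x < m" for x
      using assms(1) that unfolding good_def fibre_ok_def by blast
  qed (use M0 heavy_num I in auto)
  then show ?thesis by simp
qed

lemma good_exceptional: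
  assumes "good r e" "I \<in> ksets"
  shows "card (exceptional m t r e I) \<le> x0"
proof -
  note I = ksetD[OF assms(2)]
  have "real (card (exceptional m t r e I)) \<le> card I * M + (y0 + t * (2 * M * E0)) + 2 * real (card I) * ((real q)\<^sup>2 * (h * M))"
  proof (rule card_exceptional_le[where n = n])
    show "I \<subseteq> {..<n}" using I by blast
    show "r i < m" if "i \<in> I" for i using that I assms(1) unfolding good_def by blast
    show "\<not> e {z}" for z using assms(1) unfolding good_def by blast
    show "card {y. y < m \<and> e {x, y} \<and> e {x', y}} \<le> h" if "x < m" "x' < m" "x \<noteq> x'" for x x'
      using assms(1) that unfolding good_def codeg_ok_def by blast
    show "card {i. i < n \<and> r i = x} \<le> M" if "x < m" for x
      using assms(1) that unfolding good_def fibre_ok_def by blast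
    show "card (heavy m t r e I) \<le> q" by (rule good_heavy[OF assms])
    show "card {d\<in>edges_in (r ` I). e d} \<le> E0" using assms unfolding good_def edge_ok_def by blast
    show "light_pairs m t r e I \<le> y0"
      using assms unfolding good_def light_ok_def by blast
  qed (use M0 t0 in auto)
  then show ?thesis using x0 I by simp
qed

lemma finite_exceptional:
  assumes "I \<in> ksets" shows "finite (exceptional m t r e I)"
proof -
  have "exceptional m t r e I \<subseteq> I \<times> I"
    unfolding exceptional_def closed_pairs_def nbrs_def multi_def by blast
  then show ?thesis using ksetD[OF assms] finite_subset by blast
qed

section \<open>The probability of one fixed pair of records\<close>

definition balanced where "balanced I a \<longleftrightarrow> (\<forall>c<q. card {i\<in>I. a i = c} \<le> 9/20 * k)"
definition covered where "covered I a = {i\<in>I. a i < q}"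
text \<open>Although \<open>b\<close> describes the pieces of the other colour, with
  \<open>\<zeta>\<close>, \<open>a\<close>, \<open>b\<close>, \<open>J\<close> fixed this is an
  event about one map and one graph only. The independence of the two colours rests on that.\<close>

definition sparse_event where "sparse_event I \<zeta> a b J = {(r, e). deg_ok e \<and> (\<forall>i\<in>covered I a. e {\<zeta> (a i), r i}) \<and>
   r ` (I - covered I a) \<subseteq> r ` J \<and> inj_on r J \<and> card {d\<in>separated q b J. e (r ` d)} \<le> \<tau>}"

text \<open>Every point of \<open>I\<close> outside \<open>J\<close>, whether covered or not, costs
  a factor at most \<open>\<Lambda> / k\<close>, and there are \<open>k - card J\<close> of
  them.\<close>

lemma prob_sparse_event:
  assumes I: "I \<in> ksets" and \<zeta>: "\<zeta> \<in> {..<q} \<rightarrow>\<^sub>E {..<m}" and J: "J \<subseteq> I - covered I a"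
  shows "prb St (sparse_event I \<zeta> a b J) \<le> exp (k * ln \<Lambda> - (k - real (card J)) * ln k + 3 * \<tau> - (1 - exp (- 3)) * p * card (separated q b J))"
proof -
  let ?U = "covered I a"
  have I': "I \<subseteq> {..<n}" "card I = k" "finite I" using ksetD[OF I] by auto
  have UI: "?U \<subseteq> I" unfolding covered_def by blast
  have fU: "finite ?U" and fJ: "finite J" using UI J I'(3) finite_subset by blast+
  have ux: "card ?U + card J \<le> k"
  proof -
    have "card ?U + card J = card (?U \<union> J)" using fU fJ J by (intro card_Un_disjoint[symmetric]) auto
    also have "\<dots> \<le> card I" using UI J I'(3) by (intro card_mono) auto
    finally show ?thesis using I' by simp
  qed
  have "prb St (sparse_event I \<zeta> a b J) \<le>
     (\<Delta> / m) ^ card ?U * (card J / m) ^ (card I - card ?U - card J) * exp (3 * \<tau> - (1 - exp (- 3)) * p * card (separated q b J))"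
    unfolding sparse_event_def deg_ok_def
  proof (rule piece_tail[OF p m0 \<Delta>0 I'(1) UI J])
    show "separated q b J \<subseteq> edges_in J" unfolding separated_def by blast
    show "\<zeta> (a i) < m" if "i \<in> ?U" for i using \<zeta> that unfolding covered_def by auto
  qed
  also have "\<dots> \<le> exp (k * ln \<Lambda> - (k - real (card J)) * ln k) * exp (3 * \<tau> - (1 - exp (- 3)) * p * card (separated q b J))"
  proof (rule mult_right_mono)
    have L0: "0 \<le> \<Lambda> / k" using \<Lambda> by simp
    have "(\<Delta> / m) ^ card ?U * (card J / m) ^ (card I - card ?U - card J) \<le> (\<Lambda> / k) ^ card ?U * (\<Lambda> / k) ^ (card I - card ?U - card J)"
    proof (intro mult_mono power_mono)
      have "card J / m \<le> k / m" using ux m0 by (intro divide_right_mono) auto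
      then show "card J / m \<le> \<Lambda> / k" using \<Lambda>(3) by linarith
    qed (use \<Delta>0 \<Lambda> L0 in auto)
    also have "\<dots> = (\<Lambda> / k) ^ (k - card J)"
      using ux I'(2) by (simp flip: power_add)
    also have "\<dots> = exp (ln (\<Lambda> / k) * real (k - card J))"
      using \<Lambda>(1) k0 by (simp add: exp_of_nat2_mult)
    also have "\<dots> = exp ((k - real (card J)) * (ln \<Lambda> - ln k))"
      using \<Lambda>(1) k0 ux by (simp add: ln_div of_nat_diff mult.commute)
    also have "\<dots> \<le> exp (k * ln \<Lambda> - (k - real (card J)) * ln k)"
    proof -
      have "(k - real (card J)) * ln \<Lambda> \<le> k * ln \<Lambda>" using \<Lambda>(1) by (intro mult_right_mono) auto
      then show ?thesis by (simp add: right_diff_distrib)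
    qed
    finally show "(\<Delta> / m) ^ card ?U * (card J / m) ^ (card I - card ?U - card J) \<le> exp (k * ln \<Lambda> - (k - real (card J)) * ln k)" .
  qed simp
  also have "\<dots> = exp (k * ln \<Lambda> - (k - real (card J)) * ln k + 3 * \<tau> - (1 - exp (- 3)) * p * card (separated q b J))"
    by (simp flip: exp_add)
  finally show ?thesis .
qed

text \<open>The assignments are crossed: the edges of \<open>J\<close> are counted between pieces of
  \<open>b\<close>, those of \<open>J'\<close> between pieces of \<open>a\<close>. The product of
  the two bounds is governed by \<open>density_beats_entropy\<close>, and the surplus
  \<open>1/1000\<close> there becomes the excess over \<open>k ln k\<close>, the exponent of the
  number of k-sets.\<close>

lemma prob_sparse_pair:
  assumes I: "I \<in> ksets" and \<zeta>: "\<zeta> \<in> {..<q} \<rightarrow>\<^sub>E {..<m}" "\<zeta>' \<in> {..<q} \<rightarrow>\<^sub>E {..<m}"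
    and J: "J \<subseteq> I - covered I a" "J' \<subseteq> I - covered I b" and bal: "balanced I a" "balanced I b"
  shows "prb (pair_pmf St St) (sparse_event I \<zeta> a b J \<times> sparse_event I \<zeta>' b a J')
     \<le> exp (2 * k * ln \<Lambda> + 6 * \<tau> - 1001/1000 * (k * ln k) + 57/50 * ln k)"
proof -
  have I': "card I = k" "finite I" using ksetD[OF I] by auto
  define x y u v where xy: "x = real (card J)" "y = real (card J')" "u = real (card (covered I a))" "v = real (card (covered I b))"
  have cov: "card J + card (covered I a) \<le> k" if "J \<subseteq> I - covered I a" for J a
  proof -
    have UI: "covered I a \<subseteq> I" unfolding covered_def by blast
    have fin: "finite J" "finite (covered I a)" using that UI I'(2) finite_subset by blast+
    have "card J + card (covered I a) = card (J \<union> covered I a)" using fin that by (intro card_Un_disjoint[symmetric]) auto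
    also have "\<dots> \<le> card I" using UI that I'(2) by (intro card_mono) auto
    finally show ?thesis using I' by simp
  qed
  have xu: "x \<le> k - u" "y \<le> k - v" using cov[OF J(1)] cov[OF J(2)] unfolding xy by linarith+
  have nn: "0 \<le> x" "0 \<le> y" "0 \<le> u" "0 \<le> v" unfolding xy by simp_all
  define sq where "sq b J = (\<Sum>c<q. (real (card {i\<in>J. b i = c}))\<^sup>2)" for b and J :: "nat set"
  have sq: "sq b J \<le> (real (card (covered I b)))\<^sup>2" "sq b J \<le> (real (card J))\<^sup>2" "sq b J \<le> 9/20 * k * card J"
    if "J \<subseteq> I" "balanced I b" for b J
  proof -
    have fJ: "finite J" using that I' finite_subset by blast
    have K: "card {i\<in>J. b i = c} \<le> 9/20 * real k" if "c < q" for c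
    proof -
      have "card {i\<in>J. b i = c} \<le> card {i\<in>I. b i = c}" using \<open>J \<subseteq> I\<close> I' by (intro card_mono) auto
      moreover have "card {i\<in>I. b i = c} \<le> 9/20 * real k" using \<open>balanced I b\<close> that unfolding balanced_def by blast
      ultimately show ?thesis by linarith
    qed
    have c1: "card {i\<in>J. b i < q} \<le> card J" using fJ by (intro card_mono) auto
    have c2: "card {i\<in>J. b i < q} \<le> card (covered I b)"
      unfolding covered_def using that I' by (intro card_mono) auto
    have s: "sq b J \<le> (real (card {i\<in>J. b i < q}))\<^sup>2" "sq b J \<le> 9/20 * real k * real (card {i\<in>J. b i < q})"
      unfolding sq_def by (rule sum_squares_pieces[OF fJ K], assumption)+
    have "(real (card {i\<in>J. b i < q}))\<^sup>2 \<le> (real (card (covered I b)))\<^sup>2" using c2 by (intro power_mono) auto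
    then show "sq b J \<le> (real (card (covered I b)))\<^sup>2" using s(1) by linarith
    have "(real (card {i\<in>J. b i < q}))\<^sup>2 \<le> (real (card J))\<^sup>2" using c1 by (intro power_mono) auto
    then show "sq b J \<le> (real (card J))\<^sup>2" using s(1) by linarith
    have "9/20 * k * real (card {i\<in>J. b i < q}) \<le> 9/20 * k * real (card J)" using c1 by (intro mult_left_mono) auto
    then show "sq b J \<le> 9/20 * k * card J" using s(2) by linarith
  qed
  have JI: "J \<subseteq> I" "J' \<subseteq> I" using J by blast+
  have fJ: "finite J" "finite J'" using JI I' finite_subset by blast+
  define W where "W = x\<^sup>2 + y\<^sup>2 - sq b J - sq a J'"
  have dens: "k * (x + y - k) + 1/1000 * (real k)\<^sup>2 \<le> 11/20 * W"
    unfolding W_def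
    by (rule density_beats_entropy[OF _ nn xu]) (use sq[OF JI(1) bal(2)] sq[OF JI(2) bal(1)] k0 in \<open>auto simp: xy\<close>)
  have W0: "0 \<le> W" unfolding W_def xy using sq(2)[OF JI(1) bal(2)] sq(2)[OF JI(2) bal(1)] by linarith
  define T where "T = real (card (separated q b J)) + real (card (separated q a J'))"
  have T: "(W - (x + y)) / 2 \<le> T"
    using card_separated_ge[OF fJ(1), where q = q and a = b] card_separated_ge[OF fJ(2), where q = q and a = a]
    unfolding T_def W_def xy sq_def by argo
  have T0: "0 \<le> T" unfolding T_def by simp
  have kl: "0 \<le> ln k / k" using lnk by simp
  have "ln k / k * (k * (x + y - k) + 1/1000 * (real k)\<^sup>2) - 57/50 * ln k \<le> (1 - exp (- 3)) * p * T"
  proof -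
    \<comment> \<open>Half of the effective density \<open>57/50\<close> exceeds the
      \<open>11/20\<close> of the extremal inequality, and \<open>W\<close> is nonnegative.\<close>
    have "ln k / k * (k * (x + y - k) + 1/1000 * (real k)\<^sup>2) \<le> ln k / k * (57/100 * W)"
      using dens W0 kl by (intro mult_left_mono) auto
    \<comment> \<open>The diagonal terms lost in counting unordered pairs amount to
      \<open>x + y \<le> 2 k\<close>, hence only to a multiple of \<open>ln k\<close>.\<close>
    moreover have "ln k / k * (57/100 * (x + y)) \<le> ln k / k * (57/50 * k)"
      using xu nn kl by (intro mult_left_mono) auto
    moreover have "ln k / k * (57/50 * k) = 57/50 * ln k" using k0 by simp
    ultimately have "ln k / k * (k * (x + y - k) + 1/1000 * (real k)\<^sup>2) - 57/50 * ln k \<le> ln k / k * (57/100 * W) - ln k / k * (57/100 * (x + y))"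
      by linarith
    also have "\<dots> = 57/50 * (ln k / k) * ((W - (x + y)) / 2)"
    proof -
      have "c * (57/100 * W) - c * (57/100 * s) = 57/50 * c * ((W - s) / 2)" for c s :: real
        by (simp add: algebra_simps)
      then show ?thesis .
    qed
    also have "\<dots> \<le> 57/50 * (ln k / k) * T" using T kl by (intro mult_left_mono) auto
    also have "\<dots> \<le> (1 - exp (- 3)) * p * T" using density T0 by (intro mult_right_mono) auto
    finally show ?thesis .
  qed
  moreover have "ln k / k * (k * (x + y - k) + 1/1000 * (real k)\<^sup>2) = (x + y - k) * ln k + 1/1000 * (k * ln k)"
    using k0 by (simp add: field_simps power2_eq_square)
  ultimately have main: "(x + y - k) * ln k + 1/1000 * (k * ln k) - 57/50 * ln k \<le> (1 - exp (- 3)) * p * T" by linarith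
  have "prb (pair_pmf St St) (sparse_event I \<zeta> a b J \<times> sparse_event I \<zeta>' b a J')
     = prb St (sparse_event I \<zeta> a b J) * prb St (sparse_event I \<zeta>' b a J')"
    by (rule prob_pair_times[OF fin_St fin_St])
  also have "\<dots> \<le> exp (k * ln \<Lambda> - (k - x) * ln k + 3 * \<tau> - (1 - exp (- 3)) * p * card (separated q b J))
     * exp (k * ln \<Lambda> - (k - y) * ln k + 3 * \<tau> - (1 - exp (- 3)) * p * card (separated q a J'))"
    unfolding xy by (intro mult_mono prob_sparse_event[OF I \<zeta>(1) J(1)] prob_sparse_event[OF I \<zeta>(2) J(2)]) simp_all
  also have "\<dots> = exp (2 * k * ln \<Lambda> + 6 * \<tau> + (x + y - 2 * k) * ln k - (1 - exp (- 3)) * p * T)"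
    unfolding T_def exp_add[symmetric] by (rule arg_cong[where f = exp]) (simp add: algebra_simps)
  also have "\<dots> \<le> exp (2 * k * ln \<Lambda> + 6 * \<tau> - 1001/1000 * (k * ln k) + 57/50 * ln k)"
  proof -
    have "(x + y - 2 * k) * ln k = (x + y - k) * ln k - k * ln k" by (simp add: algebra_simps)
    then show ?thesis using main by simp
  qed
  finally show ?thesis .
qed

definition params where "params I = ({..<q} \<rightarrow>\<^sub>E {..<m}) \<times> (I \<rightarrow>\<^sub>E {..q}) \<times> Pow I"

text \<open>Data violating the side conditions are given the empty event, so the union bound can run
  over the whole product \<open>params I\<close> with an explicit cardinality.\<close>

definition blocked where "blocked I z z' = (case (z, z') of ((\<zeta>, a, J), (\<zeta>', b, J')) \<Rightarrow>
   if J \<subseteq> I - covered I a \<and> J' \<subseteq> I - covered I b \<and> balanced I a \<and> balanced I b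
   then sparse_event I \<zeta> a b J \<times> sparse_event I \<zeta>' b a J' else {})"

lemma prob_blocked:
  assumes "I \<in> ksets" "z \<in> params I" "z' \<in> params I"
  shows "prb (pair_pmf St St) (blocked I z z') \<le> exp (2 * k * ln \<Lambda> + 6 * \<tau> - 1001/1000 * (k * ln k) + 57/50 * ln k)"
proof -
  obtain \<zeta> a J \<zeta>' b J' where z: "z = (\<zeta>, a, J)" "z' = (\<zeta>', b, J')" by (metis surj_pair)
  have \<zeta>: "\<zeta> \<in> {..<q} \<rightarrow>\<^sub>E {..<m}" "\<zeta>' \<in> {..<q} \<rightarrow>\<^sub>E {..<m}" using assms(2,3) unfolding z params_def by simp_all
  show ?thesis
  proof (cases "J \<subseteq> I - covered I a \<and> J' \<subseteq> I - covered I b \<and> balanced I a \<and> balanced I b")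
    case True
    then have "blocked I z z' = sparse_event I \<zeta> a b J \<times> sparse_event I \<zeta>' b a J'"
      unfolding blocked_def z prod.case by (rule if_P)
    then show ?thesis using prob_sparse_pair[OF assms(1) \<zeta>, of J a J' b] True by simp
  next
    case False
    then have "blocked I z z' = {}" unfolding blocked_def z prod.case by (rule if_not_P)
    then show ?thesis by (simp only: measure_empty) simp
  qed
qed

lemma prob_main:
  "prb (pair_pmf St St) {w. \<exists>I\<in>ksets. \<exists>z\<in>params I. \<exists>z'\<in>params I. w \<in> blocked I z z'} \<le> 1/64"
proof (rule prob_ksets_le[OF _ main_num])
  fix I assume I: "I \<in> ksets"
  have I': "card I = k" "finite I" using ksetD[OF I] by auto
  let ?b = "exp (2 * k * ln \<Lambda> + 6 * \<tau> - 1001/1000 * (k * ln k) + 57/50 * ln k)"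
  have fP: "finite (params I)" unfolding params_def using I' by (intro finite_cartesian_product finite_PiE) auto
  have cP: "card (params I) = m ^ q * ((q + 1) ^ k * 2 ^ k)"
    unfolding params_def using I' by (simp add: card_cartesian_product card_PiE card_Pow)
  have "{w. \<exists>z\<in>params I. \<exists>z'\<in>params I. w \<in> blocked I z z'} = (\<Union>zz\<in>params I \<times> params I. blocked I (fst zz) (snd zz))"
    by force
  also have "prb (pair_pmf St St) \<dots> \<le> card (params I \<times> params I) * ?b"
  proof (rule prob_UN_le)
    show "finite (params I \<times> params I)" using fP by simp
    show "prb (pair_pmf St St) (blocked I (fst zz) (snd zz)) \<le> ?b" if "zz \<in> params I \<times> params I" for zz
      by (rule prob_blocked[OF I]) (use that in auto)
  qed
  also have "card (params I \<times> params I) * ?b = ((real m ^ q) * real (q + 1) ^ k * 2 ^ k)\<^sup>2 * ?b"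
    by (simp add: card_cartesian_product cP power2_eq_square mult_ac)
  finally show "prb (pair_pmf St St) {w. \<exists>z\<in>params I. \<exists>z'\<in>params I. w \<in> blocked I z z'}
     \<le> ((real m ^ q) * real (q + 1) ^ k * 2 ^ k)\<^sup>2 * ?b" .
qed

end

subsection \<open>The graph\<close>

text \<open>A coloured edge is kept unless its ends have a common neighbour in the other colour, so in a triangle
  with two colours the edge of the odd colour is removed.\<close>

definition coloured where "coloured m r e i j \<longleftrightarrow> thin m e {r i, r j :: nat}"

definition bite where "bite n m r e s g i j \<longleftrightarrow>
  coloured m r e i j \<and> \<not> (\<exists>v<n. coloured m s g v i \<and> coloured m s g v j)"

definition two_bite_graph where "two_bite_graph n m r e s g i j \<longleftrightarrow> bite n m r e s g i j \<or> bite n m s g r e i j"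

lemma bite_commute: "bite n m r e s g i j = bite n m r e s g j i"
  unfolding bite_def coloured_def by (auto simp: insert_commute)

lemma bite_irrefl: "(\<And>z. \<not> e {z}) \<Longrightarrow> \<not> bite n m r e s g i i"
  unfolding bite_def coloured_def thin_def by simp

lemma simple_two_bite_graph:
  assumes "\<And>z. \<not> e {z}" "\<And>z. \<not> g {z}"
  shows "simple_graph V (two_bite_graph n m r e s g)"
  unfolding simple_graph_def two_bite_graph_def
  using bite_commute bite_irrefl[of e] bite_irrefl[of g] assms by blast

lemma bite_coloured: "bite n m r e s g i j \<Longrightarrow> thin m e {r i, r j}"
  unfolding bite_def coloured_def by (rule conjunct1)

lemma thin_distinct:
  assumes "thin m e {x, y}" "\<And>z. \<not> e {z}" shows "x \<noteq> y"
proof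
  assume "x = y"
  then have "e {x}" using assms(1) unfolding thin_def by simp
  then show False using assms(2) by blast
qed

lemma bite_triangle:
  assumes loop: "\<And>z. \<not> e {z}" and r: "\<And>i. i < n \<Longrightarrow> r i < m" and i: "i < n" "j < n" "l < n"
    and b: "bite n m r e s g i j" "bite n m r e s g j l" "bite n m r e s g i l"
  shows False
proof -
  note t = bite_coloured[OF b(1)] bite_coloured[OF b(2)] bite_coloured[OF b(3)]
  show False
    by (rule thin_triangle_free[OF r[OF i(1)] r[OF i(2)] r[OF i(3)] _ _ _ t])
       (rule thin_distinct[OF t(1) loop], rule thin_distinct[OF t(2) loop], rule thin_distinct[OF t(3) loop])
qed

lemma bite_mixed:
  assumes "v < n" "bite n m r e s g v i" "bite n m r e s g v j" shows "\<not> bite n m s g r e i j"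
  using assms unfolding bite_def by blast

lemma triangle_free_two_bite_graph:
  assumes loop: "\<And>z. \<not> e {z}" "\<And>z. \<not> g {z}" and r: "\<And>i. i < n \<Longrightarrow> r i < m" "\<And>i. i < n \<Longrightarrow> s i < m"
  shows "\<not> has_triangle {..<n} (two_bite_graph n m r e s g)"
proof
  assume "has_triangle {..<n} (two_bite_graph n m r e s g)"
  then obtain i j l where i: "i < n" "j < n" "l < n"
    and E: "two_bite_graph n m r e s g i j" "two_bite_graph n m r e s g j l" "two_bite_graph n m r e s g i l"
    unfolding has_triangle_def by auto
  let ?R = "bite n m r e s g" and ?B = "bite n m s g r e"
  have sym: "?R x y = ?R y x" "?B x y = ?B y x" for x y by (rule bite_commute)+
  have RRR: "\<not> (?R i j \<and> ?R j l \<and> ?R i l)"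
    using bite_triangle[where e = e and r = r, OF loop(1) r(1) i] by (intro notI) (elim conjE)
  have BBB: "\<not> (?B i j \<and> ?B j l \<and> ?B i l)"
    using bite_triangle[where e = g and r = s, OF loop(2) r(2) i] by (intro notI) (elim conjE)
  have mixR: "?R v x \<longrightarrow> ?R v y \<longrightarrow> \<not> ?B x y" if "v < n" for v x y by (intro impI) (rule bite_mixed[OF that])
  have mixB: "?B v x \<longrightarrow> ?B v y \<longrightarrow> \<not> ?R x y" if "v < n" for v x y by (intro impI) (rule bite_mixed[OF that])
  show False
    using E[unfolded two_bite_graph_def] RRR BBB mixR[OF i(1), of j l] mixR[OF i(2), of i l] mixR[OF i(3), of i j]
      mixB[OF i(1), of j l] mixB[OF i(2), of i l] mixB[OF i(3), of i j] sym[of i j] sym[of j l] sym[of i l]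
    by argo
qed

context two_bites
begin

text \<open>This is where independence of \<open>I\<close>, in the form of \<open>closed\<close>,
  becomes a rare event: separated edges over \<open>J\<close> are either removed by the packing, at
  most \<open>3 * F\<close> of them, or exceptional, at most \<open>\<tau>1\<close>.\<close>

lemma ex_sparse_event:
  assumes good: "good r e" and I: "I \<in> ksets" and b: "b \<in> I \<rightarrow>\<^sub>E {..q}" and a: "\<zeta> \<in> {..<q} \<rightarrow>\<^sub>E {..<m}" "a \<in> I \<rightarrow>\<^sub>E {..q}"
    and piece: "\<forall>i\<in>I. a i < q \<longrightarrow> e {\<zeta> (a i), r i}"
    and closed: "\<And>i j. i \<in> I \<Longrightarrow> j \<in> I \<Longrightarrow> coloured m r e i j \<Longrightarrow> (b i = b j \<and> b i < q) \<or> (i, j) \<in> X"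
    and exc: "\<And>J. J \<subseteq> I \<Longrightarrow> inj_on r J \<Longrightarrow> card {d\<in>pair_edges X J. e (r ` d)} \<le> \<tau>1"
  shows "\<exists>J\<subseteq>I - covered I a. balanced I a \<and> (r, e) \<in> sparse_event I \<zeta> a b J"
proof -
  have I': "I \<subseteq> {..<n}" "card I = k" "finite I" using ksetD[OF I] by auto
  have g: "\<And>i. i < n \<Longrightarrow> r i < m" "deg_ok e" "nbr_ok r e" "packing_ok r e I"
    using good I unfolding good_def by blast+
  \<comment> \<open>One point is chosen from each fibre over the uncovered part, so base edges over
    \<open>J\<close> correspond to pairs of \<open>J\<close>.\<close>
  obtain J where J: "J \<subseteq> I - covered I a" "inj_on r J" "r ` (I - covered I a) = r ` J"
    using subset_image_inj[of "r ` (I - covered I a)" r "I - covered I a"] by auto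
  have JI: "J \<subseteq> I" using J(1) by blast
  have fJ: "finite J" using JI I'(3) finite_subset by blast
  have "balanced I a"
    unfolding balanced_def
  proof (intro allI impI)
    fix c assume c: "c < q"
    have "card {i\<in>I. a i = c} \<le> card {i. i < n \<and> e {\<zeta> c, r i}}"
      using piece c I'(1) by (intro card_mono) auto
    moreover have "\<zeta> c < m" using a(1) c by auto
    then have "card {i. i < n \<and> e {\<zeta> c, r i}} \<le> 9/20 * k" using g(3) unfolding nbr_ok_def by blast
    ultimately show "card {i\<in>I. a i = c} \<le> 9/20 * k" by linarith
  qed
  moreover have "card {d\<in>separated q b J. e (r ` d)} \<le> \<tau>"
  proof -
    have "card {d\<in>separated q b J. e (r ` d)} \<le>
      card {d\<in>edges_in (r ` J). e d \<and> \<not> thin m e d} + card {d\<in>pair_edges X J. e (r ` d)}"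
    proof (rule card_coloured_separated_le[OF fJ JI J(2)])
      fix i j assume "i \<in> J" "j \<in> J" "thin m e {r i, r j}"
      then show "(b i = b j \<and> b i < q) \<or> (i, j) \<in> X" using closed JI unfolding coloured_def by blast
    qed
    moreover have "card {d\<in>edges_in (r ` J). e d \<and> \<not> thin m e d} \<le> card {d\<in>edges_in (r ` I). e d \<and> \<not> thin m e d}"
    proof (rule card_mono)
      show "finite {d\<in>edges_in (r ` I). e d \<and> \<not> thin m e d}" using finite_edges_in[of "r ` I"] I'(3) by simp
      have "edges_in (r ` J) \<subseteq> edges_in (r ` I)" by (rule edges_in_mono) (use JI in blast)
      then show "{d\<in>edges_in (r ` J). e d \<and> \<not> thin m e d} \<subseteq> {d\<in>edges_in (r ` I). e d \<and> \<not> thin m e d}" by blast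
    qed
    moreover have "card {d\<in>edges_in (r ` I). e d \<and> \<not> thin m e d} \<le> 3 * F"
    proof (rule card_removed_edges_packing)
      show "r ` I \<subseteq> {..<m}" using g(1) I'(1) by auto
      show "\<nexists>\<T>. triangle_packing m e \<T> \<and> (\<forall>T\<in>\<T>. 2 \<le> card (T \<inter> r ` I)) \<and> F \<le> card \<T>"
        using g(4) unfolding packing_ok_def .
    qed
    moreover have "card {d\<in>pair_edges X J. e (r ` d)} \<le> \<tau>1" by (rule exc[OF JI J(2)])
    ultimately show ?thesis using \<tau> by linarith
  qed
  moreover have "\<forall>i\<in>covered I a. e {\<zeta> (a i), r i}" using piece unfolding covered_def by blast
  ultimately show ?thesis using J g(2) unfolding sparse_event_def by (intro exI[of _ J] conjI) auto
qed

lemma prob_Un_le: "prb P A \<le> a \<Longrightarrow> prb P B \<le> b \<Longrightarrow> prb P (A \<union> B) \<le> a + b"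
  by (rule order_trans[OF measure_Un_le add_mono]) simp_all

definition typical where "typical r e s g \<longleftrightarrow> good r e \<and> good s g \<and>
  (\<forall>I\<in>ksets. \<forall>J\<subseteq>I. inj_on r J \<longrightarrow> card {d\<in>pair_edges (exceptional m t s g I) J. e (r ` d)} \<le> \<tau>1) \<and>
  (\<forall>I\<in>ksets. \<forall>J\<subseteq>I. inj_on s J \<longrightarrow> card {d\<in>pair_edges (exceptional m t r e I) J. g (s ` d)} \<le> \<tau>1) \<and>
  (\<forall>I\<in>ksets. \<forall>z\<in>params I. \<forall>z'\<in>params I. ((r, e), (s, g)) \<notin> blocked I z z')"

text \<open>The exceptional pairs of one colour are tested against the edges of the other. For this
  the first colour is held fixed, so that its exceptional sets become constants.\<close>

lemma ex_typical: "\<exists>r e s g. typical r e s g"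
proof -
  define D where "D X x \<longleftrightarrow> (\<exists>I\<in>ksets. \<exists>J\<subseteq>I. finite (X I) \<and> card (X I) \<le> x0 \<and> inj_on (fst x) J \<and> fst x ` J \<subseteq> {..<m} \<and>
     \<tau>1 < card {d\<in>pair_edges (X I) J. snd x (fst x ` d)})"
    for X :: "nat set \<Rightarrow> (nat \<times> nat) set" and x :: "(nat \<Rightarrow> nat) \<times> (nat set \<Rightarrow> bool)"
  define X where "X x = exceptional m t (fst x) (snd x)" for x
  define G where "G x \<longleftrightarrow> good (fst x) (snd x)" for x
  let ?PP = "pair_pmf St St"
  let ?A1 = "{(x, y :: (nat \<Rightarrow> nat) \<times> (nat set \<Rightarrow> bool)). \<not> G x}" and ?A2 = "{(x :: (nat \<Rightarrow> nat) \<times> (nat set \<Rightarrow> bool), y). \<not> G y}"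
  let ?A3 = "{(x, y). D (X y) x}" and ?A4 = "{(x, y). D (X x) y}"
  let ?A5 = "{w. \<exists>I\<in>ksets. \<exists>z\<in>params I. \<exists>z'\<in>params I. w \<in> blocked I z z'}"
  have ng: "prb St {x. \<not> G x} \<le> 7/64"
    using prob_not_good unfolding G_def case_prod_unfold .
  have ex: "prb St {x. D X x} \<le> 1/64" for X
    using prob_exceptional[of X] unfolding D_def case_prod_unfold .
  have a1: "prb ?PP ?A1 \<le> 7/64" by (rule prob_pair_le_snd[OF fin_St fin_St ng])
  have a2: "prb ?PP ?A2 \<le> 7/64" by (rule prob_pair_le_fst[OF fin_St fin_St ng])
  have a3: "prb ?PP ?A3 \<le> 1/64" by (rule prob_pair_le_snd[OF fin_St fin_St ex])
  have a4: "prb ?PP ?A4 \<le> 1/64" by (rule prob_pair_le_fst[OF fin_St fin_St ex])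
  note a5 = prob_main
  \<comment> \<open>Seven bad events for each colour and three joint ones, at \<open>1/64\<close>
    each, give \<open>17/64 < 1\<close>.\<close>
  have "prb ?PP (?A1 \<union> (?A2 \<union> (?A3 \<union> (?A4 \<union> ?A5)))) \<le> 7/64 + (7/64 + (1/64 + (1/64 + 1/64)))"
    by (rule prob_Un_le[OF a1 prob_Un_le[OF a2 prob_Un_le[OF a3 prob_Un_le[OF a4 a5]]]])
  then have "prb ?PP (?A1 \<union> (?A2 \<union> (?A3 \<union> (?A4 \<union> ?A5)))) \<noteq> 1" by linarith
  then have "?A1 \<union> (?A2 \<union> (?A3 \<union> (?A4 \<union> ?A5))) \<noteq> UNIV" using measure_pmf.prob_space[of ?PP] by force
  then obtain w where w: "w \<notin> ?A1 \<union> (?A2 \<union> (?A3 \<union> (?A4 \<union> ?A5)))" by blast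
  obtain r e s g where weq: "w = ((r, e), (s, g))" by (metis surj_pair)
  have n1: "w \<notin> ?A1" and n2: "w \<notin> ?A2" and n3: "w \<notin> ?A3" and n4: "w \<notin> ?A4" and n5: "w \<notin> ?A5" using w by blast+
  have gr: "good r e" using n1 unfolding weq G_def by simp
  have gs: "good s g" using n2 unfolding weq G_def by simp
  have im: "q ` J \<subseteq> {..<m}" if "good q f" "I \<in> ksets" "J \<subseteq> I" for q f I J
    using that ksetD[of I] unfolding good_def by (auto simp: image_subset_iff)
  have "typical r e s g"
    unfolding typical_def
  proof (intro conjI gr gs ballI allI impI)
    fix I J assume IJ: "I \<in> ksets" "J \<subseteq> I" "inj_on r J"
    show "card {d\<in>pair_edges (exceptional m t s g I) J. e (r ` d)} \<le> \<tau>1"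
    proof (rule ccontr)
      assume "\<not> ?thesis"
      then have "w \<in> ?A3" using IJ finite_exceptional[OF IJ(1)] good_exceptional[OF gs IJ(1)] im[OF gr IJ(1,2)]
        unfolding weq mem_Collect_eq case_prod_conv D_def X_def fst_conv snd_conv by (intro bexI[of _ I] exI[of _ J] conjI) simp_all
      then show False using n3 by blast
    qed
  next
    fix I J assume IJ: "I \<in> ksets" "J \<subseteq> I" "inj_on s J"
    show "card {d\<in>pair_edges (exceptional m t r e I) J. g (s ` d)} \<le> \<tau>1"
    proof (rule ccontr)
      assume "\<not> ?thesis"
      then have "w \<in> ?A4" using IJ finite_exceptional[OF IJ(1)] good_exceptional[OF gr IJ(1)] im[OF gs IJ(1,2)]
        unfolding weq mem_Collect_eq case_prod_conv D_def X_def fst_conv snd_conv by (intro bexI[of _ I] exI[of _ J] conjI) simp_all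
      then show False using n4 by blast
    qed
  next
    fix I z z' assume "I \<in> ksets" "z \<in> params I" "z' \<in> params I"
    then show "((r, e), (s, g)) \<notin> blocked I z z'" using n5 unfolding weq by blast
  qed
  then show ?thesis by blast
qed

end

lemma two_bite_graph_commute: "two_bite_graph n m r e s g i j = two_bite_graph n m s g r e i j"
  unfolding two_bite_graph_def by (rule disj_commute)

lemma two_bite_closed:
  assumes "\<not> two_bite_graph n m r e s g i j" "coloured m r e i j" "\<And>v. v < n \<Longrightarrow> s v < m"
  shows "\<exists>z<m. g {z, s i} \<and> g {z, s j}"
proof -
  have "\<exists>v<n. coloured m s g v i \<and> coloured m s g v j"
    using assms(1,2) unfolding two_bite_graph_def bite_def by argo
  then obtain v where v: "v < n" "coloured m s g v i" "coloured m s g v j" by (elim exE conjE)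
  show ?thesis
    by (rule exI[of _ "s v"]) (use v assms(3) in \<open>simp add: coloured_def thin_def\<close>)
qed

context two_bites begin
lemma good_loop: "good r e \<Longrightarrow> \<not> e {z}"
  unfolding good_def by simp

lemma good_vertex: "good r e \<Longrightarrow> i < n \<Longrightarrow> r i < m"
  unfolding good_def by simp

text \<open>In an independent k-set every surviving red pair has a common blue neighbour, and
  conversely. The piece assignment of each colour is thus fed into the sparse event of the other,
  which produces a member of \<open>blocked\<close> and contradicts typicality.\<close>

theorem ex_ramsey_graph:
  "\<exists>E :: nat \<Rightarrow> nat \<Rightarrow> bool. simple_graph {..<n} E \<and> \<not> has_triangle {..<n} E \<and> \<not> has_indep_set_of_size {..<n} E k"
proof -
  obtain r e s g where ty: "typical r e s g" using ex_typical by (elim exE)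
  have gr: "good r e" and gs: "good s g" using ty unfolding typical_def by simp_all
  let ?E = "two_bite_graph n m r e s g"
  have loop: "\<not> e {z}" "\<not> g {z}" for z by (rule good_loop[OF gr], rule good_loop[OF gs])
  have rm: "r i < m" "s i < m" if "i < n" for i by (rule good_vertex[OF gr that], rule good_vertex[OF gs that])
  have "\<not> has_indep_set_of_size {..<n} ?E k"
  proof
    assume "has_indep_set_of_size {..<n} ?E k"
    then obtain I where ind: "independent_set {..<n} ?E I" "card I = k" unfolding has_indep_set_of_size_def by blast
    then have I: "I \<in> ksets" unfolding independent_set_def ksets_def by simp
    have I': "I \<subseteq> {..<n}" "finite I" using ksetD[OF I] by auto
    have nE: "\<not> ?E i j" if "i \<in> I" "j \<in> I" for i j using ind(1) that unfolding independent_set_def by simp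
    have cr: "\<exists>z<m. g {z, s i} \<and> g {z, s j}" if "i \<in> I" "j \<in> I" "coloured m r e i j" for i j
      by (rule two_bite_closed[OF nE[OF that(1,2)] that(3) rm(2)])
    have cs: "\<exists>z<m. e {z, r i} \<and> e {z, r j}" if "i \<in> I" "j \<in> I" "coloured m s g i j" for i j
      by (rule two_bite_closed[OF nE[OF that(1,2), unfolded two_bite_graph_commute[of n m r]] that(3) rm(1)])
    obtain \<zeta> a where a: "\<zeta> \<in> {..<q} \<rightarrow>\<^sub>E {..<m}" "a \<in> I \<rightarrow>\<^sub>E {..q}" "\<forall>i\<in>I. a i < q \<longrightarrow> e {\<zeta> (a i), r i}"
      "\<forall>i\<in>I. \<forall>j\<in>I. (\<exists>z<m. e {z, r i} \<and> e {z, r j}) \<longrightarrow> (a i = a j \<and> a i < q) \<or> (i, j) \<in> exceptional m t r e I"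
      using ex_piece_assignment[OF m0 good_heavy[OF gr I] I'(2)] by blast
    obtain \<zeta>' b where b: "\<zeta>' \<in> {..<q} \<rightarrow>\<^sub>E {..<m}" "b \<in> I \<rightarrow>\<^sub>E {..q}" "\<forall>i\<in>I. b i < q \<longrightarrow> g {\<zeta>' (b i), s i}"
      "\<forall>i\<in>I. \<forall>j\<in>I. (\<exists>z<m. g {z, s i} \<and> g {z, s j}) \<longrightarrow> (b i = b j \<and> b i < q) \<or> (i, j) \<in> exceptional m t s g I"
      using ex_piece_assignment[OF m0 good_heavy[OF gs I] I'(2)] by blast
    have "\<exists>J\<subseteq>I - covered I a. balanced I a \<and> (r, e) \<in> sparse_event I \<zeta> a b J"
    proof (rule ex_sparse_event[OF gr I b(2) a(1-3)])
      show "(b i = b j \<and> b i < q) \<or> (i, j) \<in> exceptional m t s g I" if "i \<in> I" "j \<in> I" "coloured m r e i j" for i j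
        using b(4) cr[OF that] that by simp
      show "card {d\<in>pair_edges (exceptional m t s g I) J. e (r ` d)} \<le> \<tau>1" if "J \<subseteq> I" "inj_on r J" for J
        using ty I that unfolding typical_def by (elim conjE) simp
    qed
    then obtain J where J: "J \<subseteq> I - covered I a" "balanced I a" "(r, e) \<in> sparse_event I \<zeta> a b J" by blast
    have "\<exists>J\<subseteq>I - covered I b. balanced I b \<and> (s, g) \<in> sparse_event I \<zeta>' b a J"
    proof (rule ex_sparse_event[OF gs I a(2) b(1-3)])
      show "(a i = a j \<and> a i < q) \<or> (i, j) \<in> exceptional m t r e I" if "i \<in> I" "j \<in> I" "coloured m s g i j" for i j
        using a(4) cs[OF that] that by simp
      show "card {d\<in>pair_edges (exceptional m t r e I) J. g (s ` d)} \<le> \<tau>1" if "J \<subseteq> I" "inj_on s J" for J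
        using ty I that unfolding typical_def by (elim conjE) simp
    qed
    then obtain J' where J': "J' \<subseteq> I - covered I b" "balanced I b" "(s, g) \<in> sparse_event I \<zeta>' b a J'" by blast
    have "((r, e), (s, g)) \<in> blocked I (\<zeta>, a, J) (\<zeta>', b, J')"
      unfolding blocked_def prod.case using J J' by simp
    moreover have JI: "J \<in> Pow I" "J' \<in> Pow I" using J(1) J'(1) by blast+
    have "(\<zeta>, a, J) \<in> params I" unfolding params_def by (intro SigmaI a(1,2) JI)
    moreover have "(\<zeta>', b, J') \<in> params I" unfolding params_def by (intro SigmaI b(1,2) JI)
    ultimately show False using conjunct2[OF conjunct2[OF conjunct2[OF conjunct2[OF ty[unfolded typical_def]]]]] I by (meson bspec)
  qed
  moreover have "simple_graph {..<n} ?E" by (rule simple_two_bite_graph[where e = e and g = g, OF loop])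
  moreover have "\<not> has_triangle {..<n} ?E" by (rule triangle_free_two_bite_graph[where e = e and g = g and r = r and s = s, OF loop rm])
  ultimately show ?thesis by blast
qed

end

text \<open>\<open>R3 k\<close> is a \<open>LEAST\<close>, which has its defining property only once
  some \<open>n\<close> satisfies it; Ramsey's theorem supplies one.\<close>

lemma ex_ramsey_number:
  "\<exists>n. \<forall>E :: nat \<Rightarrow> nat \<Rightarrow> bool. simple_graph {..<n} E \<longrightarrow> has_triangle {..<n} E \<or> has_indep_set_of_size {..<n} E k"
proof -
  obtain N :: nat where N: "\<And>(V :: nat set) E. finite V \<Longrightarrow> N \<le> card V \<Longrightarrow>
      \<exists>R\<subseteq>V. card R = 3 \<and> clique R E \<or> card R = k \<and> indep R E"
    using ramsey2[of 3 k] by metis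
  have "has_triangle {..<N} E \<or> has_indep_set_of_size {..<N} E k" if E: "simple_graph {..<N} E" for E :: "nat \<Rightarrow> nat \<Rightarrow> bool"
  proof -
    let ?F = "{{x, y} | x y. x < N \<and> y < N \<and> E x y}"
    obtain R where R: "R \<subseteq> {..<N}" "card R = 3 \<and> clique R ?F \<or> card R = k \<and> indep R ?F"
      using N[of "{..<N}" ?F] by auto
    have F: "{x, y} \<in> ?F \<longleftrightarrow> E x y" if "x < N" "y < N" for x y
      using E that unfolding simple_graph_def by (auto simp: doubleton_eq_iff)
    have fR: "finite R" using R(1) finite_subset by blast
    show ?thesis using R(2)
    proof (elim disjE conjE)
      assume "card R = 3" and c: "clique R ?F"
      then obtain x y z where xyz: "R = {x, y, z}" "x \<noteq> y" "y \<noteq> z" "x \<noteq> z" by (auto simp: card_3_iff)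
      have "E x y" "E y z" "E x z" using c xyz R(1) F unfolding clique_def by auto
      then show ?thesis using xyz R(1) unfolding has_triangle_def by blast
    next
      assume "card R = k" and c: "indep R ?F"
      have "\<not> E x y" if xy: "x \<in> R" "y \<in> R" for x y
      proof (cases "x = y")
        case True then show ?thesis using E xy R(1) unfolding simple_graph_def by blast
      next
        case False
        then have "{x, y} \<notin> ?F" using c xy unfolding indep_def by blast
        then show ?thesis using F xy R(1) by blast
      qed
      then show ?thesis using R(1) \<open>card R = k\<close> fR unfolding has_indep_set_of_size_def independent_set_def by blast
    qed
  qed
  then show ?thesis by blast
qed

text \<open>A graph on at least \<open>R3 k\<close> vertices restricts to its first
  \<open>R3 k\<close> ones, and a triangle or independent set found there persists in the whole
  graph.\<close>

lemma less_R3: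
  fixes E :: "nat \<Rightarrow> nat \<Rightarrow> bool"
  assumes "simple_graph {..<n} E" "\<not> has_triangle {..<n} E" "\<not> has_indep_set_of_size {..<n} E k"
  shows "n < R3 k"
proof (rule ccontr)
  assume "\<not> n < R3 k"
  then have le: "{..<R3 k} \<subseteq> {..<n}" by auto
  let ?P = "\<lambda>n. \<forall>E :: nat \<Rightarrow> nat \<Rightarrow> bool. simple_graph {..<n} E \<longrightarrow> has_triangle {..<n} E \<or> has_indep_set_of_size {..<n} E k"
  have P: "?P (R3 k)" unfolding R3_def using ex_ramsey_number[of k] by (rule LeastI_ex)
  have "simple_graph {..<R3 k} E" using assms(1) le by (auto simp: simple_graph_def)
  then have "has_triangle {..<R3 k} E \<or> has_indep_set_of_size {..<R3 k} E k" using P by simp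
  moreover have "has_triangle {..<n} E" if "has_triangle {..<R3 k} E"
    using that subsetD[OF le] unfolding has_triangle_def by (elim bexE) (intro bexI, assumption, simp_all)
  moreover have "has_indep_set_of_size {..<n} E k" if "has_indep_set_of_size {..<R3 k} E k"
    using that order_trans[OF _ le] unfolding has_indep_set_of_size_def independent_set_def
    by (elim exE conjE) (intro exI conjI, simp_all)
  ultimately show False using assms(2,3) by argo
qed

subsection \<open>Choice of the parameters\<close>

lemma pow_div_fact_le_exp:
  fixes x :: real assumes "0 \<le> x" shows "x ^ n / fact n \<le> exp x"
proof -
  have "(\<Sum>i\<in>{n}. x ^ i /\<^sub>R fact i) \<le> (\<Sum>i. x ^ i /\<^sub>R fact i)"
    by (rule sum_le_suminf[OF summable_exp_generic]) (use assms in auto)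
  then show ?thesis by (simp add: exp_def divide_inverse mult.commute)
qed

text \<open>A weak Stirling bound, \<open>n^n / n! \<le> e^n\<close>, read off from one term of the
  exponential series. It serves both for the number of k-sets and for the packing tail.\<close>

lemma pow_div_fact_le:
  fixes a b :: real assumes "0 \<le> a" "0 < b" "a * exp 1 \<le> b * n" "0 < n"
  shows "a ^ n / fact n \<le> b ^ n"
proof -
  have "a ^ n / fact n = (a / n) ^ n * (real n ^ n / fact n)" using assms by (simp add: power_divide)
  also have "\<dots> \<le> (a / n) ^ n * exp (real n)"
    using assms by (intro mult_left_mono pow_div_fact_le_exp) auto
  also have "\<dots> = (a * exp 1 / n) ^ n" by (simp add: power_mult_distrib power_divide flip: exp_of_nat_mult)
  also have "\<dots> \<le> b ^ n" using assms by (intro power_mono) (auto simp: field_simps)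
  finally show ?thesis .
qed

lemma choose_le_pow_div_fact: "real (n choose k) \<le> real n ^ k / fact k"
proof -
  have "real ((n choose k) * fact k) \<le> real (n ^ k)" using binomial_fact_pow by (rule of_nat_mono)
  then show ?thesis by (simp add: field_simps)
qed

text \<open>Hence the threshold -7 to which all tail exponents are compared below.\<close>

lemma exp_le_one_64: "x \<le> - 7 \<Longrightarrow> exp x \<le> (1/64 :: real)"
proof -
  assume x: "x \<le> - 7"
  have "(2::real) ^ 7 \<le> exp 1 ^ 7" using exp_ge_add_one_self[of "1::real"] by (intro power_mono) auto
  also have "\<dots> = exp 7" by (simp flip: exp_of_nat_mult)
  finally have "128 \<le> exp (7::real)" by simp
  then have "exp (- 7 :: real) \<le> 1/64" by (simp add: exp_minus field_simps)
  moreover have "exp x \<le> exp (- 7)" using x by simp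
  ultimately show ?thesis by linarith
qed

lemma le_one_64_if_le_exp: "a \<le> exp x \<Longrightarrow> x \<le> - 7 \<Longrightarrow> a \<le> (1/64 :: real)"
  using exp_le_one_64[of x] by linarith

text \<open>The last bound fixes the density constant: after the lower tail at exponent -3, the
  constant \<open>61/50\<close> still leaves \<open>57/50\<close>, more than twice
  \<open>11/20\<close>.\<close>

lemma exp_numeric_bounds:
  shows "exp (1/50) - 1 \<le> (102/5000 :: real)" "exp 1 \<le> (3::real)" "exp 4 \<le> (81::real)" "61/50 * (1 - exp (- 3)) \<ge> (57/50 :: real)"
proof -
  show "exp (1/50) - 1 \<le> (102/5000 :: real)" using exp_bound[of "1/50::real"] by (simp add: power2_eq_square)
  show e3: "exp 1 \<le> (3::real)" by (rule exp_le)
  have "exp (4::real) = exp 1 ^ 4" by (simp flip: exp_of_nat_mult)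
  also have "\<dots> \<le> 3 ^ 4" using e3 by (intro power_mono) auto
  finally show "exp 4 \<le> (81::real)" by simp
  have "(5/2::real) \<le> exp 1" using exp_lower_Taylor_quadratic[of "1::real"] by simp
  then have "(5/2::real) ^ 3 \<le> exp 1 ^ 3" by (intro power_mono) auto
  also have "\<dots> = exp 3" by (simp flip: exp_of_nat_mult)
  finally have "125/8 \<le> exp (3::real)" by (simp add: power3_eq_cube)
  then have "exp (- 3 :: real) \<le> 8/125" by (simp add: exp_minus field_simps)
  then show "61/50 * (1 - exp (- 3)) \<ge> (57/50 :: real)" by simp
qed

text \<open>All asymptotic demands on the parameters, expressed in \<open>x = k\<close> and
  \<open>l = log k\<close> alone. Each is an elementary comparison of growth rates; what remains for
  a given \<open>k\<close> is algebra.\<close>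

definition eventual_bounds :: "real \<Rightarrow> real \<Rightarrow> bool" where
  "eventual_bounds x l \<longleftrightarrow> 1 \<le> l \<and> 1 \<le> x \<and> 2 * (x\<^sup>2 / l ^ 6) \<le> x\<^sup>2 \<and> 61/50 * (l / x) \<le> 1 \<and>
    10 / l\<^sup>2 \<le> 1 \<and> 61/50 * (l / x) * (10 * l\<^sup>2 / x * (x / l ^ 10)) * x \<le> 1 \<and>
    3 / l ^ 4 \<le> exp (- 1) \<and> 4 * l - l\<^sup>2 \<le> - 7 \<and>
    2 * l - 61/50 * (x / l ^ 5) / 5000 \<le> - 7 \<and>
    2 * l + 2/3 * l ^ 5 - l ^ 6 \<le> - 7 \<and>
    2 * l - 4/10000 * x \<le> - 7 \<and>
    1440000 / l ^ 4 \<le> 1 / l \<and> 2 * x * l - x * l * ln l / 120000 \<le> - 7 \<and>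
    2 * x * l + 61/25 * (x * l) - x * l\<^sup>2 \<le> - 7 \<and>
    2 * x * l + 2412 * (x / l\<^sup>2) - 5 * (x * l) \<le> - 7 \<and>
    2 * x * l + x + 61/50 * (x * l) - ln l * (x * l / 50000) \<le> - 7 \<and>
    32 * l ^ 28 \<le> x / l ^ 10 \<and> 3 * x - 96 * l ^ 38 > x \<and>
    x * l ^ 6 + (x\<^sup>2 / (2 * l) + x / l ^ 10 * (2 * l ^ 6 * (x * l\<^sup>2))) + 2 * x * (32 * l ^ 28) \<le> x\<^sup>2 / l \<and>
    3 * (x * l / 120000 + 1) + x * l / 50000 \<le> x * l / 20000 \<and>
    x * l + 16 * l ^ 11 + 2 * x * ln (5 * l ^ 10) + 2 * x + 2 * x * ln (l ^ 7) + 6 * (x * l / 20000) - 1001/1000 * (x * l) + 57/50 * l \<le> - 7 \<and>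
    2 \<le> x\<^sup>2 / l ^ 6 \<and> 3 / 2 \<le> l"

lemma eventually_bounds: "\<forall>\<^sub>F k :: nat in at_top. eventual_bounds (real k) (ln (real k))"
  unfolding eventual_bounds_def
  by (intro eventually_conj; real_asymp)

text \<open>The scales are as follows. The mean fibre size is at most \<open>l^5 / 3\<close>, below
  \<open>M = l^6\<close>, and \<open>m p^2\<close> has order \<open>l^-4\<close>. The product
  \<open>q t\<close> is at least \<open>3 k\<close>, while overlaps of neighbourhoods are
  polylogarithmic. The thresholds \<open>F\<close> and \<open>\<tau>1\<close> are small multiples of
  \<open>k l\<close>, far above the means of order at most \<open>k / l^3\<close> and
  \<open>k\<close>; their tail exponents therefore gain a factor \<open>ln l\<close>, which beats
  the \<open>exp (2 k l)\<close> bounding the number of k-sets.\<close>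

lemma two_bites_instance:
  fixes k :: nat and x l :: real
  assumes x: "x = real k" and l: "l = ln x" and ev: "eventual_bounds x l"
  defines "n \<equiv> nat \<lfloor>x\<^sup>2 / (3 * l)\<rfloor>" and "m \<equiv> nat \<lceil>x\<^sup>2 / l ^ 6\<rceil>" and "p \<equiv> 61/50 * (l / x)"
  shows "two_bites k n m (nat \<lceil>l\<^sup>2\<rceil>) (nat \<lceil>3 * l ^ 10\<rceil>) (nat \<lceil>x * l / 120000\<rceil>) p (l ^ 6) (x / l ^ 10)
    (103/100 * (p * m)) (x * l / 20000) (x * l / 50000) (x * l\<^sup>2) (x\<^sup>2 / (2 * l)) (x\<^sup>2 / l) (10 * l\<^sup>2 / x) (ln l) (l ^ 7)"
proof -
  define h where "h = nat \<lceil>l\<^sup>2\<rceil>"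
  define q where "q = nat \<lceil>3 * l ^ 10\<rceil>"
  define F where "F = nat \<lceil>x * l / 120000\<rceil>"
  have l1: "1 \<le> l" and x1: "1 \<le> x" and E4: "2 * (x\<^sup>2 / l ^ 6) \<le> x\<^sup>2" and E5: "61/50 * (l / x) \<le> 1"
    and E6: "10 / l\<^sup>2 \<le> 1" and E7: "61/50 * (l / x) * (10 * l\<^sup>2 / x * (x / l ^ 10)) * x \<le> 1"
    and E8: "3 / l ^ 4 \<le> exp (- 1)" and E9: "4 * l - l\<^sup>2 \<le> - 7"
    and E10: "2 * l - 61/50 * (x / l ^ 5) / 5000 \<le> - 7" and E11: "2 * l + 2/3 * l ^ 5 - l ^ 6 \<le> - 7"
    and E12: "2 * l - 4/10000 * x \<le> - 7" and E13: "1440000 / l ^ 4 \<le> 1 / l"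
    and E14: "2 * x * l - x * l * ln l / 120000 \<le> - 7" and E15: "2 * x * l + 61/25 * (x * l) - x * l\<^sup>2 \<le> - 7"
    and E16: "2 * x * l + 2412 * (x / l\<^sup>2) - 5 * (x * l) \<le> - 7"
    and E17: "2 * x * l + x + 61/50 * (x * l) - ln l * (x * l / 50000) \<le> - 7"
    and E18: "32 * l ^ 28 \<le> x / l ^ 10" and E19: "3 * x - 96 * l ^ 38 > x"
    and E20: "x * l ^ 6 + (x\<^sup>2 / (2 * l) + x / l ^ 10 * (2 * l ^ 6 * (x * l\<^sup>2))) + 2 * x * (32 * l ^ 28) \<le> x\<^sup>2 / l"
    and E21: "3 * (x * l / 120000 + 1) + x * l / 50000 \<le> x * l / 20000"
    and E22: "x * l + 16 * l ^ 11 + 2 * x * ln (5 * l ^ 10) + 2 * x + 2 * x * ln (l ^ 7) + 6 * (x * l / 20000) - 1001/1000 * (x * l) + 57/50 * l \<le> - 7"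
    and E23: "2 \<le> x\<^sup>2 / l ^ 6" and E24: "3 / 2 \<le> l"
    using ev unfolding eventual_bounds_def by (simp_all only:)
  have l0: "0 < l" and x0: "0 < x" using l1 x1 by linarith+
  have k0: "0 < k" using x0 x by simp
  have ex: "exp l = x" using x0 l by simp
  have lp: "1 \<le> l ^ j" for j using l1 by (rule one_le_power)
  have lp0: "0 < l ^ j" for j using l0 by simp
  have n_le: "n \<le> x\<^sup>2 / (3 * l)" unfolding n_def using l0 by simp
  have m_ge: "x\<^sup>2 / l ^ 6 \<le> m" unfolding m_def by (rule real_nat_ceiling_ge)
  note mm = E23
  have m_le: "m \<le> 2 * (x\<^sup>2 / l ^ 6)"
  proof -
    have "m \<le> x\<^sup>2 / l ^ 6 + 1" unfolding m_def using mm by linarith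
    then show ?thesis using mm by linarith
  qed
  have m0: "0 < real m" using m_ge mm by linarith
  have m_le2: "m \<le> x\<^sup>2" using m_le E4 by linarith
  have h_ge: "l\<^sup>2 \<le> h" unfolding h_def by (rule real_nat_ceiling_ge)
  have h_le: "h \<le> 2 * l\<^sup>2" unfolding h_def using lp[of 2] by linarith
  have q_ge: "3 * l ^ 10 \<le> q" unfolding q_def by (rule real_nat_ceiling_ge)
  have q_le: "q \<le> 4 * l ^ 10" unfolding q_def using lp[of 10] by linarith
  have xl0: "0 < x * l" using x0 l0 by simp
  have F_ge: "x * l / 120000 \<le> F" unfolding F_def by (rule real_nat_ceiling_ge)
  have F_le: "F \<le> x * l / 120000 + 1" unfolding F_def using xl0 by linarith
  have F0: "0 < F" using F_ge xl0 by (intro Nat.gr0I) simp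
  have p0: "0 \<le> p" unfolding p_def using l0 x0 by simp
  have p1: "p \<le> 1" unfolding p_def by (rule E5)
  have x2: "x\<^sup>2 = exp (2 * l)" using ex by (simp add: exp_double)
  have n_le2: "real n \<le> x\<^sup>2"
  proof -
    have "x\<^sup>2 / (3 * l) \<le> x\<^sup>2 / 1" using l1 by (intro divide_left_mono) auto
    then show ?thesis using n_le by simp
  qed
  have choose: "real (n choose k) \<le> exp (2 * x * l)"
  proof -
    have "real (n choose k) \<le> real (n ^ k)" by (rule of_nat_mono[OF choose_le_pow])
    also have "\<dots> = real n ^ k" by simp
    also have "\<dots> \<le> (x\<^sup>2) ^ k" using n_le2 by (intro power_mono) auto
    also have "\<dots> = exp (real k * (2 * l))" unfolding x2 by (rule exp_of_nat_mult[symmetric])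
    also have "\<dots> = exp (2 * x * l)" by (simp add: x)
    finally show ?thesis .
  qed
  \<comment> \<open>The main union bound needs the sharp exponent \<open>k l\<close>, whereas
    \<open>choose\<close> loses a factor 2 that is harmless elsewhere. The 3 in \<open>n\<close>
    absorbs \<open>e\<close>, and the remaining \<open>1 / l\<close> is given away.\<close>
  have choose': "real (n choose k) \<le> exp (x * l)"
  proof -
    have "real (n choose k) \<le> real n ^ k / fact k" by (rule choose_le_pow_div_fact)
    also have "\<dots> \<le> x ^ k"
    proof (rule pow_div_fact_le)
      have "real n * exp 1 \<le> x\<^sup>2 / (3 * l) * 3" using n_le exp_numeric_bounds(2) l0 by (intro mult_mono) auto
      also have "\<dots> = x\<^sup>2 / l" by simp
      also have "\<dots> \<le> x\<^sup>2 / 1" using l1 by (intro divide_left_mono) auto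
      finally show "real n * exp 1 \<le> x * real k" using x by (simp add: power2_eq_square)
    qed (use x0 k0 in auto)
    also have "\<dots> = exp l ^ k" by (simp add: ex)
    also have "\<dots> = exp (x * l)" unfolding x by (simp flip: exp_of_nat_mult)
    finally show ?thesis .
  qed
  have times: "real (n choose k) * b \<le> 1/64" if "b \<le> exp y" "2 * x * l + y \<le> - 7" for b y
  proof (rule le_one_64_if_le_exp[OF _ that(2)])
    have "real (n choose k) * b \<le> real (n choose k) * exp y" using that(1) by (intro mult_left_mono) auto
    also have "\<dots> \<le> exp (2 * x * l) * exp y" using choose by (intro mult_right_mono) auto
    finally show "real (n choose k) * b \<le> exp (2 * x * l + y)" by (simp add: exp_add)
  qed
  have mtimes: "real m * exp y \<le> 1/64" if "y \<le> y'" "2 * l + y' \<le> - 7" for y y'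
  proof (rule le_one_64_if_le_exp[OF _ that(2)])
    have "real m * exp y \<le> x\<^sup>2 * exp y'" using m_le2 that(1) by (intro mult_mono) auto
    then show "real m * exp y \<le> exp (2 * l + y')" by (simp add: exp_add x2)
  qed
  have two_k: "(2::real) ^ k \<le> exp x"
  proof -
    have "(2::real) ^ k \<le> exp 1 ^ k" using exp_ge_add_one_self[of "1::real"] by (intro power_mono) auto
    then show ?thesis using x by (simp flip: exp_of_nat_mult)
  qed
  have qhM: "(real q)\<^sup>2 * (h * l ^ 6) \<le> 32 * l ^ 28"
  proof -
    have "(real q)\<^sup>2 * (h * l ^ 6) \<le> (4 * l ^ 10)\<^sup>2 * (2 * l\<^sup>2 * l ^ 6)"
      using q_le h_le lp0 by (intro mult_mono power_mono) (use l0 in \<open>auto intro: less_imp_le\<close>)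
    also have "\<dots> = 32 * l ^ 28" by (simp add: power_mult_distrib flip: power_add power_mult)
    finally show ?thesis .
  qed
  have "two_bites k n m h q F p (l ^ 6) (x / l ^ 10)
    (103/100 * (p * m)) (x * l / 20000) (x * l / 50000) (x * l\<^sup>2) (x\<^sup>2 / (2 * l)) (x\<^sup>2 / l) (10 * l\<^sup>2 / x) (ln l) (l ^ 7)"
  proof
    show "0 \<le> p" "p \<le> 1" "0 < k" by (fact p0 p1 k0)+
    show "0 < m" using m0 by simp
    show "0 \<le> l ^ 6" "0 \<le> x / l ^ 10" "0 \<le> 10 * l\<^sup>2 / x" using lp0 x0 by (auto intro: less_imp_le)
    show "0 \<le> 103/100 * (p * m)" using p0 by simp
    show "0 \<le> ln l" using l1 by simp
    show "10 * l\<^sup>2 / x * (x / l ^ 10) * l ^ 6 \<le> 1"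
    proof -
      have "10 * l\<^sup>2 / x * (x / l ^ 10) * l ^ 6 = 10 * (l ^ 8 / l ^ 10)" using x0 by (simp flip: power_add)
      also have "l ^ 8 / l ^ 10 = 1 / l\<^sup>2" using l0 by (simp add: field_simps flip: power_add)
      finally show ?thesis using E6 by simp
    qed
    show "p * (10 * l\<^sup>2 / x * (x / l ^ 10)) * k \<le> 1" unfolding p_def x[symmetric] by (rule E7)
    show "real m ^ 2 * (real m * p\<^sup>2) ^ h \<le> 1/64"
    proof (rule le_one_64_if_le_exp)
      have "real m * p\<^sup>2 \<le> 2 * (x\<^sup>2 / l ^ 6) * p\<^sup>2" using m_le by (intro mult_right_mono) auto
      also have "\<dots> = 2 * (61/50)\<^sup>2 * (l\<^sup>2 / l ^ 6)" unfolding p_def using x0 by (simp add: power_mult_distrib power_divide)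
      also have "l\<^sup>2 / l ^ 6 = 1 / l ^ 4" using l0 by (simp add: field_simps flip: power_add)
      also have "2 * (61/50)\<^sup>2 * (1 / l ^ 4) \<le> 3 * (1 / l ^ 4)" using lp0[of 4] by (intro mult_right_mono) (auto simp: power2_eq_square)
      also have "\<dots> \<le> exp (- 1)" using E8 by simp
      finally have a: "real m * p\<^sup>2 \<le> exp (- 1)" .
      have "(real m * p\<^sup>2) ^ h \<le> exp (- 1) ^ h" using a by (intro power_mono) auto
      also have "\<dots> = exp (- real h)" by (simp flip: exp_of_nat_mult)
      also have "\<dots> \<le> exp (- (l\<^sup>2))" using h_ge by simp
      finally have b: "(real m * p\<^sup>2) ^ h \<le> exp (- (l\<^sup>2))" .
      have "real m ^ 2 \<le> (x\<^sup>2)\<^sup>2" using m_le2 by (intro power_mono) auto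
      also have "\<dots> = exp (4 * l)" unfolding x2 by (simp flip: exp_double)
      finally have "real m ^ 2 * (real m * p\<^sup>2) ^ h \<le> exp (4 * l) * exp (- (l\<^sup>2))" using b by (intro mult_mono) auto
      then show "real m ^ 2 * (real m * p\<^sup>2) ^ h \<le> exp (4 * l - l\<^sup>2)" by (simp flip: exp_add)
      show "4 * l - l\<^sup>2 \<le> - 7" by (rule E9)
    qed
    \<comment> \<open>At exponent \<open>1/50\<close> the moment costs \<open>0.0204\<close> per
      expected neighbour and the threshold \<open>103/100\<close> gains \<open>0.0206\<close>; the
      difference is the \<open>1/5000\<close> below.\<close>
    show "real m * exp (p * m * (exp (1/50) - 1) - 1/50 * (103/100 * (p * m))) \<le> 1/64"
    proof (rule mtimes)
      have "x\<^sup>2 / l ^ 6 * p \<le> m * p" using m_ge p0 by (intro mult_right_mono)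
      moreover have "x\<^sup>2 / l ^ 6 * p = 61/50 * (x / l ^ 5)"
        unfolding p_def using x0 l0 by (simp add: field_simps power2_eq_square flip: power_Suc)
      ultimately have pm: "61/50 * (x / l ^ 5) \<le> p * m" by (simp add: mult.commute)
      have "p * m * (exp (1/50) - 1) \<le> p * m * (102/5000)" using exp_numeric_bounds(1) p0 by (intro mult_left_mono) auto
      then show "p * m * (exp (1/50) - 1) - 1/50 * (103/100 * (p * m)) \<le> - (61/50 * (x / l ^ 5) / 5000)" using pm by simp
      show "2 * l + - (61/50 * (x / l ^ 5) / 5000) \<le> - 7" using E10 by linarith
    qed
    show "real m * exp (n * (1 / m) * (exp 1 - 1) - l ^ 6) \<le> 1/64"
    proof (rule mtimes)
      have "n / m \<le> (x\<^sup>2 / (3 * l)) / (x\<^sup>2 / l ^ 6)" using n_le m_ge x0 l0 by (intro frac_le) auto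
      also have "\<dots> = l ^ 5 / 3" using x0 l0 by (simp add: field_simps flip: power_Suc)
      finally have "n / m * (exp 1 - 1) \<le> l ^ 5 / 3 * 2" using exp_numeric_bounds(2) lp0[of 5] by (intro mult_mono) auto
      then show "n * (1 / m) * (exp 1 - 1) - l ^ 6 \<le> 2/3 * l ^ 5 - l ^ 6" by simp
      show "2 * l + (2/3 * l ^ 5 - l ^ 6) \<le> - 7" using E11 by linarith
    qed
    show "real m * exp (n * (103/100 * (p * m) / m) * (exp (1/50) - 1) - 1/50 * (9/20 * k)) \<le> 1/64"
    proof (rule mtimes)
      define V where "V = n * (103/100 * (p * m) / m)"
      have "V = n * (103/100 * p)" using m0 by (simp add: V_def)
      also have "\<dots> \<le> x\<^sup>2 / (3 * l) * (103/100 * p)" using n_le p0 by (intro mult_right_mono) auto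
      \<comment> \<open>\<open>6283/15000\<close> is \<open>61/50 * 103/100 / 3\<close>, about
        \<open>0.419\<close>, which stays below \<open>9/20\<close>.\<close>
      also have "\<dots> = 6283/15000 * x" unfolding p_def using x0 l0 by (simp add: power2_eq_square)
      finally have V: "V \<le> 6283/15000 * x" .
      have "0 \<le> V" using p0 by (simp add: V_def)
      with exp_numeric_bounds(1) have "V * (exp (1/50) - 1) \<le> V * (102/5000)" by (rule mult_left_mono)
      then have "V * (exp (1/50) - 1) - 1/50 * (9/20 * x) \<le> - (4/10000 * x)" using V x0 by simp
      then show "n * (103/100 * (p * m) / m) * (exp (1/50) - 1) - 1/50 * (9/20 * k) \<le> - (4/10000 * x)"
        unfolding V_def x .
      show "2 * l + - (4/10000 * x) \<le> - 7" using E12 by linarith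
    qed
    show "real (n choose k) * ((real (k\<^sup>2 * m) * p ^ 3) ^ F / fact F) \<le> 1/64"
    proof (rule times)
      let ?A = "real (k\<^sup>2 * m) * p ^ 3"
      have A: "?A \<le> 4 * (x / l ^ 3)"
      proof -
        have "?A = x\<^sup>2 * m * p ^ 3" by (simp add: x)
        also have "\<dots> \<le> x\<^sup>2 * (2 * (x\<^sup>2 / l ^ 6)) * p ^ 3" using m_le p0 by (intro mult_right_mono mult_left_mono) auto
        also have "\<dots> = 2 * (61/50) ^ 3 * (x / l ^ 3)"
        proof -
          have "l ^ 6 = l ^ 3 * l ^ 3" by (simp flip: power_add)
          then show ?thesis unfolding p_def using x0 l0 by (simp add: power_divide power_mult_distrib power2_eq_square power3_eq_cube)
        qed
        also have "\<dots> \<le> 4 * (x / l ^ 3)" using x0 lp0[of 3] by (intro mult_right_mono) (auto simp: power3_eq_cube)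
        finally show ?thesis .
      qed
      \<comment> \<open>The mean \<open>?A\<close> is smaller than \<open>F\<close> by a factor of
        order \<open>l^4\<close>, so even after the Stirling loss each triangle contributes at most
        \<open>1 / l\<close>.\<close>
      have "?A ^ F / fact F \<le> (1 / l) ^ F"
      proof (rule pow_div_fact_le)
        have "?A * exp 1 \<le> 4 * (x / l ^ 3) * 3" by (rule mult_mono[OF A exp_numeric_bounds(2)]) (use x0 l0 in auto)
        also have "\<dots> = 1440000 / l ^ 4 * (x * l / 120000)" using l0 by (simp add: field_simps flip: power_Suc)
        also have "\<dots> \<le> 1 / l * F" by (rule mult_mono[OF E13 F_ge]) (use x0 l0 in auto)
        finally show "?A * exp 1 \<le> 1 / l * F" .
      qed (use p0 l0 F0 in auto)
      also have "(1 / l) ^ F = exp (- ln l) ^ F" using l0 by (simp add: exp_minus inverse_eq_divide)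
      also have "\<dots> = exp (- (F * ln l))" by (simp flip: exp_of_nat_mult)
      also have "\<dots> \<le> exp (- (x * l * ln l / 120000))"
      proof -
        have "x * l / 120000 * ln l \<le> F * ln l" using F_ge l1 by (intro mult_right_mono) auto
        then show ?thesis by simp
      qed
      finally show "?A ^ F / fact F \<le> exp (- (x * l * ln l / 120000))" .
      show "2 * x * l + - (x * l * ln l / 120000) \<le> - 7" using E14 by simp
    qed
    show "real (n choose k) * exp (p * k\<^sup>2 * (exp 1 - 1) - x * l\<^sup>2) \<le> 1/64"
    proof (rule times)
      have pk: "p * k\<^sup>2 = 61/50 * (x * l)" unfolding p_def using x x0 by (simp add: power2_eq_square)
      have "p * k\<^sup>2 * (exp 1 - 1) \<le> 61/50 * (x * l) * 2"
        unfolding pk by (rule mult_left_mono) (use exp_numeric_bounds(2) xl0 in simp_all)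
      then show "exp (p * k\<^sup>2 * (exp 1 - 1) - x * l\<^sup>2) \<le> exp (61/25 * (x * l) - x * l\<^sup>2)" by (simp add: mult.commute)
      show "2 * x * l + (61/25 * (x * l) - x * l\<^sup>2) \<le> - 7" using E15 by (simp only: add_diff_eq)
    qed
    show "real (n choose k) * exp (m * (10 * l\<^sup>2 / x * (real k)\<^sup>2 * p\<^sup>2 * exp 4) - 10 * l\<^sup>2 / x * (x\<^sup>2 / (2 * l))) \<le> 1/64"
    proof (rule times)
      have "m * (10 * l\<^sup>2 / x * (real k)\<^sup>2 * p\<^sup>2 * exp 4) \<le> 2 * (x\<^sup>2 / l ^ 6) * (10 * l\<^sup>2 / x * (real k)\<^sup>2 * p\<^sup>2 * 81)"
        by (rule mult_mono[OF m_le mult_left_mono[OF exp_numeric_bounds(3)]]) (use x0 l0 in auto)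
      also have "\<dots> = 2 * 10 * (61/50)\<^sup>2 * 81 * (x / l\<^sup>2)"
      proof -
        have "l ^ 6 = l\<^sup>2 * l\<^sup>2 * l\<^sup>2" by (simp flip: power_add)
        then show ?thesis unfolding p_def using x0 l0 by (simp add: power_divide power_mult_distrib power2_eq_square x[symmetric])
      qed
      also have "\<dots> \<le> 2412 * (x / l\<^sup>2)" using x0 lp0[of 2] by (intro mult_right_mono) (auto simp: power2_eq_square)
      finally have a: "m * (10 * l\<^sup>2 / x * (real k)\<^sup>2 * p\<^sup>2 * exp 4) \<le> 2412 * (x / l\<^sup>2)" .
      \<comment> \<open>The choice of \<open>\<theta>\<close> makes this term \<open>5 k l\<close>,
        against \<open>2 k l\<close> for the number of k-sets, while the moment term is only of
        order \<open>k / l^2\<close>.\<close>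
      have "10 * l\<^sup>2 / x * (x\<^sup>2 / (2 * l)) = 5 * (x * l)" using x0 l0 by (simp add: power2_eq_square)
      then show "exp (m * (10 * l\<^sup>2 / x * (real k)\<^sup>2 * p\<^sup>2 * exp 4) - 10 * l\<^sup>2 / x * (x\<^sup>2 / (2 * l))) \<le> exp (2412 * (x / l\<^sup>2) - 5 * (x * l))"
        using a by simp
      show "2 * x * l + (2412 * (x / l\<^sup>2) - 5 * (x * l)) \<le> - 7" using E16 by (simp only: add_diff_eq)
    qed
    show "real (n choose k) * (2 ^ k * exp (p * (x\<^sup>2 / l) * (exp (ln l) - 1) - ln l * (x * l / 50000))) \<le> 1/64"
    proof (rule times)
      have px: "p * (x\<^sup>2 / l) = 61/50 * x" unfolding p_def using x0 l0 by (simp add: power2_eq_square)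
      \<comment> \<open>With \<open>\<mu> = ln l\<close> the moment costs order \<open>k l\<close>,
        but \<open>\<mu> * \<tau>1\<close> has order \<open>k l ln l\<close>.\<close>
      have "61/50 * x * (exp (ln l) - 1) = 61/50 * (x * l) - 61/50 * x" using l0 by (simp add: right_diff_distrib)
      then have "p * (x\<^sup>2 / l) * (exp (ln l) - 1) \<le> 61/50 * (x * l)" unfolding px using x0 by simp
      then have "2 ^ k * exp (p * (x\<^sup>2 / l) * (exp (ln l) - 1) - ln l * (x * l / 50000)) \<le> exp x * exp (61/50 * (x * l) - ln l * (x * l / 50000))"
        using two_k by (intro mult_mono) auto
      then show "2 ^ k * exp (p * (x\<^sup>2 / l) * (exp (ln l) - 1) - ln l * (x * l / 50000)) \<le> exp (x + (61/50 * (x * l) - ln l * (x * l / 50000)))"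
        by (simp only: exp_add)
      show "2 * x * l + (x + (61/50 * (x * l) - ln l * (x * l / 50000))) \<le> - 7" using E17 by (simp only: add_diff_eq add.assoc)
    qed
    show "real k < real q * (x / l ^ 10 - (real q)\<^sup>2 * (h * l ^ 6))"
    proof -
      note t = E18
      have "real k < 3 * x - 96 * l ^ 38" using E19 x by simp
      also have "\<dots> = 3 * l ^ 10 * (x / l ^ 10 - 32 * l ^ 28)"
        using l0 by (simp add: right_diff_distrib flip: power_add)
      also have "\<dots> \<le> q * (x / l ^ 10 - (real q)\<^sup>2 * (h * l ^ 6))"
        using q_ge qhM t by (intro mult_mono) auto
      finally show ?thesis .
    qed
    show "k * l ^ 6 + (x\<^sup>2 / (2 * l) + x / l ^ 10 * (2 * l ^ 6 * (x * l\<^sup>2))) + 2 * real k * ((real q)\<^sup>2 * (h * l ^ 6)) \<le> x\<^sup>2 / l"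
    proof -
      have "2 * x * ((real q)\<^sup>2 * (h * l ^ 6)) \<le> 2 * x * (32 * l ^ 28)"
        by (rule mult_left_mono[OF qhM]) (use x0 in simp)
      then show ?thesis unfolding x[symmetric] by (rule order_trans[OF add_left_mono E20])
    qed
    show "3 * F + x * l / 50000 \<le> x * l / 20000"
    proof -
      show ?thesis using E21 F_le by (simp add: mult.commute)
    qed
    show "1 \<le> l ^ 7" by (rule lp)
    \<comment> \<open>Only \<open>k ln \<Lambda>\<close> enters the main bound, which is
      \<open>o(k l)\<close> for any power of \<open>l\<close>; \<open>l^7\<close> dominates both
      \<open>1.26 l\<close> and \<open>l^6\<close>.\<close>
    show "103/100 * (p * m) / m \<le> l ^ 7 / k"
    proof -
      have "103/100 * (p * m) / m = 6283/5000 * l / x" unfolding p_def using m0 by simp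
      also have "\<dots> \<le> l ^ 7 / x"
      proof (rule divide_right_mono)
        have "(3/2) * l \<le> l * l" using E24 l0 by (intro mult_right_mono) auto
        also have "\<dots> = l\<^sup>2" by (simp add: power2_eq_square)
        also have "\<dots> \<le> l ^ 7" using l1 by (intro power_increasing) auto
        finally show "6283/5000 * l \<le> l ^ 7" using l0 by linarith
      qed (use x0 in simp)
      finally show ?thesis using x by simp
    qed
    show "k / m \<le> l ^ 7 / k"
    proof -
      have "k / m \<le> x / (x\<^sup>2 / l ^ 6)" unfolding x[symmetric] using m_ge x0 l0 m0 by (intro divide_left_mono mult_pos_pos) auto
      also have "\<dots> = l ^ 6 / x" using x0 by (simp add: power2_eq_square)
      also have "\<dots> \<le> l ^ 7 / x" using l1 x0 by (intro divide_right_mono power_increasing) auto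
      finally show ?thesis using x by simp
    qed
    show "57/50 * (ln (real k) / real k) \<le> (1 - exp (- 3)) * p"
    proof -
      have "57/50 * (l / x) \<le> 61/50 * (1 - exp (- 3)) * (l / x)"
        using exp_numeric_bounds(4) l0 x0 by (intro mult_right_mono) auto
      then show ?thesis unfolding p_def using x l by (simp add: mult_ac)
    qed
    show "0 \<le> ln (real k)" using l l0 x by simp
    show "real (n choose k) * ((real m ^ q * real (q + 1) ^ k * 2 ^ k)\<^sup>2 *
       exp (2 * k * ln (l ^ 7) + 6 * (x * l / 20000) - 1001/1000 * (k * ln (real k)) + 57/50 * ln (real k))) \<le> 1/64"
    proof (rule le_one_64_if_le_exp)
      let ?y = "2 * x * ln (l ^ 7) + 6 * (x * l / 20000) - 1001/1000 * (x * l) + 57/50 * l"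
      have a: "real m ^ q \<le> exp (8 * l ^ 11)"
      proof -
        have "real m ^ q \<le> exp (2 * l) ^ q" using m_le2 x2 by (intro power_mono) auto
        also have "\<dots> = exp (q * (2 * l))" by (simp flip: exp_of_nat_mult)
        also have "q * (2 * l) \<le> 4 * l ^ 10 * (2 * l)" using q_le l0 by (intro mult_right_mono) auto
        also have "\<dots> = 8 * l ^ 11" by (simp add: power_Suc2[symmetric])
        finally show ?thesis by simp
      qed
      have b: "real (q + 1) ^ k \<le> exp (x * ln (5 * l ^ 10))"
      proof -
        have "real (q + 1) \<le> 5 * l ^ 10" using q_le lp[of 10] by simp
        then have "real (q + 1) ^ k \<le> (5 * l ^ 10) ^ k" by (intro power_mono) auto
        also have "\<dots> = exp (ln (5 * l ^ 10)) ^ k" using lp0[of 10] by simp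
        also have "\<dots> = exp (x * ln (5 * l ^ 10))" unfolding x exp_of_nat_mult ..
        finally show ?thesis .
      qed
      have "real m ^ q * real (q + 1) ^ k * 2 ^ k \<le> exp (8 * l ^ 11) * exp (x * ln (5 * l ^ 10)) * exp x"
        using a b two_k by (intro mult_mono) auto
      also have "\<dots> = exp (8 * l ^ 11 + x * ln (5 * l ^ 10) + x)" by (simp add: exp_add)
      finally have "(real m ^ q * real (q + 1) ^ k * 2 ^ k)\<^sup>2 \<le> exp (8 * l ^ 11 + x * ln (5 * l ^ 10) + x) ^ 2"
        by (intro power_mono) auto
      also have "\<dots> = exp (2 * (8 * l ^ 11 + x * ln (5 * l ^ 10) + x))" by (rule exp_double[symmetric])
      finally have "(real m ^ q * real (q + 1) ^ k * 2 ^ k)\<^sup>2 * exp ?y \<le> exp (2 * (8 * l ^ 11 + x * ln (5 * l ^ 10) + x)) * exp ?y"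
        by (intro mult_right_mono) auto
      then have "real (n choose k) * ((real m ^ q * real (q + 1) ^ k * 2 ^ k)\<^sup>2 * exp ?y) \<le> exp (x * l) * (exp (2 * (8 * l ^ 11 + x * ln (5 * l ^ 10) + x)) * exp ?y)"
        by (rule mult_mono[OF choose']) simp_all
      then show "real (n choose k) * ((real m ^ q * real (q + 1) ^ k * 2 ^ k)\<^sup>2 *
         exp (2 * k * ln (l ^ 7) + 6 * (x * l / 20000) - 1001/1000 * (k * ln (real k)) + 57/50 * ln (real k)))
         \<le> exp (x * l + (2 * (8 * l ^ 11 + x * ln (5 * l ^ 10) + x) + ?y))"
        unfolding x l by (simp only: exp_add of_nat_mult of_nat_numeral)
      \<comment> \<open>The surplus \<open>k l / 1000\<close> pays for
        \<open>6 * \<tau> = 3 k l / 10000\<close>; all other terms, the number of records included,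
        are of lower order.\<close>
      show "x * l + (2 * (8 * l ^ 11 + x * ln (5 * l ^ 10) + x) + ?y) \<le> - 7"
        using E22 by (simp add: algebra_simps)
    qed
  qed
  then show ?thesis unfolding h_def q_def F_def .
qed

theorem theorem1p1:
  shows "\<forall>\<epsilon>>0. \<forall>\<^sub>F k in at_top.
           real (R3 k) \<ge> (1/3 - \<epsilon>) * (real k)\<^sup>2 / ln (real k)"
proof (intro allI impI)
  fix \<epsilon> :: real assume \<epsilon>: "0 < \<epsilon>"
  show "\<forall>\<^sub>F k in at_top. real (R3 k) \<ge> (1/3 - \<epsilon>) * (real k)\<^sup>2 / ln (real k)"
    using eventually_bounds
  proof eventually_elim
    fix k :: nat assume ev: "eventual_bounds (real k) (ln (real k))"
    let ?n = "nat \<lfloor>(real k)\<^sup>2 / (3 * ln (real k))\<rfloor>"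
    have l0: "0 < ln (real k)" using ev unfolding eventual_bounds_def by linarith
    obtain E :: "nat \<Rightarrow> nat \<Rightarrow> bool" where "simple_graph {..<?n} E" "\<not> has_triangle {..<?n} E" "\<not> has_indep_set_of_size {..<?n} E k"
      using two_bites.ex_ramsey_graph[OF two_bites_instance[OF refl refl ev]] by (elim exE conjE)
    then have "?n < R3 k" by (rule less_R3)
    \<comment> \<open>Rounding down costs nothing: the strict inequality for \<open>R3 k\<close>
      gives back the 1 lost in the floor.\<close>
    moreover have "(real k)\<^sup>2 / (3 * ln (real k)) < real ?n + 1" by linarith
    ultimately have "(real k)\<^sup>2 / (3 * ln (real k)) \<le> real (R3 k)" by linarith
    moreover have "(1/3 - \<epsilon>) * (real k)\<^sup>2 / ln (real k) \<le> 1/3 * (real k)\<^sup>2 / ln (real k)"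
      using \<epsilon> l0 by (intro divide_right_mono mult_right_mono) auto
    ultimately show "(1/3 - \<epsilon>) * (real k)\<^sup>2 / ln (real k) \<le> real (R3 k)" by simp
  qed
qed

end
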